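(* Every graph with at most 20 edges is $2$-apex.
   Context: Graphs are finite and simple. A graph is $2$-apex if it becomes planar after the deletion of at most two vertices (together with their incident edges). *)

theory Defs
  imports "HOL-Analysis.Analysis"
begin

text \<open>
  A graph is given by its vertex set \<open>V\<close> and its edge set \<open>E\<close>, an edge being the set of
  its two ends.
\<close>

definition simple_graph :: "'a set \<Rightarrow> 'a set set \<Rightarrow> bool" where
  "simple_graph V E \<longleftrightarrow> finite V \<and> (\<forall>e\<in>E. e \<subseteq> V \<and> card e = 2)"

text \<open>
  A drawing without crossings, with \<^typ>\<open>complex\<close> as the plane (as in the Jordan curve theorem of
  the library). Edges are arbitrary topological arcs; the orientation of the arc is irrelevant.
  The third condition keeps an edge from passing through a vertex other than its ends, and by the
  fourth two edges meet at most in common ends.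
\<close>

definition plane_drawing ::
    "'a set \<Rightarrow> 'a set set \<Rightarrow> ('a \<Rightarrow> complex) \<Rightarrow> ('a set \<Rightarrow> real \<Rightarrow> complex) \<Rightarrow> bool" where
  "plane_drawing V E p \<gamma> \<longleftrightarrow>
     inj_on p V \<and>
     (\<forall>e\<in>E. arc (\<gamma> e) \<and> {pathstart (\<gamma> e), pathfinish (\<gamma> e)} = p ` e) \<and>
     (\<forall>e\<in>E. \<forall>v\<in>V. p v \<in> path_image (\<gamma> e) \<longrightarrow> v \<in> e) \<and>
     (\<forall>e\<in>E. \<forall>f\<in>E. e \<noteq> f \<longrightarrow> path_image (\<gamma> e) \<inter> path_image (\<gamma> f) \<subseteq> p ` (e \<inter> f))"

definition planar :: "'a set \<Rightarrow> 'a set set \<Rightarrow> bool" where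
  "planar V E \<longleftrightarrow> (\<exists>p \<gamma>. plane_drawing V E p \<gamma>)"

definition two_apex :: "'a set \<Rightarrow> 'a set set \<Rightarrow> bool" where
  "two_apex V E \<longleftrightarrow>
     (\<exists>S\<subseteq>V. finite S \<and> card S \<le> 2 \<and> planar (V - S) {e \<in> E. e \<inter> S = {}})"

end

theory Submission imports Defs begin

text \<open>
  A nonplanar graph with at most 12 edges contains a subdivision of
  \<open>K\<^sub>3\<^sub>,\<^sub>3\<close> or \<open>K\<^sub>5\<close>, so few edges remain
  undetermined. Put back one vertex: a graph with at most 14 edges becomes planar by deleting one
  vertex, and the graphs with 15 edges, minimum degree 3, maximum degree at most 5 and at least 8
  vertices for which this fails are four members of the Petersen family. Now let \<open>G\<close> be a
  counterexample with as few vertices as possible. Its minimum degree is at least 3, it may be assumed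
  to have exactly 20 edges, and its maximum degree is at most 5 by the bound 14. If a vertex has degree
  5, its removal leaves a member of the Petersen family, unless \<open>G\<close> has only 8 vertices and
  is regular. If the maximum degree is 4 and some vertex \<open>a\<close> of degree 4 has a neighbour
  \<open>r\<close> of degree 3, then \<open>G - a\<close> is a member of the Petersen family with one
  edge subdivided by \<open>r\<close>; if there is no such pair, \<open>G\<close> is regular or the
  vertices of degree 3 form a component \<open>K\<^sub>4\<close>. Regular graphs are treated by removing
  two nonadjacent vertices. In all cases the remaining finite choices are eliminated by search trees, in
  which planarity is witnessed by embeddings in a book with two pages.
\<close>

section \<open>Thick drawings\<close>

text \<open>The argument only ever exhibits drawings. A candidate counterexample is either drawn
  after deletions or shown to contain a listed graph, and what one search cannot draw becomes the
  starting point of the next, with one more vertex. Starting from a large known subgraph is what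
  keeps the trees small. Minimum degree 3 makes the searches finite, since it bounds the number of
  vertices by two thirds of the number of edges. The constants fit together. A nonplanar graph has
  at least 9 edges, the number for K_{3,3}, so with 14 edges a vertex of degree at least 6 would
  leave only 8. With 20 edges such a vertex leaves at most 14, one of degree 5 leaves 15, and one of
  degree 4 leaves 16, which becomes 15 when a vertex of degree 2 is smoothed. The obstacle is
  topological: undoing the removal of a vertex of degree 2 means drawing a path alongside an
  arbitrary arc. This needs a neighbourhood of the arc, so drawings carry such neighbourhoods from
  the start, and ordinary planarity is derived once, at the end.\<close>

abbreviation sq :: "(real \<times> real) set" where "sq \<equiv> {0..1} \<times> {-1..1}"
abbreviation strip :: "(real \<times> real) set" where "strip \<equiv> {0<..<1} \<times> {-1..1}"

text \<open>
  Thick drawings replace every arc by a strip that is pinched at the two ends, which leaves room next to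
  an edge for further edges.
\<close>

definition band :: "(real \<times> real \<Rightarrow> complex) \<Rightarrow> complex \<Rightarrow> complex \<Rightarrow> bool" where
  "band \<phi> a b \<longleftrightarrow> continuous_on sq \<phi> \<and> inj_on \<phi> strip \<and>
     (\<forall>u\<in>{-1..1}. \<phi> (0, u) = a \<and> \<phi> (1, u) = b)"

definition thick_drawing ::
    "'a set \<Rightarrow> 'a set set \<Rightarrow> ('a \<Rightarrow> complex) \<Rightarrow> ('a set \<Rightarrow> real \<times> real \<Rightarrow> complex) \<Rightarrow> bool" where
  "thick_drawing V E p \<phi> \<longleftrightarrow>
     inj_on p V \<and>
     (\<forall>e\<in>E. \<exists>x\<in>V. \<exists>y\<in>V. x \<noteq> y \<and> e = {x, y} \<and> band (\<phi> e) (p x) (p y)) \<and>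
     (\<forall>e\<in>E. \<phi> e ` strip \<inter> p ` V = {}) \<and>
     (\<forall>e\<in>E. \<forall>f\<in>E. e \<noteq> f \<longrightarrow> \<phi> e ` strip \<inter> \<phi> f ` strip = {})"

definition thick :: "'a set \<Rightarrow> 'a set set \<Rightarrow> bool" where
  "thick V E \<longleftrightarrow> (\<exists>p \<phi>. thick_drawing V E p \<phi>)"

lemma thick_drawing_edgeE:
  assumes "thick_drawing V E p \<phi>" "e \<in> E"
  obtains x y where "x \<in> V" "y \<in> V" "x \<noteq> y" "e = {x, y}" "band (\<phi> e) (p x) (p y)"
  using assms unfolding thick_drawing_def by (elim conjE) (drule (1) bspec, elim bexE conjE, rule that)

lemma thick_drawingD:
  assumes "thick_drawing V E p \<phi>"
  shows "inj_on p V" "e \<in> E \<Longrightarrow> \<phi> e ` strip \<inter> p ` V = {}"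
    "e \<in> E \<Longrightarrow> f \<in> E \<Longrightarrow> e \<noteq> f \<Longrightarrow> \<phi> e ` strip \<inter> \<phi> f ` strip = {}"
  using assms by (simp_all add: thick_drawing_def)

lemma thick_edge_subset: "thick V E \<Longrightarrow> e \<in> E \<Longrightarrow> e \<subseteq> V \<and> card e = 2"
  unfolding thick_def by (elim exE, erule (1) thick_drawing_edgeE) simp

text \<open>The centre line \<open>u = 0\<close> of each band is an arc whose interior lies in the
  open strip. The strips avoid the vertices and each other, so two such arcs can share only
  ends.\<close>

lemma thick_imp_planar:
  assumes "thick V E"
  shows "planar V E"
proof -
  obtain p \<phi> where d: "thick_drawing V E p \<phi>" using assms by (auto simp: thick_def)
  define \<gamma> where "\<gamma> e t = \<phi> e (t, 0)" for e t
  have inj: "inj_on p V" using d by (simp add: thick_drawing_def)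
  have edge: "\<exists>x\<in>V. \<exists>y\<in>V. x \<noteq> y \<and> e = {x, y} \<and> \<gamma> e 0 = p x \<and> \<gamma> e 1 = p y \<and> arc (\<gamma> e) \<and>
      path_image (\<gamma> e) \<subseteq> {p x, p y} \<union> \<phi> e ` strip" if e: "e \<in> E" for e
  proof -
    obtain x y where xy: "x \<in> V" "y \<in> V" "x \<noteq> y" "e = {x, y}" and b: "band (\<phi> e) (p x) (p y)"
      using thick_drawing_edgeE[OF d e] .
    have av: "\<phi> e ` strip \<inter> p ` V = {}" using d e by (simp add: thick_drawing_def)
    have ends: "\<gamma> e 0 = p x" "\<gamma> e 1 = p y" using b by (auto simp: band_def \<gamma>_def)
    have inner: "\<gamma> e t \<in> \<phi> e ` strip" if "0 < t" "t < 1" for t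
      using that by (auto simp: \<gamma>_def)
    have "continuous_on {0..1} (\<lambda>t. \<phi> e (t, 0))"
      by (rule continuous_on_compose2[of sq "\<phi> e"]) (use b in \<open>auto simp: band_def intro!: continuous_intros\<close>)
    hence path: "path (\<gamma> e)" by (simp add: path_def \<gamma>_def[abs_def])
    have "s = t" if st: "0 \<le> s" "s < t" "t \<le> 1" "\<gamma> e s = \<gamma> e t" for s t
    proof -
      have "p x \<noteq> p y" using xy inj by (auto dest: inj_onD)
      \<comment> \<open>A band is injective on the open strip only. A coincidence involving an end
        of the arc would put a vertex inside a strip.\<close>
      consider "s = 0" "t = 1" | "s = 0" "t < 1" | "0 < s" "t = 1" | "0 < s" "t < 1" using st by linarith
      then show ?thesis
      proof cases
        case 1 then show ?thesis using ends st \<open>p x \<noteq> p y\<close> by auto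
      next
        case 2
        then have "p x \<in> \<phi> e ` strip" using inner[of t] ends(1) st by simp
        then show ?thesis using av xy(1) by blast
      next
        case 3
        then have "p y \<in> \<phi> e ` strip" using inner[of s] ends(2) st by simp
        then show ?thesis using av xy(2) by blast
      next
        case 4
        have "inj_on (\<phi> e) strip" using b by (simp add: band_def)
        moreover have "(s, 0) \<in> strip" "(t, 0) \<in> strip" using st 4 by auto
        ultimately have "(s, 0::real) = (t, 0)" using st(4) unfolding \<gamma>_def by (metis inj_onD)
        thus ?thesis by simp
      qed
    qed
    hence "inj_on (\<gamma> e) {0..1}" by (intro linorder_inj_onI') (auto simp: less_le)
    hence arc: "arc (\<gamma> e)" using path by (simp add: arc_def)
    have "\<gamma> e t \<in> {p x, p y} \<union> \<phi> e ` strip" if "0 \<le> t" "t \<le> 1" for t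
      using that ends inner[of t] by (cases "t = 0"; cases "t = 1") auto
    hence "path_image (\<gamma> e) \<subseteq> {p x, p y} \<union> \<phi> e ` strip" by (force simp: path_image_def)
    thus ?thesis using xy ends arc by blast
  qed
  have img: "path_image (\<gamma> e) \<subseteq> p ` e \<union> \<phi> e ` strip \<and> e \<subseteq> V" if "e \<in> E" for e
    using edge[OF that] by auto
  have "plane_drawing V E p \<gamma>"
    unfolding plane_drawing_def
  proof (intro conjI ballI impI)
    show "inj_on p V" by (rule inj)
    show "arc (\<gamma> e)" if "e \<in> E" for e using edge[OF that] by blast
    show "{pathstart (\<gamma> e), pathfinish (\<gamma> e)} = p ` e" if "e \<in> E" for e
      using edge[OF that] by (auto simp: pathstart_def pathfinish_def)
    show "v \<in> e" if "e \<in> E" "v \<in> V" "p v \<in> path_image (\<gamma> e)" for e v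
    proof -
      have "p v \<notin> \<phi> e ` strip" using d that by (auto simp: thick_drawing_def)
      hence "p v \<in> p ` e" using img[OF that(1)] that(3) by blast
      thus ?thesis using img[OF that(1)] that(2) inj by (metis inj_on_image_mem_iff)
    qed
    show "path_image (\<gamma> e) \<inter> path_image (\<gamma> f) \<subseteq> p ` (e \<inter> f)" if "e \<in> E" "f \<in> E" "e \<noteq> f" for e f
    proof -
      have gen: "A \<inter> B \<subseteq> Z" if "A \<subseteq> P \<union> X" "B \<subseteq> Q \<union> Y" "X \<inter> Y = {}" "X \<inter> W = {}" "Y \<inter> W = {}"
          "P \<subseteq> W" "Q \<subseteq> W" "P \<inter> Q = Z" for A B P Q X Y W Z :: "complex set"
        using that by blast
      have sub: "path_image (\<gamma> e) \<subseteq> p ` e \<union> \<phi> e ` strip" "path_image (\<gamma> f) \<subseteq> p ` f \<union> \<phi> f ` strip"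
          "e \<subseteq> V" "f \<subseteq> V"
        using img that by simp_all
      show ?thesis
        by (rule gen[OF sub(1,2) thick_drawingD(3)[OF d that] thick_drawingD(2)[OF d that(1)]
              thick_drawingD(2)[OF d that(2)] image_mono[OF sub(3)] image_mono[OF sub(4)]])
           (rule inj_on_image_Int[OF inj sub(3,4), symmetric])
    qed
  qed
  thus ?thesis by (auto simp: planar_def)
qed

lemma thick_mono:
  assumes "thick V E" "V' \<subseteq> V" "E' \<subseteq> E" "\<And>e. e \<in> E' \<Longrightarrow> e \<subseteq> V'"
  shows "thick V' E'"
proof -
  obtain p \<phi> where d: "thick_drawing V E p \<phi>" using assms by (auto simp: thick_def)
  have "thick_drawing V' E' p \<phi>" unfolding thick_drawing_def
  proof (intro conjI ballI impI)
    show "inj_on p V'" using d assms(2) by (auto simp: thick_drawing_def intro: inj_on_subset)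
    show "\<exists>x\<in>V'. \<exists>y\<in>V'. x \<noteq> y \<and> e = {x, y} \<and> band (\<phi> e) (p x) (p y)" if e: "e \<in> E'" for e
    proof -
      obtain x y where xy: "x \<noteq> y" "e = {x, y}" "band (\<phi> e) (p x) (p y)"
        using thick_drawing_edgeE[OF d subsetD[OF assms(3) e]] .
      moreover have "x \<in> V'" "y \<in> V'" using assms(4)[OF e] xy(2) by auto
      ultimately show ?thesis by (intro bexI[of _ x] bexI[of _ y]) simp_all
    qed
    show "\<phi> e ` strip \<inter> p ` V' = {}" if e: "e \<in> E'" for e
    proof -
      have "\<phi> e ` strip \<inter> p ` V = {}" using thick_drawingD(2)[OF d] e assms(3) by blast
      thus ?thesis using assms(2) by blast
    qed
    show "\<phi> e ` strip \<inter> \<phi> f ` strip = {}" if "e \<in> E'" "f \<in> E'" "e \<noteq> f" for e f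
      using thick_drawingD(3)[OF d] that assms(3) by (meson subsetD)
  qed
  thus ?thesis by (auto simp: thick_def)
qed

text \<open>This cuts a narrower band out of a given one: \<open>G\<close> selects a part of the
  square. The new ends are the points to which the two vertical sides are sent, so an end may be an
  old vertex or an interior point of the old band.\<close>

lemma band_reparam:
  assumes "band \<phi> a b" "continuous_on sq G" "G ` sq \<subseteq> sq" "inj_on G strip" "G ` strip \<subseteq> strip"
    and "\<And>u. u \<in> {-1..1} \<Longrightarrow> \<phi> (G (0, u)) = a' \<and> \<phi> (G (1, u)) = b'"
  shows "band (\<phi> \<circ> G) a' b'"
proof -
  have "continuous_on sq (\<phi> \<circ> G)"
    by (rule continuous_on_compose[OF assms(2)])
       (use assms(1,3) in \<open>auto simp: band_def intro: continuous_on_subset\<close>)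
  moreover have "inj_on (\<phi> \<circ> G) strip"
    by (rule comp_inj_on[OF assms(4)]) (use assms(1,5) in \<open>auto simp: band_def intro: inj_on_subset\<close>)
  ultimately show ?thesis using assms(6) by (simp add: band_def)
qed

text \<open>The band of an edge \<open>xy\<close> is wide enough to hold the edge itself and, next to it, a path \<open>xvy\<close>.\<close>

lemma thick_parallel_path:
  assumes "thick V E" "{x, y} \<in> E" "v \<notin> V"
  shows "thick (insert v V) (insert {v, x} (insert {v, y} E))"
proof -
  obtain p \<phi> where d: "thick_drawing V E p \<phi>" using assms by (auto simp: thick_def)
  obtain a b where ab: "a \<in> V" "b \<in> V" "a \<noteq> b" "{x, y} = {a, b}" and bd: "band (\<phi> {x, y}) (p a) (p b)"
    using thick_drawing_edgeE[OF d assms(2)] .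
  define \<psi> where "\<psi> = \<phi> {x, y}"
  \<comment> \<open>The square is cut into three pieces. \<open>G0\<close> maps to the lower third
    and carries the old edge. \<open>G1\<close> and \<open>G2\<close> map to the left and right
    halves of the upper third; both are pinched at (1/2, 2/3), where the new vertex is placed, and
    widen linearly towards the old ends.\<close>
  define G0 where "G0 = (\<lambda>(t::real, u::real). (t, (u - 2) / 3))"
  define G1 where "G1 = (\<lambda>(t::real, u::real). (t / 2, 2 / 3 + u * (1 - t) / 3))"
  define G2 where "G2 = (\<lambda>(t::real, u::real). ((1 + t) / 2, 2 / 3 + u * t / 3))"
  define q where "q = p(v := \<psi> (1/2, 2/3))"
  define \<rho> where "\<rho> = \<phi>({a, b} := \<psi> \<circ> G0, {v, a} := \<psi> \<circ> G1, {v, b} := \<psi> \<circ> G2)"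
  have bd': "band \<psi> (p a) (p b)" using bd by (simp add: \<psi>_def)
  have va: "v \<noteq> a" "v \<noteq> b" using ab assms(3) by auto
  have EV: "e \<subseteq> V" if "e \<in> E" for e using thick_edge_subset[OF assms(1) that] by simp
  have vE: "{v, a} \<notin> E" "{v, b} \<notin> E" using EV assms(3) by blast+
  have ends: "\<psi> (0, u) = p a" "\<psi> (1, u) = p b" if "u \<in> {-1..1}" for u
    using bd' that by (auto simp: band_def)
  have prod01: "-1 \<le> u * t" "u * t \<le> 1" if "-1 \<le> u" "u \<le> 1" "0 \<le> t" "t \<le> 1" for u t :: real
  proof -
    have "\<bar>u * t\<bar> \<le> 1" using that by (simp add: abs_mult mult_le_one)
    thus "-1 \<le> u * t" "u * t \<le> 1" by linarith+
  qed
  have sub0: "G0 ` sq \<subseteq> {0..1} \<times> {-1..-1/3}" "G0 ` strip \<subseteq> {0<..<1} \<times> {-1..-1/3}"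
    by (auto simp: G0_def)
  have G1: "G1 (t, u) \<in> {t / 2} \<times> {1/3..1}" if "(t, u) \<in> sq" for t u
    using prod01[of u "1 - t"] that by (simp add: G1_def)
  have G2: "G2 (t, u) \<in> {(1 + t) / 2} \<times> {1/3..1}" if "(t, u) \<in> sq" for t u
    using prod01[of u t] that by (simp add: G2_def)
  have sub1: "G1 ` sq \<subseteq> {0..1/2} \<times> {1/3..1}" "G1 ` strip \<subseteq> {0<..<1/2} \<times> {1/3..1}"
  proof -
    show "G1 ` sq \<subseteq> {0..1/2} \<times> {1/3..1}"
    proof (intro image_subsetI)
      fix z assume "z \<in> sq"
      thus "G1 z \<in> {0..1/2} \<times> {1/3..1}" using G1[of "fst z" "snd z"] by (cases z) auto
    qed
    show "G1 ` strip \<subseteq> {0<..<1/2} \<times> {1/3..1}"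
    proof (intro image_subsetI)
      fix z assume "z \<in> strip"
      thus "G1 z \<in> {0<..<1/2} \<times> {1/3..1}" using G1[of "fst z" "snd z"] by (cases z) auto
    qed
  qed
  have sub2: "G2 ` sq \<subseteq> {1/2..1} \<times> {1/3..1}" "G2 ` strip \<subseteq> {1/2<..<1} \<times> {1/3..1}"
  proof -
    show "G2 ` sq \<subseteq> {1/2..1} \<times> {1/3..1}"
    proof (intro image_subsetI)
      fix z assume "z \<in> sq"
      thus "G2 z \<in> {1/2..1} \<times> {1/3..1}" using G2[of "fst z" "snd z"] by (cases z) auto
    qed
    show "G2 ` strip \<subseteq> {1/2<..<1} \<times> {1/3..1}"
    proof (intro image_subsetI)
      fix z assume "z \<in> strip"
      thus "G2 z \<in> {1/2<..<1} \<times> {1/3..1}" using G2[of "fst z" "snd z"] by (cases z) auto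
    qed
  qed
  have b0: "band (\<psi> \<circ> G0) (p a) (p b)"
  proof (rule band_reparam[OF bd'])
    show "continuous_on sq G0" unfolding G0_def by (auto simp: case_prod_beta intro!: continuous_intros)
    show "inj_on G0 strip" by (auto simp: inj_on_def G0_def)
    show "G0 ` sq \<subseteq> sq" "G0 ` strip \<subseteq> strip" using sub0 by force+
    show "\<psi> (G0 (0, u)) = p a \<and> \<psi> (G0 (1, u)) = p b" if "u \<in> {-1..1}" for u
      using that by (auto simp: G0_def intro!: ends)
  qed
  have b1: "band (\<psi> \<circ> G1) (p a) (q v)"
  proof (rule band_reparam[OF bd'])
    show "continuous_on sq G1" unfolding G1_def by (auto simp: case_prod_beta intro!: continuous_intros)
    show "inj_on G1 strip" by (auto simp: inj_on_def G1_def)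
    show "G1 ` sq \<subseteq> sq" "G1 ` strip \<subseteq> strip" using sub1 by force+
    show "\<psi> (G1 (0, u)) = p a \<and> \<psi> (G1 (1, u)) = q v" if "u \<in> {-1..1}" for u
      using that by (auto simp: G1_def q_def intro!: ends)
  qed
  have b2: "band (\<psi> \<circ> G2) (q v) (p b)"
  proof (rule band_reparam[OF bd'])
    show "continuous_on sq G2" unfolding G2_def by (auto simp: case_prod_beta intro!: continuous_intros)
    show "inj_on G2 strip" by (auto simp: inj_on_def G2_def)
    show "G2 ` sq \<subseteq> sq" "G2 ` strip \<subseteq> strip" using sub2 by force+
    show "\<psi> (G2 (0, u)) = q v \<and> \<psi> (G2 (1, u)) = p b" if "u \<in> {-1..1}" for u
      using that by (auto simp: G2_def q_def intro!: ends)
  qed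
  have inj\<psi>: "inj_on \<psi> strip" using bd' by (simp add: band_def)
  have disj: "\<psi> ` X \<inter> \<psi> ` Y = {}" if "X \<inter> Y = {}" "X \<subseteq> strip" "Y \<subseteq> strip" for X Y
    using that inj\<psi> by (metis image_empty inj_on_image_Int)
  have c0: "(\<psi> \<circ> G0) ` strip \<subseteq> \<psi> ` ({0<..<1} \<times> {-1..-1/3})"
    unfolding image_comp[symmetric] by (rule image_mono[OF sub0(2)])
  have c1: "(\<psi> \<circ> G1) ` strip \<subseteq> \<psi> ` ({0<..<1/2} \<times> {1/3..1})"
    unfolding image_comp[symmetric] by (rule image_mono[OF sub1(2)])
  have c2: "(\<psi> \<circ> G2) ` strip \<subseteq> \<psi> ` ({1/2<..<1} \<times> {1/3..1})"
    unfolding image_comp[symmetric] by (rule image_mono[OF sub2(2)])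
  have qv: "q v \<in> \<psi> ` {(1/2, 2/3)}" by (simp add: q_def)
  have X: "\<psi> ` ({0<..<1} \<times> {-1..-1/3}) \<inter> \<psi> ` ({0<..<1/2} \<times> {1/3..1}) = {}"
     "\<psi> ` ({0<..<1} \<times> {-1..-1/3}) \<inter> \<psi> ` ({1/2<..<1} \<times> {1/3..1}) = {}"
     "\<psi> ` ({0<..<1/2} \<times> {1/3..1}) \<inter> \<psi> ` ({1/2<..<1} \<times> {1/3..1}) = {}"
     "\<psi> ` ({0<..<1} \<times> {-1..-1/3}) \<inter> \<psi> ` {(1/2, 2/3)} = {}"
     "\<psi> ` ({0<..<1/2} \<times> {1/3..1}) \<inter> \<psi> ` {(1/2, 2/3)} = {}"
     "\<psi> ` ({1/2<..<1} \<times> {1/3..1}) \<inter> \<psi> ` {(1/2, 2/3)} = {}"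
    by (rule disj; force)+
  have C: "(\<psi> \<circ> G0) ` strip \<subseteq> \<psi> ` strip" "(\<psi> \<circ> G1) ` strip \<subseteq> \<psi> ` strip" "(\<psi> \<circ> G2) ` strip \<subseteq> \<psi> ` strip"
      "q v \<in> \<psi> ` strip"
  proof -
    show "(\<psi> \<circ> G0) ` strip \<subseteq> \<psi> ` strip" by (rule order_trans[OF c0]) (rule image_mono, force)
    show "(\<psi> \<circ> G1) ` strip \<subseteq> \<psi> ` strip" by (rule order_trans[OF c1]) (rule image_mono, force)
    show "(\<psi> \<circ> G2) ` strip \<subseteq> \<psi> ` strip" by (rule order_trans[OF c2]) (rule image_mono, force)
    show "q v \<in> \<psi> ` strip" by (auto simp: q_def)
  qed
  have av: "\<psi> ` strip \<inter> p ` V = {}" unfolding \<psi>_def by (rule thick_drawingD(2)[OF d assms(2)])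
  have avE: "\<phi> e ` strip \<inter> p ` V = {}" "e \<noteq> {a, b} \<Longrightarrow> \<phi> e ` strip \<inter> \<psi> ` strip = {}" if "e \<in> E" for e
    using thick_drawingD(2)[OF d that] thick_drawingD(3)[OF d that assms(2)] ab(4) unfolding \<psi>_def by auto
  have \<rho>: "\<rho> {a, b} = \<psi> \<circ> G0" "\<rho> {v, a} = \<psi> \<circ> G1" "\<rho> {v, b} = \<psi> \<circ> G2"
    "\<And>e. e \<in> E \<Longrightarrow> e \<noteq> {a, b} \<Longrightarrow> \<rho> e = \<phi> e"
    using va ab(3) vE by (auto simp: \<rho>_def doubleton_eq_iff)
  have qV: "q ` V = p ` V" using assms(3) by (auto simp: q_def)
  have qx: "q z = p z" if "z \<in> V" for z using that assms(3) by (auto simp: q_def)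
  let ?E = "insert {v, a} (insert {v, b} E)"
  have cases: "e = {v, a} \<or> e = {v, b} \<or> e = {a, b} \<or> (e \<in> E \<and> e \<noteq> {a, b})" if "e \<in> ?E" for e
    using that by auto
  have disjoint_mono: "A \<inter> B = {} \<Longrightarrow> C \<subseteq> B \<Longrightarrow> A \<inter> C = {}" for A B C :: "complex set" by auto
  have disjoint_mono2: "A \<subseteq> A' \<Longrightarrow> C \<subseteq> C' \<Longrightarrow> A' \<inter> C' = {} \<Longrightarrow> A \<inter> C = {}" for A A' C C' :: "complex set" by auto
  note D01 = disjoint_mono2[OF c0 c1 X(1)] and D02 = disjoint_mono2[OF c0 c2 X(2)] and D12 = disjoint_mono2[OF c1 c2 X(3)]
  have DE: "\<rho> g ` strip \<inter> \<psi> ` strip = {}" if "g \<in> E" "g \<noteq> {a, b}" for g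
    using avE(2)[OF that] \<rho>(4)[OF that] by simp
  have Y: "\<rho> g ` strip \<subseteq> \<psi> ` strip" if "g \<in> {{v, a}, {v, b}, {a, b}}" for g
    using that \<rho>(1-3) C(1-3) by (elim insertE emptyE) simp_all
  have avoid: "A \<inter> p ` V = {} \<and> q v \<notin> A" if "A \<subseteq> B" "A \<subseteq> \<psi> ` strip" "B \<inter> \<psi> ` {(1/2, 2/3)} = {}" for A B
    using that av qv by (metis disjoint_iff subsetD)
  have "thick_drawing (insert v V) ?E q \<rho>"
    unfolding thick_drawing_def
  proof (intro conjI ballI impI)
    have "inj_on p V" using d by (simp add: thick_drawing_def)
    hence "inj_on q V" by (rule inj_on_cong[THEN iffD1, rotated]) (simp add: qx)
    thus "inj_on q (insert v V)" using C(4) av qV assms(3) by (auto simp: inj_on_insert)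
    show "\<exists>x\<in>insert v V. \<exists>y\<in>insert v V. x \<noteq> y \<and> e = {x, y} \<and> band (\<rho> e) (q x) (q y)" if "e \<in> ?E" for e
      using cases[OF that]
    proof (elim disjE)
      assume "e = {v, a}" thus ?thesis using \<rho> b1 va ab qx by (intro bexI[of _ a] bexI[of _ v]) auto
    next
      assume "e = {v, b}" thus ?thesis using \<rho> b2 va ab qx by (intro bexI[of _ v] bexI[of _ b]) auto
    next
      assume "e = {a, b}" thus ?thesis using \<rho> b0 va ab qx by (intro bexI[of _ a] bexI[of _ b]) auto
    next
      assume e: "e \<in> E \<and> e \<noteq> {a, b}"
      obtain x y where "x \<in> V" "y \<in> V" "x \<noteq> y" "e = {x, y}" "band (\<phi> e) (p x) (p y)"
        using thick_drawing_edgeE[OF d conjunct1[OF e]] .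
      thus ?thesis using e \<rho>(4)[of e] qx by (intro bexI[of _ x] bexI[of _ y]) auto
    qed
    show "\<rho> e ` strip \<inter> q ` insert v V = {}" if "e \<in> ?E" for e
    proof -
      have "\<rho> e ` strip \<inter> p ` V = {} \<and> q v \<notin> \<rho> e ` strip"
        using cases[OF that]
      proof (elim disjE)
        assume "e = {v, a}" thus ?thesis using avoid[OF c1 C(2) X(5)] \<rho>(2) by simp
      next
        assume "e = {v, b}" thus ?thesis using avoid[OF c2 C(3) X(6)] \<rho>(3) by simp
      next
        assume "e = {a, b}" thus ?thesis using avoid[OF c0 C(1) X(4)] \<rho>(1) by simp
      next
        assume e: "e \<in> E \<and> e \<noteq> {a, b}"
        hence "q v \<notin> \<phi> e ` strip" using avE(2)[of e] C(4) by (meson disjoint_iff)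
        thus ?thesis using avE(1)[of e] e \<rho>(4)[of e] by simp
      qed
      thus ?thesis unfolding image_insert qV by simp
    qed
    show "\<rho> e ` strip \<inter> \<rho> f ` strip = {}" if H: "e \<in> ?E" "f \<in> ?E" "e \<noteq> f" for e f
    proof -
      let ?T = "{{v, a}, {v, b}, {a, b}}"
      have e: "e \<in> ?T" if "\<not> (e \<in> E \<and> e \<noteq> {a, b})" using cases[OF H(1)] that by simp
      have f: "f \<in> ?T" if "\<not> (f \<in> E \<and> f \<noteq> {a, b})" using cases[OF H(2)] that by simp
      have TT: ?thesis if "e \<in> ?T" "f \<in> ?T"
        using that H(3) D01 D02 D12 \<rho>(1-3) by (elim insertE emptyE) (simp_all add: Int_commute)
      show ?thesis
      proof (cases "e \<in> E \<and> e \<noteq> {a, b}"; cases "f \<in> E \<and> f \<noteq> {a, b}")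
        assume "e \<in> E \<and> e \<noteq> {a, b}" "f \<in> E \<and> f \<noteq> {a, b}"
        thus ?thesis using thick_drawingD(3)[OF d _ _ H(3)] \<rho>(4) by simp
      next
        assume "e \<in> E \<and> e \<noteq> {a, b}" "\<not> (f \<in> E \<and> f \<noteq> {a, b})"
        thus ?thesis using disjoint_mono[OF DE[of e] Y[OF f]] by simp
      next
        assume "\<not> (e \<in> E \<and> e \<noteq> {a, b})" "f \<in> E \<and> f \<noteq> {a, b}"
        thus ?thesis using disjoint_mono[OF DE[of f] Y[OF e]] by (simp add: Int_commute)
      next
        assume "\<not> (e \<in> E \<and> e \<noteq> {a, b})" "\<not> (f \<in> E \<and> f \<noteq> {a, b})"
        thus ?thesis using TT e f by simp
      qed
    qed
  qed
  moreover have "?E = insert {v, x} (insert {v, y} E)" using ab(4) by (auto simp: doubleton_eq_iff)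
  ultimately show ?thesis by (auto simp: thick_def)
qed

section \<open>Using the free space outside a bounded drawing\<close>

lemma thick_drawing_bounded:
  assumes "thick_drawing V E p \<phi>" "finite V" "finite E"
  obtains R where "\<And>v. v \<in> V \<Longrightarrow> norm (p v) < R" "\<And>e z. e \<in> E \<Longrightarrow> z \<in> \<phi> e ` strip \<Longrightarrow> norm z < R"
proof -
  have "bounded (\<phi> e ` sq)" if "e \<in> E" for e
  proof -
    have "continuous_on sq (\<phi> e)" by (rule thick_drawing_edgeE[OF assms(1) that]) (simp add: band_def)
    thus ?thesis by (intro compact_imp_bounded compact_continuous_image compact_Times) auto
  qed
  moreover define K where "K = p ` V \<union> (\<Union>e\<in>E. \<phi> e ` sq)"
  ultimately have "bounded K" using assms by (auto intro: finite_imp_bounded)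
  then obtain R where R: "\<And>z. z \<in> K \<Longrightarrow> norm z < R"
    unfolding bounded_pos_less by blast
  have "strip \<subseteq> sq" by auto
  show thesis
  proof (rule that)
    show "norm (p v) < R" if "v \<in> V" for v using R that unfolding K_def by blast
    show "norm z < R" if "e \<in> E" "z \<in> \<phi> e ` strip" for e z
      using R[of z] that image_mono[OF \<open>strip \<subseteq> sq\<close>, of "\<phi> e"] unfolding K_def by blast
  qed
qed

lemma thick_isolated_vertex:
  assumes "thick V E" "finite V" "finite E" "v \<notin> V"
  shows "thick (insert v V) E"
proof -
  obtain p \<phi> where d: "thick_drawing V E p \<phi>" using assms by (auto simp: thick_def)
  obtain R where R: "\<And>v. v \<in> V \<Longrightarrow> norm (p v) < R" "\<And>e z. e \<in> E \<Longrightarrow> z \<in> \<phi> e ` strip \<Longrightarrow> norm z < R"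
    using thick_drawing_bounded[OF d assms(2,3)] by metis
  \<comment> \<open>The old drawing lies strictly inside the circle of radius \<open>R\<close>, so
    the point \<open>R\<close> on the real axis is free.\<close>
  define q where "q = p(v := of_real R)"
  have nq: "norm (q v) \<ge> R" by (simp add: q_def)
  have qV: "q z = p z" if "z \<in> V" for z using that assms(4) by (auto simp: q_def)
  hence im: "q ` V = p ` V" by simp
  have "q v \<notin> p ` V" using R(1) nq by force
  have "thick_drawing (insert v V) E q \<phi>" unfolding thick_drawing_def
  proof (intro conjI ballI impI)
    have "inj_on p V" using d by (simp add: thick_drawing_def)
    hence "inj_on q V" by (rule inj_on_cong[THEN iffD1, rotated]) (simp add: qV)
    thus "inj_on q (insert v V)" using \<open>q v \<notin> p ` V\<close> im assms(4) by (auto simp: inj_on_insert)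
    show "\<exists>x\<in>insert v V. \<exists>y\<in>insert v V. x \<noteq> y \<and> e = {x, y} \<and> band (\<phi> e) (q x) (q y)" if e: "e \<in> E" for e
    proof -
      obtain x y where "x \<in> V" "y \<in> V" "x \<noteq> y" "e = {x, y}" "band (\<phi> e) (p x) (p y)"
        using thick_drawing_edgeE[OF d e] .
      thus ?thesis using qV by (intro bexI[of _ x] bexI[of _ y]) auto
    qed
    show "\<phi> e ` strip \<inter> q ` insert v V = {}" if e: "e \<in> E" for e
    proof -
      have "\<phi> e ` strip \<inter> p ` V = {}" by (rule thick_drawingD(2)[OF d e])
      moreover have "q v \<notin> \<phi> e ` strip" using R(2)[OF e] nq by force
      ultimately show ?thesis using im by auto
    qed
    show "\<phi> e ` strip \<inter> \<phi> f ` strip = {}" if "e \<in> E" "f \<in> E" "e \<noteq> f" for e f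
      using thick_drawingD(3)[OF d that] .
  qed
  thus ?thesis by (auto simp: thick_def)
qed

lemma thick_isolated_edge:
  assumes "thick V E" "finite V" "finite E" "v \<notin> V" "w \<notin> V" "v \<noteq> w"
  shows "thick (insert v (insert w V)) (insert {v, w} E)"
proof -
  obtain p \<phi> where d: "thick_drawing V E p \<phi>" using assms by (auto simp: thick_def)
  obtain R where R: "\<And>v. v \<in> V \<Longrightarrow> norm (p v) < R" "\<And>e z. e \<in> E \<Longrightarrow> z \<in> \<phi> e ` strip \<Longrightarrow> norm z < R"
    using thick_drawing_bounded[OF d assms(2,3)] by metis
  define q where "q = p(v := Complex R 0, w := Complex (R + 1) 0)"
  \<comment> \<open>A lens around the real segment from \<open>R\<close> to \<open>R + 1\<close>.
    Its half-width \<open>t * (1 - t)\<close> vanishes exactly at the two ends, and real part at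
    least \<open>R\<close> keeps it off the old drawing.\<close>
  define \<psi> where "\<psi> = (\<lambda>(t, u). Complex (R + t) (u * (t * (1 - t))))"
  define \<rho> where "\<rho> = \<phi>({v, w} := \<psi>)"
  have EV: "e \<subseteq> V" if "e \<in> E" for e using thick_edge_subset[OF assms(1) that] by simp
  have new: "{v, w} \<notin> E" using EV assms(4) by blast
  have \<rho>: "\<rho> {v, w} = \<psi>" "\<And>e. e \<in> E \<Longrightarrow> \<rho> e = \<phi> e" using new by (auto simp: \<rho>_def)
  have qV: "q z = p z" if "z \<in> V" for z using that assms(4,5) by (auto simp: q_def)
  hence im: "q ` V = p ` V" by simp
  have qvw: "q v = Complex R 0" "q w = Complex (R + 1) 0" using assms(6) by (auto simp: q_def)
  have far: "norm z \<ge> R" if "Re z \<ge> R" for z using that complex_Re_le_cmod[of z] by linarith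
  have out: "z \<notin> p ` V" "\<And>e. e \<in> E \<Longrightarrow> z \<notin> \<phi> e ` strip" if "Re z \<ge> R" for z
    using R far[OF that] by force+
  have \<psi>R: "Re z \<ge> R" if "z \<in> \<psi> ` strip" for z using that by (auto simp: \<psi>_def)
  have b: "band \<psi> (q v) (q w)" unfolding band_def
  proof (intro conjI ballI)
    show "continuous_on sq \<psi>" unfolding \<psi>_def Complex_eq by (auto simp: case_prod_beta intro!: continuous_intros)
    show "inj_on \<psi> strip" by (auto simp: inj_on_def \<psi>_def)
  qed (auto simp: \<psi>_def qvw)
  have "thick_drawing (insert v (insert w V)) (insert {v, w} E) q \<rho>" unfolding thick_drawing_def
  proof (intro conjI ballI impI)
    have "inj_on p V" using d by (simp add: thick_drawing_def)
    hence "inj_on q V" by (rule inj_on_cong[THEN iffD1, rotated]) (simp add: qV)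
    moreover have "q v \<notin> q ` V" "q w \<notin> q ` V" using out qvw unfolding im by simp_all
    ultimately show "inj_on q (insert v (insert w V))" using qvw assms(4-6) by (auto simp: inj_on_insert)
    show "\<exists>x\<in>insert v (insert w V). \<exists>y\<in>insert v (insert w V). x \<noteq> y \<and> e = {x, y} \<and> band (\<rho> e) (q x) (q y)"
      if e: "e \<in> insert {v, w} E" for e
    proof (cases "e = {v, w}")
      case True thus ?thesis using b \<rho> assms(6) by (intro bexI[of _ v] bexI[of _ w]) auto
    next
      case False
      hence eE: "e \<in> E" using e by simp
      obtain x y where "x \<in> V" "y \<in> V" "x \<noteq> y" "e = {x, y}" "band (\<phi> e) (p x) (p y)"
        using thick_drawing_edgeE[OF d eE] .
      thus ?thesis using qV \<rho> False e by (intro bexI[of _ x] bexI[of _ y]) auto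
    qed
    show "\<rho> e ` strip \<inter> q ` insert v (insert w V) = {}" if e: "e \<in> insert {v, w} E" for e
    proof (cases "e = {v, w}")
      case True
      have "q v \<notin> \<psi> ` strip" "q w \<notin> \<psi> ` strip" by (auto simp: qvw \<psi>_def)
      moreover have "\<psi> ` strip \<inter> p ` V = {}" using \<psi>R out(1) by blast
      ultimately show ?thesis using im \<rho>(1) True by simp
    next
      case False
      hence e: "e \<in> E" using e by simp
      have "\<phi> e ` strip \<inter> p ` V = {}" by (rule thick_drawingD(2)[OF d e])
      moreover have "q v \<notin> \<phi> e ` strip" "q w \<notin> \<phi> e ` strip" by (rule out(2); simp add: qvw e)+
      ultimately show ?thesis using im \<rho>(2)[OF e] by auto
    qed
    show "\<rho> e ` strip \<inter> \<rho> f ` strip = {}" if "e \<in> insert {v, w} E" "f \<in> insert {v, w} E" "e \<noteq> f" for e f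
    proof -
      have "\<psi> ` strip \<inter> \<phi> g ` strip = {}" if "g \<in> E" for g using \<psi>R out(2)[OF _ that] by blast
      moreover have "e \<in> E \<Longrightarrow> f \<in> E \<Longrightarrow> \<phi> e ` strip \<inter> \<phi> f ` strip = {}"
        using thick_drawingD(3)[OF d _ _ that(3)] .
      moreover have "e = {v, w} \<and> f \<in> E \<or> f = {v, w} \<and> e \<in> E \<or> e \<in> E \<and> f \<in> E" using that by auto
      ultimately show ?thesis using \<rho> by (elim disjE) (simp_all add: Int_commute)
    qed
  qed
  thus ?thesis by (auto simp: thick_def)
qed

text \<open>If \<open>y\<close> has a neighbour \<open>x\<close>, a path from \<open>x\<close>
  through \<open>v\<close> to \<open>y\<close> is drawn beside the edge \<open>xy\<close> and its
  half at \<open>x\<close> is dropped. If \<open>y\<close> has no edge, \<open>y\<close> is removed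
  and drawn again far away, together with the edge \<open>vy\<close>.\<close>

lemma thick_pendant:
  assumes "thick V E" "finite V" "finite E" "v \<notin> V" "y \<in> V"
  shows "thick (insert v V) (insert {v, y} E)"
proof (cases "\<exists>e\<in>E. y \<in> e")
  case True
  then obtain e where e: "e \<in> E" "y \<in> e" by blast
  then obtain x where "e = {x, y}" using thick_edge_subset[OF assms(1)] by (metis card_2_iff' card_2_iff insertE insert_commute singletonD)
  hence "thick (insert v V) (insert {v, x} (insert {v, y} E))" using thick_parallel_path[OF assms(1)] e assms(4) by blast
  thus ?thesis by (rule thick_mono) (use thick_edge_subset[OF assms(1)] assms(5) in auto)
next
  case False
  have "thick (V - {y}) E" by (rule thick_mono[OF assms(1)]) (use False thick_edge_subset[OF assms(1)] in auto)
  hence "thick (insert v (insert y (V - {y}))) (insert {v, y} E)"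
    by (rule thick_isolated_edge) (use assms in auto)
  thus ?thesis using assms(5) by (simp add: insert_absorb)
qed

section \<open>Book embeddings and vertex deletion\<close>

text \<open>If one of two nested intervals with ends at distance at least 1 lies strictly inside the
  other on some side, then at each inner point the heights of the two parabolas differ by a factor
  of at least \<open>1 + 1/N\<close>. Varying both heights by a factor within \<open>1/(4 N)\<close>
  of 1 preserves the order, because (1 + d/4) < (1 - d/4)(1 + d) for 0 < d \<le> 1.\<close>

lemma nested_parabolas:
  fixes x y x' y' X N u u' :: real
  assumes "x \<le> x'" "y' \<le> y" "x + 1 \<le> x' \<or> y' + 1 \<le> y" "x' < X" "X < y'" "y' - x' \<le> N" "1 \<le> N"
    "-1 \<le> u" "u \<le> 1" "-1 \<le> u'" "u' \<le> 1"
  shows "(1 + u' / (4 * N)) * ((X - x') * (y' - X)) < (1 + u / (4 * N)) * ((X - x) * (y - X))"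
proof -
  define d where "d = 1 / N"
  have d: "0 < d" "d \<le> 1" using assms by (auto simp: d_def)
  define A where "A = (X - x') * (y' - X)"
  have A: "A > 0" unfolding A_def using assms by simp
  have grow: "p * (1 + d) \<le> q" if "p + 1 \<le> q" "p \<le> N" for p q :: real
  proof -
    have "p * d \<le> 1" using that(2) assms(7) by (simp add: d_def)
    thus ?thesis using that(1) by (simp add: algebra_simps)
  qed
  have "(1 + d) * A \<le> (X - x) * (y - X)"
    using assms(3)
  proof
    assume "x + 1 \<le> x'"
    hence "(X - x') * (1 + d) \<le> X - x" using assms by (intro grow) auto
    hence "((X - x') * (1 + d)) * (y' - X) \<le> (X - x) * (y - X)" using assms by (intro mult_mono) auto
    thus ?thesis by (simp add: A_def algebra_simps)
  next
    assume "y' + 1 \<le> y"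
    hence "(y' - X) * (1 + d) \<le> y - X" using assms by (intro grow) auto
    hence "(X - x') * ((y' - X) * (1 + d)) \<le> (X - x) * (y - X)" using assms d by (intro mult_mono) auto
    thus ?thesis by (simp add: A_def algebra_simps)
  qed
  hence B: "(1 - d / 4) * ((1 + d) * A) \<le> (1 - d / 4) * ((X - x) * (y - X))"
    using d by (intro mult_left_mono) auto
  have nn: "0 \<le> (X - x) * (y - X)" using assms by simp
  have "d * d < 2 * d" using d by simp
  moreover have "(1 - d / 4) * (1 + d) = 1 + 3 * d / 4 - d * d / 4" by (simp add: field_simps)
  ultimately have "1 + d / 4 < (1 - d / 4) * (1 + d)" by linarith
  hence C: "(1 + d / 4) * A < (1 - d / 4) * (1 + d) * A" using A by simp
  have u: "u / (4 * N) = u * d / 4" "u' / (4 * N) = u' * d / 4" by (simp_all add: d_def)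
  have "u' * d \<le> 1 * d" "(-1) * d \<le> u * d" using assms d by (intro mult_right_mono; simp)+
  hence "(1 + u' / (4 * N)) * A \<le> (1 + d / 4) * A" "(1 - d / 4) * ((X - x) * (y - X)) \<le> (1 + u / (4 * N)) * ((X - x) * (y - X))"
    using A nn unfolding u by (intro mult_right_mono; simp)+
  thus ?thesis using B C unfolding A_def[symmetric] by (simp add: mult.assoc)
qed

text \<open>The vertices go to integer points of the real axis, and each edge becomes a parabolic
  arch above or below it according to \<open>side\<close>. Arches of one page that do not cross have
  nested intervals or intervals without common inner points; the nested case is the only one that
  needs an estimate.\<close>

lemma book_embedding_thick:
  fixes pos :: "'a \<Rightarrow> nat" and side :: "'a set \<Rightarrow> bool"
  assumes "simple_graph V E" "inj_on pos V"
    and nocross: "\<And>a b c d. {a, b} \<in> E \<Longrightarrow> {c, d} \<in> E \<Longrightarrow> side {a, b} = side {c, d} \<Longrightarrow>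
      pos a < pos c \<Longrightarrow> pos c < pos b \<Longrightarrow> pos b < pos d \<Longrightarrow> False"
  shows "thick V E"
proof -
  define lo where "lo e = Min (pos ` e)" for e
  define hi where "hi e = Max (pos ` e)" for e
  have ends: "\<exists>a b. a \<in> V \<and> b \<in> V \<and> e = {a, b} \<and> pos a < pos b \<and> lo e = pos a \<and> hi e = pos b" if e: "e \<in> E" for e
  proof -
    obtain a b where ab: "e = {a, b}" "a \<noteq> b" using assms(1) e by (metis card_2_iff simple_graph_def)
    have V: "a \<in> V" "b \<in> V" using assms(1) e ab by (auto simp: simple_graph_def)
    hence "pos a \<noteq> pos b" using assms(2) ab by (auto dest: inj_onD)
    thus ?thesis
    proof (cases "pos a < pos b")
      case True
      thus ?thesis using ab V by (intro exI[of _ a] exI[of _ b]) (auto simp: lo_def hi_def)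
    next
      case False
      thus ?thesis using ab V \<open>pos a \<noteq> pos b\<close> by (intro exI[of _ b] exI[of _ a]) (auto simp: lo_def hi_def)
    qed
  qed
  obtain M where M: "pos v \<le> M" if "v \<in> V" for v
    using assms(1) unfolding simple_graph_def by (metis finite_nat_set_iff_bounded_le finite_imageI imageI)
  \<comment> \<open>At least 1 and at least the span of every edge, as required for comparing nested
    arches.\<close>
  define N where "N = real (Suc M)"
  have N: "1 \<le> N" by (simp add: N_def)
  have loM: "lo e < hi e" "real (hi e) - real (lo e) \<le> N" if e: "e \<in> E" for e
  proof -
    obtain a b where "b \<in> V" "pos a < pos b" "lo e = pos a" "hi e = pos b" using ends[OF e] by blast
    thus "lo e < hi e" "real (hi e) - real (lo e) \<le> N" using M[of b] by (auto simp: N_def)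
  qed
  define sg where "sg e = (if side e then 1 else -1 :: real)" for e
  define X where "X e t = real (lo e) + t * (real (hi e) - real (lo e))" for e t
  \<comment> \<open>The horizontal coordinate depends on \<open>t\<close> alone; \<open>u\<close>
    rescales the height of the arch. The height vanishes at both ends, which pinches the band
    there.\<close>
  define \<phi> where "\<phi> e = (\<lambda>(t, u). Complex (X e t)
      (sg e * ((1 + u / (4 * N)) * ((X e t - real (lo e)) * (real (hi e) - X e t)))))" for e
  define p where "p v = Complex (real (pos v)) 0" for v
  have Xb: "real (lo e) < X e t" "X e t < real (hi e)" if "e \<in> E" "0 < t" "t < 1" for e t
  proof -
    have "0 < t * (real (hi e) - real (lo e))" "t * (real (hi e) - real (lo e)) < 1 * (real (hi e) - real (lo e))"
      using loM(1)[OF that(1)] that by (auto intro!: mult_strict_right_mono)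
    thus "real (lo e) < X e t" "X e t < real (hi e)" by (auto simp: X_def)
  qed
  have fac: "0 < 1 + u / (4 * N)" if "-1 \<le> u" for u
  proof -
    have "-1 < u / (4 * N)" using that N by (simp add: field_simps)
    thus ?thesis by simp
  qed
  have ht: "0 < (1 + u / (4 * N)) * ((X e t - real (lo e)) * (real (hi e) - X e t))"
    if "e \<in> E" "0 < t" "t < 1" "-1 \<le> u" for e t u
    using Xb[OF that(1-3)] fac[OF that(4)] by simp
  have "thick_drawing V E p \<phi>"
    unfolding thick_drawing_def
  proof (intro conjI ballI impI)
    show "inj_on p V" using assms(2) by (auto simp: inj_on_def p_def)
    show "\<exists>x\<in>V. \<exists>y\<in>V. x \<noteq> y \<and> e = {x, y} \<and> band (\<phi> e) (p x) (p y)" if e: "e \<in> E" for e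
    proof -
      obtain a b where ab: "a \<in> V" "b \<in> V" "e = {a, b}" "pos a < pos b" "lo e = pos a" "hi e = pos b"
        using ends[OF e] by blast
      have "band (\<phi> e) (p a) (p b)" unfolding band_def
      proof (intro conjI ballI)
        show "continuous_on sq (\<phi> e)" unfolding \<phi>_def X_def Complex_eq
          using N by (auto simp: case_prod_beta intro!: continuous_intros)
        show "inj_on (\<phi> e) strip"
        proof (rule inj_onI)
          fix z w assume zw: "z \<in> strip" "w \<in> strip" "\<phi> e z = \<phi> e w"
          obtain t u where z: "z = (t, u)" by (cases z)
          obtain t' u' where w: "w = (t', u')" by (cases w)
          have "X e t = X e t'" using zw(3) by (simp add: \<phi>_def z w)
          hence tt: "t = t'" using loM(1)[OF e] by (simp add: X_def)
          have "(X e t - real (lo e)) * (real (hi e) - X e t) \<noteq> 0" using Xb[OF e, of t] zw(1) z by simp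
          moreover have "sg e \<noteq> 0" by (simp add: sg_def)
          ultimately have "u / (4 * N) = u' / (4 * N)" using zw(3) tt by (simp add: \<phi>_def z w)
          hence "u = u'" using N by simp
          thus "z = w" using tt z w by simp
        qed
      qed (simp_all add: \<phi>_def X_def p_def ab(5,6))
      thus ?thesis using ab by (intro bexI[of _ a] bexI[of _ b]) auto
    qed
    show "\<phi> e ` strip \<inter> p ` V = {}" if e: "e \<in> E" for e
    proof -
      have "Im z \<noteq> 0" if "z \<in> \<phi> e ` strip" for z
      proof -
        obtain t u where "z = \<phi> e (t, u)" "0 < t" "t < 1" "-1 \<le> u" using \<open>z \<in> \<phi> e ` strip\<close> by auto
        hence "Im z = sg e * ((1 + u / (4 * N)) * ((X e t - real (lo e)) * (real (hi e) - X e t)))"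
          by (simp add: \<phi>_def)
        moreover have "sg e \<noteq> 0" by (simp add: sg_def)
        ultimately show ?thesis
          using ht[OF e \<open>0 < t\<close> \<open>t < 1\<close> \<open>-1 \<le> u\<close>] by (metis less_irrefl mult_eq_0_iff)
      qed
      moreover have "Im z = 0" if "z \<in> p ` V" for z using that by (auto simp: p_def)
      ultimately show ?thesis by blast
    qed
    show "\<phi> e ` strip \<inter> \<phi> f ` strip = {}" if ef: "e \<in> E" "f \<in> E" "e \<noteq> f" for e f
    proof (rule ccontr)
      assume "\<phi> e ` strip \<inter> \<phi> f ` strip \<noteq> {}"
      then obtain z w where zw: "z \<in> strip" "w \<in> strip" "\<phi> e z = \<phi> f w" by (auto 0 0) metis
      obtain t u where z: "z = (t, u)" by (cases z)
      obtain t' u' where w: "w = (t', u')" by (cases w)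
      have tu: "0 < t" "t < 1" "-1 \<le> u" "u \<le> 1" "0 < t'" "t' < 1" "-1 \<le> u'" "u' \<le> 1" using zw(1,2) z w by auto
      define Y where "Y = X e t"
      have Y': "X f t' = Y" using zw(3) by (simp add: \<phi>_def z w Y_def)
      have bounds: "real (lo e) < Y" "Y < real (hi e)" "real (lo f) < Y" "Y < real (hi f)"
        using Xb[OF ef(1) tu(1,2)] Xb[OF ef(2) tu(5,6)] Y' by (simp_all add: Y_def)
      have Im: "sg e * ((1 + u / (4 * N)) * ((Y - real (lo e)) * (real (hi e) - Y))) =
            sg f * ((1 + u' / (4 * N)) * ((Y - real (lo f)) * (real (hi f) - Y)))"
        using zw(3) Y' by (simp add: \<phi>_def z w Y_def)
      have pos: "0 < (1 + u / (4 * N)) * ((Y - real (lo e)) * (real (hi e) - Y))"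
          "0 < (1 + u' / (4 * N)) * ((Y - real (lo f)) * (real (hi f) - Y))"
        using ht[OF ef(1) tu(1-3)] ht[OF ef(2) tu(5-7)] Y' by (simp_all add: Y_def)
      have side: "side e = side f" using Im pos by (auto simp: sg_def split: if_splits)
      hence eq: "(1 + u / (4 * N)) * ((Y - real (lo e)) * (real (hi e) - Y)) =
            (1 + u' / (4 * N)) * ((Y - real (lo f)) * (real (hi f) - Y))"
        using Im by (simp add: sg_def split: if_splits)
      obtain a b where ab: "a \<in> V" "b \<in> V" "e = {a, b}" "lo e = pos a" "hi e = pos b" using ends[OF ef(1)] by blast
      obtain c d where cd: "c \<in> V" "d \<in> V" "f = {c, d}" "lo f = pos c" "hi f = pos d" using ends[OF ef(2)] by blast
      have ne: "\<not> (lo e = lo f \<and> hi e = hi f)"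
      proof
        assume "lo e = lo f \<and> hi e = hi f"
        hence "a = c" "b = d" using ab cd assms(2) by (auto dest: inj_onD)
        thus False using ef(3) ab cd by simp
      qed
      have nc1: "\<not> (lo e < lo f \<and> lo f < hi e \<and> hi e < hi f)"
        using nocross[of a b c d] ab cd ef side by auto
      have nc2: "\<not> (lo f < lo e \<and> lo e < hi f \<and> hi f < hi e)"
        using nocross[of c d a b] ab cd ef side by auto
      have lt: "lo f < hi e" "lo e < hi f" using bounds by linarith+
      \<comment> \<open>Both intervals contain \<open>Y\<close> in their interior and they do not
        interleave, so one contains the other.\<close>
      have "(lo e \<le> lo f \<and> hi f \<le> hi e) \<or> (lo f \<le> lo e \<and> hi e \<le> hi f)"
        using nc1 nc2 lt by linarith
      thus False
      proof
        assume n: "lo e \<le> lo f \<and> hi f \<le> hi e"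
        hence "real (lo e) + 1 \<le> real (lo f) \<or> real (hi f) + 1 \<le> real (hi e)" using ne by linarith
        hence "(1 + u' / (4 * N)) * ((Y - real (lo f)) * (real (hi f) - Y)) <
               (1 + u / (4 * N)) * ((Y - real (lo e)) * (real (hi e) - Y))"
          using n bounds loM(2)[OF ef(2)] N tu by (intro nested_parabolas) auto
        thus False using eq by simp
      next
        assume n: "lo f \<le> lo e \<and> hi e \<le> hi f"
        hence "real (lo f) + 1 \<le> real (lo e) \<or> real (hi e) + 1 \<le> real (hi f)" using ne by linarith
        hence "(1 + u / (4 * N)) * ((Y - real (lo e)) * (real (hi e) - Y)) <
               (1 + u' / (4 * N)) * ((Y - real (lo f)) * (real (hi f) - Y))"
          using n bounds loM(2)[OF ef(1)] N tu by (intro nested_parabolas) auto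
        thus False using eq by simp
      qed
    qed
  qed
  thus ?thesis by (auto simp: thick_def)
qed

lemma simple_graph_finite_edges: "simple_graph V E \<Longrightarrow> finite E"
  unfolding simple_graph_def by (metis Pow_iff finite_Pow_iff finite_subset subsetI)

text \<open>Among four points on the spine the only pairs that interleave are 02 and 13; hence 02
  gets a page of its own.\<close>

lemma thick_card_le_4:
  assumes "simple_graph V E" "card V \<le> 4"
  shows "thick V E"
proof -
  have fin: "finite V" using assms by (simp add: simple_graph_def)
  obtain pos where pos: "bij_betw pos V {0..<card V}" using ex_bij_betw_finite_nat[OF fin] by blast
  have lt: "pos v < 4" if "v \<in> V" for v using bij_betwE[OF pos] that assms(2) by fastforce
  have V: "a \<in> V" "b \<in> V" if "{a, b} \<in> E" for a b using assms(1) that by (auto simp: simple_graph_def)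
  have inj: "inj_on pos V" using pos by (rule bij_betw_imp_inj_on)
  show ?thesis
  proof (rule book_embedding_thick[OF assms(1) inj, of "\<lambda>e. pos ` e = {0, 2}"])
    fix a b c d assume H: "{a, b} \<in> E" "{c, d} \<in> E" "(pos ` {a, b} = {0, 2}) = (pos ` {c, d} = {0, 2})"
      "pos a < pos c" "pos c < pos b" "pos b < pos d"
    have "pos d < 4" using lt V[OF H(2)] by simp
    hence "pos a = 0" "pos c = 1" "pos b = 2" "pos d = 3" using H(4-6) by linarith+
    thus False using H(3) by (simp add: doubleton_eq_iff)
  qed
qed

section \<open>Deleting vertices, and reduction at vertices of degree at most 2\<close>

definition del :: "'a set \<Rightarrow> 'a set set \<Rightarrow> 'a set set" where
  "del S E = {e \<in> E. e \<inter> S = {}}"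

definition deg :: "'a set set \<Rightarrow> 'a \<Rightarrow> nat" where
  "deg E v = card {e \<in> E. v \<in> e}"

text \<open>This uses \<open>thick\<close> in place of \<open>planar\<close>, so that the drawing
  left after the deletions can still be extended.\<close>

definition kapex :: "nat \<Rightarrow> 'a set \<Rightarrow> 'a set set \<Rightarrow> bool" where
  "kapex k V E \<longleftrightarrow> (\<exists>S\<subseteq>V. card S \<le> k \<and> thick (V - S) (del S E))"

lemma simple_graph_del: "simple_graph V E \<Longrightarrow> simple_graph (V - S) (del S E)"
  by (fastforce simp: simple_graph_def del_def)

lemma kapex_0: "finite V \<Longrightarrow> kapex 0 V E \<longleftrightarrow> thick V E"
  unfolding kapex_def by (auto simp: del_def finite_subset)

lemma kapex_Suc:
  assumes "finite V" "a \<in> V" "kapex k (V - {a}) (del {a} E)"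
  shows "kapex (Suc k) V E"
proof -
  obtain S where S: "S \<subseteq> V - {a}" "card S \<le> k" "thick (V - {a} - S) (del S (del {a} E))"
    using assms(3) by (auto simp: kapex_def)
  have "V - {a} - S = V - insert a S" "del S (del {a} E) = del (insert a S) E"
    by (auto simp: del_def)
  moreover have "card (insert a S) \<le> Suc k" using S assms(1) by (simp add: card_insert_if finite_subset)
  ultimately show ?thesis using S assms(2) unfolding kapex_def by (intro exI[of _ "insert a S"]) auto
qed

lemma kapex_mono:
  assumes "kapex k V E" "E' \<subseteq> E"
  shows "kapex k V E'"
proof -
  obtain S where S: "S \<subseteq> V" "card S \<le> k" "thick (V - S) (del S E)"
    using assms(1) by (auto simp: kapex_def)
  have "thick (V - S) (del S E')"
    by (rule thick_mono[OF S(3)]) (use assms(2) thick_edge_subset[OF S(3)] in \<open>auto simp: del_def\<close>)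
  thus ?thesis using S by (auto simp: kapex_def)
qed

lemma kapex_card_le:
  assumes "simple_graph V E" "card V \<le> k + 4"
  shows "kapex k V E"
proof -
  have fin: "finite V" using assms by (simp add: simple_graph_def)
  obtain S where S: "S \<subseteq> V" "card S = card V - 4"
    using obtain_subset_with_card_n[of "card V - 4" V] by (metis diff_le_self)
  have "card (V - S) \<le> 4" using S fin by (simp add: card_Diff_subset finite_subset)
  thus ?thesis using S assms unfolding kapex_def
    by (intro exI[of _ S]) (auto intro: thick_card_le_4 simple_graph_del)
qed

text \<open>The deleted set \<open>S\<close> of the smaller graph also works for the larger one. If
  both neighbours survive and are distinct, \<open>v\<close> is drawn beside the edge
  \<open>xy\<close> of \<open>E'\<close>; if one was deleted, \<open>v\<close> is pendant; if both
  were, it is isolated. Taking \<open>x = y\<close> covers degree 1, and \<open>x = y = v\<close>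
  covers degree 0, since no edge is a singleton.\<close>

lemma kapex_add_vertex:
  assumes "simple_graph V E" "v \<in> V" "kapex k (V - {v}) E'" "x \<in> V" "y \<in> V"
    and "E \<subseteq> insert {v, x} (insert {v, y} E')" and "{x, y} \<in> E' \<or> x = y" and "finite E'"
  shows "kapex k V E"
proof -
  have fin: "finite V" using assms by (simp add: simple_graph_def)
  obtain S where S: "S \<subseteq> V - {v}" "card S \<le> k" and t: "thick (V - {v} - S) (del S E')"
    using assms(3) by (auto simp: kapex_def)
  have W: "insert v (V - {v} - S) = V - S" using assms(2) S by auto
  have sd: "\<And>e. e \<in> del S E \<Longrightarrow> e \<subseteq> V - S" and card2: "\<And>e. e \<in> E \<Longrightarrow> card e = 2"
    using assms(1) by (auto simp: simple_graph_def del_def)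
  have fins: "finite (V - {v} - S)" "finite (del S E')" using fin assms(8) by (auto simp: del_def)
  have gone: "{v, z} \<notin> del S E" if "z \<in> S \<or> z = v" for z
    using that card2[of "{v, z}"] by (auto simp: del_def)
  have delE: "e = {v, x} \<or> e = {v, y} \<or> e \<in> del S E'" if "e \<in> del S E" for e
    using that assms(6) by (auto simp: del_def)
  have "thick (V - S) (del S E)"
  proof (cases "x \<in> S \<or> x = v"; cases "y \<in> S \<or> y = v")
    assume H: "\<not> (x \<in> S \<or> x = v)" "\<not> (y \<in> S \<or> y = v)"
    show ?thesis
    proof (cases "x = y")
      case True
      have "thick (insert v (V - {v} - S)) (insert {v, y} (del S E'))"
        by (rule thick_pendant[OF t]) (use fins H assms in auto)
      thus ?thesis unfolding W by (rule thick_mono) (use delE sd True in blast)+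
    next
      case False
      hence "{x, y} \<in> del S E'" using assms(7) H by (auto simp: del_def)
      hence "thick (insert v (V - {v} - S)) (insert {v, x} (insert {v, y} (del S E')))"
        by (intro thick_parallel_path[OF t]) auto
      thus ?thesis unfolding W by (rule thick_mono) (use delE sd in blast)+
    qed
  next
    assume H: "x \<in> S \<or> x = v" "\<not> (y \<in> S \<or> y = v)"
    have "thick (insert v (V - {v} - S)) (insert {v, y} (del S E'))"
      by (rule thick_pendant[OF t]) (use fins H assms in auto)
    thus ?thesis unfolding W
      by (rule thick_mono) (use delE sd gone H in blast)+
  next
    assume H: "\<not> (x \<in> S \<or> x = v)" "y \<in> S \<or> y = v"
    have "thick (insert v (V - {v} - S)) (insert {v, x} (del S E'))"
      by (rule thick_pendant[OF t]) (use fins H assms in auto)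
    thus ?thesis unfolding W
      by (rule thick_mono) (use delE sd gone H in blast)+
  next
    assume H: "x \<in> S \<or> x = v" "y \<in> S \<or> y = v"
    have "thick (insert v (V - {v} - S)) (del S E')"
      by (rule thick_isolated_vertex[OF t]) (use fins H assms in auto)
    thus ?thesis unfolding W
      by (rule thick_mono) (use delE sd gone H in blast)+
  qed
  thus ?thesis using S unfolding kapex_def by (intro exI[of _ S]) auto
qed

lemma deg_le_2E:
  assumes "simple_graph V E" "v \<in> V" "deg E v \<le> 2"
  obtains "E = del {v} E" "deg E v = 0"
    | x where "x \<in> V" "x \<noteq> v" "{v, x} \<in> E" "E = insert {v, x} (del {v} E)" "deg E v = 1"
    | x y where "x \<in> V" "y \<in> V" "x \<noteq> v" "y \<noteq> v" "x \<noteq> y" "{v, x} \<in> E" "{v, y} \<in> E"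
        "E = insert {v, x} (insert {v, y} (del {v} E))" "deg E v = 2"
proof -
  let ?D = "{e \<in> E. v \<in> e}"
  have E: "E = ?D \<union> del {v} E" by (auto simp: del_def)
  have fin: "finite ?D" using simple_graph_finite_edges[OF assms(1)] by simp
  have nb: "\<exists>x. e = {v, x} \<and> x \<in> V \<and> x \<noteq> v" if "e \<in> ?D" for e
  proof -
    have "card e = 2" "e \<subseteq> V" "v \<in> e" using assms(1) that by (auto simp: simple_graph_def)
    then obtain a b where "e = {a, b}" "a \<noteq> b" "a \<in> V" "b \<in> V" "v = a \<or> v = b" by (auto simp: card_2_iff)
    thus ?thesis by (metis insert_commute)
  qed
  consider "card ?D = 0" | "card ?D = 1" | "card ?D = 2" using assms(3) by (fastforce simp: deg_def)
  then show thesis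
  proof cases
    case 1
    hence "?D = {}" using fin by simp
    hence "E = del {v} E" by (auto simp: del_def)
    thus ?thesis using that(1) 1 by (simp add: deg_def)
  next
    case 2
    then obtain e where e: "?D = {e}" by (auto simp: card_1_singleton_iff)
    then obtain x where x: "e = {v, x}" "x \<in> V" "x \<noteq> v" using nb by blast
    show ?thesis
    proof (rule that(2)[OF x(2,3)])
      show "{v, x} \<in> E" using e x by blast
      show "E = insert {v, x} (del {v} E)" using E[unfolded e x(1) Un_insert_left sup_bot_left] .
      show "deg E v = 1" using 2 by (simp add: deg_def)
    qed
  next
    case 3
    then obtain e f where e: "?D = {e, f}" "e \<noteq> f" by (auto simp: card_2_iff)
    then obtain x where x: "e = {v, x}" "x \<in> V" "x \<noteq> v" using nb by blast
    obtain y where y: "f = {v, y}" "y \<in> V" "y \<noteq> v" using nb e by blast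
    show ?thesis
    proof (rule that(3)[OF x(2) y(2) x(3) y(3)])
      show "x \<noteq> y" using e x y by blast
      show "{v, x} \<in> E" "{v, y} \<in> E" using e x y by blast+
      show "E = insert {v, x} (insert {v, y} (del {v} E))" using E[unfolded e(1) x(1) y(1) Un_insert_left sup_bot_left] .
      show "deg E v = 2" using 3 by (simp add: deg_def)
    qed
  qed
qed

lemma card_del: "finite E \<Longrightarrow> card (del {v} E) + deg E v = card E"
proof -
  assume "finite E"
  moreover have "E = del {v} E \<union> {e \<in> E. v \<in> e}" "del {v} E \<inter> {e \<in> E. v \<in> e} = {}" by (auto simp: del_def)
  ultimately show ?thesis unfolding deg_def by (metis (no_types, lifting) card_Un_disjoint finite_Un)
qed

text \<open>Reinsertion of a vertex read backwards. For two adjacent neighbours the edge between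
  them already serves as the guide along which \<open>v\<close> is drawn, so deletion suffices;
  otherwise that edge has to be supplied, which is smoothing.\<close>

lemma not_kapex_reduceE:
  assumes "simple_graph V E" "v \<in> V" "deg E v \<le> 2" "\<not> kapex k V E"
  obtains (delete) "\<not> kapex k (V - {v}) (del {v} E)"
    | (smooth) x y where "x \<in> V" "y \<in> V" "x \<noteq> v" "y \<noteq> v" "x \<noteq> y" "{v, x} \<in> E" "{v, y} \<in> E" "{x, y} \<notin> E" "deg E v = 2"
        "E = insert {v, x} (insert {v, y} (del {v} E))"
        "\<not> kapex k (V - {v}) (insert {x, y} (del {v} E))"
proof -
  have fin: "finite (del {v} E)" using simple_graph_finite_edges[OF assms(1)] by (simp add: del_def)
  have mono: "E \<subseteq> F" if "E = F" for F using that by simp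
  show thesis
    using assms(1-3)
  proof (cases rule: deg_le_2E)
    case 1
    have "\<not> kapex k (V - {v}) (del {v} E)"
      using kapex_add_vertex[OF assms(1,2) _ assms(2,2), of k "del {v} E"] 1 fin assms(4) by blast
    thus ?thesis by (rule delete)
  next
    case (2 x)
    have "\<not> kapex k (V - {v}) (del {v} E)"
      using kapex_add_vertex[OF assms(1,2) _ 2(1,1), of k "del {v} E"] 2 fin assms(4) by blast
    thus ?thesis by (rule delete)
  next
    case (3 x y)
    show ?thesis
    proof (cases "{x, y} \<in> E")
      case True
      hence "{x, y} \<in> del {v} E" using 3 by (auto simp: del_def)
      hence "\<not> kapex k (V - {v}) (del {v} E)"
        using kapex_add_vertex[OF assms(1,2) _ 3(1,2), of k "del {v} E"] 3 fin assms(4) by blast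
      thus ?thesis by (rule delete)
    next
      case False
      have "E \<subseteq> insert {v, x} (insert {v, y} (insert {x, y} (del {v} E)))"
        by (rule order_trans[OF mono[OF 3(8)]]) auto
      hence "\<not> kapex k (V - {v}) (insert {x, y} (del {v} E))"
        using kapex_add_vertex[OF assms(1,2) _ 3(1,2), of k "insert {x, y} (del {v} E)"] fin assms(4) by blast
      thus ?thesis using smooth[OF 3(1-7) False 3(9,8)] by blast
    qed
  qed
qed

text \<open>The form needed for minimality arguments: smoothing trades two edges for one, so edges
  are lost unless \<open>v\<close> is isolated.\<close>

lemma not_kapex_reduce:
  assumes "simple_graph V E" "v \<in> V" "deg E v \<le> 2" "\<not> kapex k V E"
  obtains E' where "simple_graph (V - {v}) E'" "\<not> kapex k (V - {v}) E'" "card E' \<le> card E"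
    "deg E v \<noteq> 0 \<Longrightarrow> card E' < card E"
proof -
  have c: "card (del {v} E) + deg E v = card E" by (rule card_del[OF simple_graph_finite_edges[OF assms(1)]])
  show thesis
    using assms
  proof (cases rule: not_kapex_reduceE)
    case delete
    thus ?thesis using that[of "del {v} E"] simple_graph_del[OF assms(1)] c by auto
  next
    case (smooth x y)
    let ?E = "insert {x, y} (del {v} E)"
    have "simple_graph (V - {v}) ?E" using simple_graph_del[OF assms(1), of "{v}"] smooth by (auto simp: simple_graph_def)
    moreover have "card ?E \<le> Suc (card (del {v} E))" by (rule card_insert_le_m1) auto
    ultimately show ?thesis using that[of ?E] smooth c by auto
  qed
qed

lemma handshake: "simple_graph V E \<Longrightarrow> (\<Sum>v\<in>V. deg E v) = 2 * card E"
proof -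
  assume s: "simple_graph V E"
  hence fin: "finite V" "finite E" using simple_graph_finite_edges by (auto simp: simple_graph_def)
  have "(\<Sum>v\<in>V. deg E v) = (\<Sum>v\<in>V. \<Sum>e\<in>E. if v \<in> e then 1 else 0)"
    unfolding deg_def using fin by (simp add: sum.If_cases Int_def)
  also have "\<dots> = (\<Sum>e\<in>E. \<Sum>v\<in>V. if v \<in> e then 1 else 0)" by (rule sum.swap)
  also have "\<dots> = (\<Sum>e\<in>E. 2)"
  proof (rule sum.cong[OF refl])
    fix e assume "e \<in> E"
    hence "e \<subseteq> V" "card e = 2" using s by (auto simp: simple_graph_def)
    moreover have "V \<inter> e = e" using \<open>e \<subseteq> V\<close> by blast
    ultimately show "(\<Sum>v\<in>V. if v \<in> e then 1 else 0) = (2::nat)" using fin by (simp add: sum.If_cases Int_def[symmetric])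
  qed
  finally show ?thesis by simp
qed

section \<open>Search trees\<close>

text \<open>Containment as a subgraph, not necessarily induced or spanning.\<close>

definition copy :: "nat \<Rightarrow> (nat \<times> nat) list \<Rightarrow> 'a set \<Rightarrow> 'a set set \<Rightarrow> bool" where
  "copy r es V E \<longleftrightarrow> (\<exists>f. inj_on f {..<r} \<and> f ` {..<r} \<subseteq> V \<and> (\<forall>i j. (i, j) \<in> set es \<longrightarrow> {f i, f j} \<in> E))"

text \<open>
  A state \<open>(A, P)\<close> of the search consists of the pairs \<open>A\<close> known to be edges and the pairs \<open>P\<close> that may
  be edges of a graph on \<open>{..<n}\<close> with at most \<open>m\<close> edges, in which vertex \<open>v\<close> has degree between \<open>lo v\<close> and
  \<open>hi v\<close>. \<open>Br\<close> branches on a pair. \<open>Fu\<close>, \<open>Fo\<close> and \<open>To\<close> propagate: the degree of a vertex has reached its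
  upper bound, its possible edges are all needed for the lower bound, all \<open>m\<close> edges are known. The other
  constructors are leaves: \<open>Dr r\<close> gives the order, along the spine of a book, of the vertices left after
  deleting at most \<open>k\<close> of them; \<open>Mx\<close>, \<open>Hi\<close> and \<open>Lo\<close> report too many edges, a too high and a too low degree;
  \<open>Co c r\<close> locates a copy of the \<open>c\<close>-th target.
\<close>

datatype tree = Br nat nat tree tree | Dr "nat list" | Mx | Hi nat | Lo nat
  | Fu nat tree | Fo nat tree | To tree | Co nat "nat list"

fun idx :: "nat list \<Rightarrow> nat \<Rightarrow> nat \<Rightarrow> nat option" where
  "idx [] v p = None"
| "idx (x # xs) v p = (if x = v then Some p else idx xs v (Suc p))"

fun arcs :: "nat list \<Rightarrow> (nat \<times> nat) list \<Rightarrow> (nat \<times> nat) list" where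
  "arcs r [] = []"
| "arcs r ((i, j) # es) = (case idx r i 0 of None \<Rightarrow> arcs r es | Some a \<Rightarrow>
     (case idx r j 0 of None \<Rightarrow> arcs r es | Some b \<Rightarrow> (if a < b then (a, b) else (b, a)) # arcs r es))"

text \<open>The comparisons are not strict because arcs with a common end are compatible.\<close>

fun nocross :: "nat \<Rightarrow> nat \<Rightarrow> (nat \<times> nat) list \<Rightarrow> bool" where
  "nocross a b [] = True"
| "nocross a b ((c, d) # es) =
     ((if a < c then b \<le> c \<or> d \<le> b else if c = a then True else d \<le> a \<or> b \<le> d) \<and> nocross a b es)"

text \<open>Greedy assignment without backtracking: an arc goes to the second page only if the first
  is blocked. Failure proves nothing; the certificates supply vertex orders for which this
  succeeds.\<close>

fun two_pages :: "(nat \<times> nat) list \<Rightarrow> (nat \<times> nat) list \<Rightarrow> (nat \<times> nat) list \<Rightarrow> bool" where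
  "two_pages [] U D = True"
| "two_pages ((a, b) # es) U D = (if nocross a b U then two_pages es ((a, b) # U) D
      else if nocross a b D then two_pages es U ((a, b) # D) else False)"

definition inc :: "nat \<Rightarrow> (nat \<times> nat) list \<Rightarrow> (nat \<times> nat) list" where
  "inc v es = filter (\<lambda>(i, j). i = v \<or> j = v) es"

definition noninc :: "nat \<Rightarrow> (nat \<times> nat) list \<Rightarrow> (nat \<times> nat) list" where
  "noninc v es = filter (\<lambda>(i, j). i \<noteq> v \<and> j \<noteq> v) es"

definition joined :: "(nat \<times> nat) list \<Rightarrow> nat \<Rightarrow> nat \<Rightarrow> bool" where
  "joined es i j \<longleftrightarrow> list_ex (\<lambda>(a, b). a = i \<and> b = j \<or> a = j \<and> b = i) es"

definition embeds :: "nat \<Rightarrow> (nat \<times> nat) list \<Rightarrow> nat \<Rightarrow> (nat \<times> nat) list \<Rightarrow> nat list \<Rightarrow> bool" where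
  "embeds n A s es r \<longleftrightarrow> length r = s \<and> distinct r \<and> list_all (\<lambda>v. v < n) r \<and>
     list_all (\<lambda>(i, j). joined A (r ! i) (r ! j)) es"

text \<open>Distinctness of \<open>A\<close> is tested at those nodes that turn its length into a
  lower bound for a number of edges. For \<open>P\<close> lengths serve as upper bounds only, so
  repetitions do no harm. The second alternative of \<open>Mx\<close> compares twice the number of
  edges with the degree sum forced by \<open>lo\<close> and \<open>A\<close> together.\<close>

fun chk :: "nat \<Rightarrow> nat \<Rightarrow> nat \<Rightarrow> (nat \<Rightarrow> nat) \<Rightarrow> (nat \<Rightarrow> nat) \<Rightarrow> (nat \<times> (nat \<times> nat) list) list \<Rightarrow>
    (nat \<times> nat) list \<Rightarrow> (nat \<times> nat) list \<Rightarrow> tree \<Rightarrow> bool" where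
  "chk n k m lo hi T A P (Br i j s t) = (i < j \<and> j < n \<and>
     chk n k m lo hi T ((i, j) # A) P s \<and> chk n k m lo hi T A (removeAll (i, j) P) t)"
| "chk n k m lo hi T A P (Dr r) = (n \<le> length r + k \<and> distinct r \<and> list_all (\<lambda>v. v < n) r \<and>
     two_pages (arcs r P) [] [])"
| "chk n k m lo hi T A P Mx = (distinct A \<and>
     (m < length A \<or> 2 * m < sum_list (map (\<lambda>v. max (lo v) (length (inc v A))) [0..<n])))"
| "chk n k m lo hi T A P (Hi v) = (v < n \<and> distinct A \<and> hi v < length (inc v A))"
| "chk n k m lo hi T A P (Lo v) = (v < n \<and> length (inc v P) < lo v)"
| "chk n k m lo hi T A P (Fu v t) = (v < n \<and> distinct A \<and> length (inc v A) = hi v \<and>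
     chk n k m lo hi T A (filter (\<lambda>(i, j). (i \<noteq> v \<and> j \<noteq> v) \<or> (i, j) \<in> set A) P) t)"
| "chk n k m lo hi T A P (Fo v t) = (v < n \<and> length (inc v P) = lo v \<and>
     chk n k m lo hi T (inc v P @ noninc v A) P t)"
| "chk n k m lo hi T A P (To t) = (distinct A \<and> length A = m \<and>
     chk n k m lo hi T A (filter (\<lambda>e. e \<in> set A) P) t)"
| "chk n k m lo hi T A P (Co c r) = (c < length T \<and> embeds n A (fst (T ! c)) (snd (T ! c)) r)"

section \<open>Soundness of the search\<close>

lemma idx_Some: "idx r v p = Some q \<Longrightarrow> p \<le> q \<and> q - p < length r \<and> r ! (q - p) = v"
proof (induction r arbitrary: p)
  case (Cons x xs)
  show ?case
  proof (cases "x = v")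
    case False
    hence "Suc p \<le> q \<and> q - Suc p < length xs \<and> xs ! (q - Suc p) = v" using Cons by simp
    hence "q - p = Suc (q - Suc p)" "Suc p \<le> q" "q - Suc p < length xs" "xs ! (q - Suc p) = v" by linarith+
    thus ?thesis by simp
  qed (use Cons in simp)
qed simp

lemma idx_mem: "v \<in> set r \<Longrightarrow> \<exists>q. idx r v p = Some q"
  by (induction r arbitrary: p) auto

lemma arcs_mem:
  assumes "(i, j) \<in> set P" "idx r i 0 = Some a" "idx r j 0 = Some b"
  shows "(min a b, max a b) \<in> set (arcs r P)"
  using assms(1)
proof (induction P)
  case (Cons e P)
  obtain i' j' where e: "e = (i', j')" by (cases e)
  show ?case
  proof (cases "(i, j) = e")
    case True thus ?thesis using e assms(2,3) by (auto simp: min_def max_def)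
  next
    case False
    hence "(min a b, max a b) \<in> set (arcs r P)" using Cons by simp
    thus ?thesis by (auto simp: e split: option.splits)
  qed
qed simp

definition noncrossing :: "(nat \<times> nat) set \<Rightarrow> bool" where
  "noncrossing X \<longleftrightarrow> (\<forall>(a, b)\<in>X. \<forall>(c, d)\<in>X. \<not> (a < c \<and> c < b \<and> b < d))"

lemma nocross_iff: "nocross a b es \<Longrightarrow> (c, d) \<in> set es \<Longrightarrow> \<not> (a < c \<and> c < b \<and> b < d) \<and> \<not> (c < a \<and> a < d \<and> d < b)"
  by (induction a b es rule: nocross.induct) (auto split: if_splits)

lemma noncrossing_insert:
  assumes "nocross a b es" "noncrossing (set es)"
  shows "noncrossing (set ((a, b) # es))"
  unfolding noncrossing_def
proof clarify
  fix p q c d assume H: "(p, q) \<in> set ((a, b) # es)" "(c, d) \<in> set ((a, b) # es)" "p < c" "c < q" "q < d"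
  show False
  proof (cases "(p, q) = (a, b)")
    case True
    hence "(c, d) \<in> set es" using H by auto
    thus False using nocross_iff[OF assms(1), of c d] True H by simp
  next
    case False
    hence pq: "(p, q) \<in> set es" using H(1) by auto
    show False
    proof (cases "(c, d) = (a, b)")
      case True thus False using nocross_iff[OF assms(1) pq] H by simp
    next
      case False
      hence "(c, d) \<in> set es" using H(2) by auto
      thus False using assms(2) pq H unfolding noncrossing_def by blast
    qed
  qed
qed

text \<open>The two pages are returned as sets, since only a splitting of the arcs into two
  noncrossing families matters for the drawing.\<close>

lemma two_pages_sound:
  "two_pages es U D \<Longrightarrow> noncrossing (set U) \<Longrightarrow> noncrossing (set D) \<Longrightarrow>
   \<exists>U' D'. set es \<union> set U \<union> set D \<subseteq> U' \<union> D' \<and> noncrossing U' \<and> noncrossing D'"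
proof (induction es U D rule: two_pages.induct)
  case (1 U D)
  thus ?case by (intro exI[of _ "set U"] exI[of _ "set D"]) auto
next
  case (2 a b es U D)
  show ?case
  proof (cases "nocross a b U")
    case True
    hence "noncrossing (set ((a, b) # U))" "two_pages es ((a, b) # U) D" using 2 noncrossing_insert by simp_all
    from 2(1)[OF True this(2,1) 2(5)] show ?thesis by auto
  next
    case False
    hence "nocross a b D" using 2(3) by (simp split: if_splits)
    moreover from this False have "noncrossing (set ((a, b) # D))" "two_pages es U ((a, b) # D)"
      using 2 noncrossing_insert by simp_all
    ultimately show ?thesis using 2(2)[OF False _ _ 2(4)] by auto
  qed
qed

text \<open>The labels missing from \<open>r\<close> are the deleted vertices; there are at most
  \<open>k\<close> of them because \<open>r\<close> is distinct and has length at least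
  \<open>n - k\<close>.\<close>

lemma two_pages_kapex:
  assumes "simple_graph V E" "bij_betw f {..<n} V"
    and P: "\<And>i j. i < j \<Longrightarrow> j < n \<Longrightarrow> {f i, f j} \<in> E \<Longrightarrow> (i, j) \<in> set P"
    and r: "n \<le> length r + k" "distinct r" "\<And>v. v \<in> set r \<Longrightarrow> v < n" "two_pages (arcs r P) [] []"
  shows "kapex k V E"
proof -
  define S where "S = f ` ({..<n} - set r)"
  have fV: "f ` {..<n} = V" and inj: "inj_on f {..<n}" using assms(2) by (auto simp: bij_betw_def)
  have "card S \<le> card ({..<n} - set r)" unfolding S_def by (rule card_image_le) simp
  also have "\<dots> = n - length r"
    using r(2,3) by (subst card_Diff_subset) (auto simp: distinct_card)
  finally have cS: "card S \<le> k" using r(1) by simp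
  have SV: "S \<subseteq> V" using fV by (auto simp: S_def)
  have VS: "V - S = f ` set r"
  proof -
    have "V - S = f ` ({..<n} - ({..<n} - set r))"
      unfolding S_def fV[symmetric] by (rule inj_on_image_set_diff[OF inj, symmetric]) auto
    moreover have "{..<n} - ({..<n} - set r) = set r" using r(3) by auto
    ultimately show ?thesis by simp
  qed
  define pos where "pos x = the (idx r (inv_into {..<n} f x) 0)" for x
  have posf: "idx r i 0 = Some (pos (f i))" if "i \<in> set r" for i
    using idx_mem[OF that, of 0] r(3)[OF that] inj by (auto simp: pos_def)
  have ipos: "inj_on pos (V - S)"
  proof (rule inj_onI)
    fix x y assume "x \<in> V - S" "y \<in> V - S" "pos x = pos y"
    then obtain i j where ij: "i \<in> set r" "j \<in> set r" "x = f i" "y = f j" using VS by auto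
    have "r ! pos (f i) = i" "r ! pos (f j) = j"
      using idx_Some[OF posf[OF ij(1)]] idx_Some[OF posf[OF ij(2)]] by simp_all
    moreover have "pos (f i) = pos (f j)" using \<open>pos x = pos y\<close> ij(3,4) by simp
    ultimately have "i = j" by metis
    thus "x = y" using ij by simp
  qed
  have simp': "simple_graph (V - S) (del S E)" by (rule simple_graph_del[OF assms(1)])
  have arc: "(pos a, pos b) \<in> set (arcs r P)" if e: "{a, b} \<in> del S E" and ab: "pos a < pos b" for a b
  proof -
    have "a \<in> V - S" "b \<in> V - S" using simp' e by (auto simp: simple_graph_def)
    then obtain i j where ij: "i \<in> set r" "j \<in> set r" "a = f i" "b = f j" using VS by auto
    have "i \<noteq> j" using ab ij by auto
    have "{f i, f j} \<in> E" using e ij by (simp add: del_def)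
    have m: "min (pos a) (pos b) = pos a" "max (pos a) (pos b) = pos b"
       "min (pos b) (pos a) = pos a" "max (pos b) (pos a) = pos b" using ab by auto
    have p: "idx r i 0 = Some (pos a)" "idx r j 0 = Some (pos b)" using posf ij by auto
    have lt: "i < n" "j < n" using r(3) ij(1,2) by auto
    show ?thesis
    proof (cases "i < j")
      case True
      hence "(i, j) \<in> set P" using P[of i j] lt \<open>{f i, f j} \<in> E\<close> by simp
      from arcs_mem[OF this p] show ?thesis by (simp only: m)
    next
      case False
      hence "j < i" using \<open>i \<noteq> j\<close> by simp
      hence "(j, i) \<in> set P" using P[of j i] lt \<open>{f i, f j} \<in> E\<close> by (simp add: insert_commute)
      from arcs_mem[OF this p(2,1)] show ?thesis by (simp only: m)
    qed
  qed
  obtain U D where UD: "set (arcs r P) \<subseteq> U \<union> D" "noncrossing U" "noncrossing D"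
    using two_pages_sound[OF r(4)] by (auto simp: noncrossing_def)
  have "thick (V - S) (del S E)"
  \<comment> \<open>An arc lying in both families is put on page \<open>U\<close>; all arcs on the
    other page then belong to \<open>D\<close>.\<close>
  proof (rule book_embedding_thick[OF simp' ipos, of "\<lambda>e. (Min (pos ` e), Max (pos ` e)) \<in> U"])
    fix a b c d
    assume H: "{a, b} \<in> del S E" "{c, d} \<in> del S E"
      "((Min (pos ` {a, b}), Max (pos ` {a, b})) \<in> U) = ((Min (pos ` {c, d}), Max (pos ` {c, d})) \<in> U)"
      "pos a < pos c" "pos c < pos b" "pos b < pos d"
    have "(pos a, pos b) \<in> U \<union> D" "(pos c, pos d) \<in> U \<union> D" using arc[OF H(1)] arc[OF H(2)] H UD(1) by auto
    moreover have "((pos a, pos b) \<in> U) = ((pos c, pos d) \<in> U)" using H(3-6) by (simp add: min_def max_def)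
    ultimately have "(pos a, pos b) \<in> U \<and> (pos c, pos d) \<in> U \<or> (pos a, pos b) \<in> D \<and> (pos c, pos d) \<in> D" by blast
    thus False using UD(2,3) H(4-6) unfolding noncrossing_def by blast
  qed
  thus ?thesis using cS SV by (auto simp: kapex_def)
qed

lemma embeds_copy:
  assumes "embeds n A s es r" "inj_on f {..<n}" "f ` {..<n} \<subseteq> V" "\<And>i j. (i, j) \<in> set A \<Longrightarrow> {f i, f j} \<in> E"
    and "\<And>i j. (i, j) \<in> set es \<Longrightarrow> i < s \<and> j < s"
  shows "copy s es V E"
proof -
  have r: "length r = s" "distinct r" "\<And>v. v \<in> set r \<Longrightarrow> v < n" and
    j: "\<And>i j. (i, j) \<in> set es \<Longrightarrow> joined A (r ! i) (r ! j)"
    using assms(1) by (auto simp: embeds_def list_all_iff)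
  let ?g = "\<lambda>i. f (r ! i)"
  have "inj_on (\<lambda>i. r ! i) {..<s}" using r(1,2) by (auto simp: inj_on_def nth_eq_iff_index_eq)
  moreover have "(\<lambda>i. r ! i) ` {..<s} \<subseteq> {..<n}" using r by auto
  ultimately have "inj_on ?g {..<s}" using comp_inj_on[of "\<lambda>i. r ! i" "{..<s}" f] assms(2)
    by (auto simp: comp_def intro: inj_on_subset)
  moreover have "?g ` {..<s} \<subseteq> V" using \<open>(\<lambda>i. r ! i) ` {..<s} \<subseteq> {..<n}\<close> assms(3) by auto
  moreover have "{?g i, ?g j} \<in> E" if "(i, j) \<in> set es" for i j
  proof -
    have "(r ! i, r ! j) \<in> set A \<or> (r ! j, r ! i) \<in> set A" using j[OF that] by (auto simp: joined_def list_ex_iff)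
    thus ?thesis using assms(4) by (metis insert_commute)
  qed
  ultimately show ?thesis unfolding copy_def by (intro exI[of _ ?g]) auto
qed

lemma edge_pairs_bij:
  fixes n :: nat
  assumes "simple_graph V E" "bij_betw f {..<n} V"
  shows "bij_betw (\<lambda>(i, j). {f i, f j}) {(i, j). i < j \<and> j < n \<and> {f i, f j} \<in> E} E"
  unfolding bij_betw_def
proof
  have fV: "f ` {..<n} = V" and inj: "inj_on f {..<n}" using assms(2) by (auto simp: bij_betw_def)
  have ff: "i = j" if "i < n" "j < n" "f i = f j" for i j using inj that by (auto dest: inj_onD)
  show "inj_on (\<lambda>(i, j). {f i, f j}) {(i, j). i < j \<and> j < n \<and> {f i, f j} \<in> E}"
  proof (rule inj_onI, clarify)
    fix i j i' j' assume H: "i < j" "j < n" "i' < j'" "j' < n" "{f i, f j} = {f i', f j'}"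
    have l: "i < j" "j < n" "i' < j'" "j' < n" "i < n" "i' < n" using H by linarith+
    have "f i = f i' \<and> f j = f j' \<or> f i = f j' \<and> f j = f i'" using H(5) by (simp only: doubleton_eq_iff)
    thus "i = i' \<and> j = j'"
    proof (elim disjE conjE)
      assume "f i = f i'" "f j = f j'"
      thus ?thesis using ff[of i i'] ff[of j j'] l by simp
    next
      assume "f i = f j'" "f j = f i'"
      hence "i = j'" "j = i'" using ff[of i j'] ff[of j i'] l by simp_all
      thus ?thesis using l by simp
    qed
  qed
  show "(\<lambda>(i, j). {f i, f j}) ` {(i, j). i < j \<and> j < n \<and> {f i, f j} \<in> E} = E"
  proof (intro equalityI subsetI)
    fix e assume e: "e \<in> E"
    then obtain a b where ab: "e = {a, b}" "a \<noteq> b" "a \<in> V" "b \<in> V" using assms(1)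
      by (metis card_2_iff insert_subset simple_graph_def)
    then obtain i j where ij: "i < n" "j < n" "a = f i" "b = f j" using fV by (metis imageE lessThan_iff)
    show "e \<in> (\<lambda>(i, j). {f i, f j}) ` {(i, j). i < j \<and> j < n \<and> {f i, f j} \<in> E}"
    proof (cases "i < j")
      case True thus ?thesis using e ij ab by (intro image_eqI[of _ _ "(i, j)"]) auto
    next
      case False
      hence "j < i" using ij ab by (cases "i = j") auto
      thus ?thesis using e ij ab by (intro image_eqI[of _ _ "(j, i)"]) (auto simp: insert_commute)
    qed
  qed auto
qed

text \<open>Every node preserves the invariant \<open>set A \<subseteq> R \<subseteq> set P\<close>,
  where \<open>R\<close> is the edge set written as increasing pairs of labels. All leaves except
  \<open>Co\<close> contradict the hypotheses, so for an empty list of targets the conclusion is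
  false, and an accepted tree shows that the graph is \<open>k\<close>-apex.\<close>

theorem chk_sound:
  assumes "chk n k m lo hi T A P t"
    and G: "simple_graph V E" "bij_betw f {..<n} V" "\<not> kapex k V E" "card E \<le> m"
    and lo: "\<And>i. i < n \<Longrightarrow> lo i \<le> deg E (f i)" and hi: "\<And>i. i < n \<Longrightarrow> deg E (f i) \<le> hi i"
    and T: "\<And>s es i j. (s, es) \<in> set T \<Longrightarrow> (i, j) \<in> set es \<Longrightarrow> i < s \<and> j < s"
    and A: "\<And>i j. (i, j) \<in> set A \<Longrightarrow> i < j \<and> j < n \<and> {f i, f j} \<in> E"
    and P: "\<And>i j. i < j \<Longrightarrow> j < n \<Longrightarrow> {f i, f j} \<in> E \<Longrightarrow> (i, j) \<in> set P"
  shows "\<exists>(s, es)\<in>set T. copy s es V E"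
proof -
  define R where "R = {(i, j). i < j \<and> j < n \<and> {f i, f j} \<in> E}"
  define N where "N v = {(i, j)\<in>R. i = v \<or> j = v}" for v
  have fV: "f ` {..<n} = V" and inj: "inj_on f {..<n}" using G(2) by (auto simp: bij_betw_def)
  have bij: "bij_betw (\<lambda>(i, j). {f i, f j}) R E" unfolding R_def by (rule edge_pairs_bij[OF G(1,2)])
  have finR: "finite R" using bij simple_graph_finite_edges[OF G(1)] bij_betw_finite by blast
  have cR: "card R = card E" using bij by (rule bij_betw_same_card)
  have dN: "deg E (f v) = card (N v)" if v: "v < n" for v
  proof -
    have "bij_betw (\<lambda>(i, j). {f i, f j}) (N v) {e \<in> E. f v \<in> e}"
      unfolding bij_betw_def
    proof
      show "inj_on (\<lambda>(i, j). {f i, f j}) (N v)"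
        using bij by (rule bij_betw_imp_inj_on[THEN inj_on_subset]) (auto simp: N_def)
      have 1: "f v \<in> {f i, f j} \<longleftrightarrow> i = v \<or> j = v" if "(i, j) \<in> R" for i j
        using that v inj by (auto simp: R_def dest: inj_onD)
      have 2: "E = (\<lambda>(i, j). {f i, f j}) ` R" using bij by (simp add: bij_betw_def)
      show "(\<lambda>(i, j). {f i, f j}) ` N v = {e \<in> E. f v \<in> e}"
      proof -
        have "(\<lambda>(i, j). {f i, f j}) ` {z \<in> R. case z of (i, j) \<Rightarrow> i = v \<or> j = v} =
              (\<lambda>(i, j). {f i, f j}) ` {z \<in> R. f v \<in> (case z of (i, j) \<Rightarrow> {f i, f j})}"
          by (rule arg_cong[where f = "image _"], rule Collect_cong) (use 1 in \<open>auto split: prod.split\<close>)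
        also have "\<dots> = {e \<in> (\<lambda>(i, j). {f i, f j}) ` R. f v \<in> e}" by blast
        also have "{z \<in> R. case z of (i, j) \<Rightarrow> i = v \<or> j = v} = N v" by (auto simp: N_def)
        finally show ?thesis unfolding 2[symmetric] .
      qed
    qed
    thus ?thesis unfolding deg_def by (rule bij_betw_same_card[symmetric])
  qed
  have finN: "finite (N v)" for v by (rule finite_subset[OF _ finR]) (auto simp: N_def)
  have atA: "length (inc v A) = card (set (inc v A))" "set (inc v A) \<subseteq> N v" if "distinct A" "set A \<subseteq> R" for v A
  proof -
    show "length (inc v A) = card (set (inc v A))" by (rule distinct_card[symmetric]) (simp add: inc_def that)
    show "set (inc v A) \<subseteq> N v" using that by (auto simp: inc_def N_def)
  qed
  have atP: "N v \<subseteq> set (inc v P)" if "R \<subseteq> set P" for v P using that by (auto simp: inc_def N_def)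
  have AR: "set A \<subseteq> R" using A by (auto simp: R_def)
  have PR: "R \<subseteq> set P" using P by (auto simp: R_def)
  have main: "chk n k m lo hi T A P t \<Longrightarrow> set A \<subseteq> R \<Longrightarrow> R \<subseteq> set P \<Longrightarrow> \<exists>(s, es)\<in>set T. copy s es V E" for A P
  proof (induction t arbitrary: A P)
    case (Br i j s t)
    show ?case
    proof (cases "(i, j) \<in> R")
      case True
      thus ?thesis using Br.IH(1)[of "(i, j) # A" P] Br.prems by simp
    next
      case False
      thus ?thesis using Br.IH(2)[of A "removeAll (i, j) P"] Br.prems by auto
    qed
  next
    case (Dr r)
    have "kapex k V E"
    proof (rule two_pages_kapex[OF G(1,2)])
      show "(i, j) \<in> set P" if "i < j" "j < n" "{f i, f j} \<in> E" for i j
        using that Dr.prems(3) by (auto simp: R_def)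
    qed (use Dr.prems(1) in \<open>auto simp: list_all_iff\<close>)
    thus ?case using G(3) by simp
  next
    case Mx
    hence d: "distinct A" by simp
    have "length A \<le> m" using card_mono[OF finR Mx(2)] distinct_card[OF d] cR G(4) by simp
    moreover have "sum_list (map (\<lambda>v. max (lo v) (length (inc v A))) [0..<n]) \<le> (\<Sum>v<n. deg E (f v))"
      unfolding sum_list_distinct_conv_sum_set[OF distinct_upt] atLeast0LessThan[symmetric] set_upt
    proof (rule sum_mono)
      fix v assume "v \<in> {0..<n}"
      thus "max (lo v) (length (inc v A)) \<le> deg E (f v)"
        using lo atA[OF d Mx(2), of v] card_mono[OF finN] dN by simp
    qed
    moreover have "(\<Sum>v<n. deg E (f v)) = (\<Sum>v\<in>V. deg E v)" by (rule sum.reindex_bij_betw[OF G(2)])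
    ultimately show ?case using Mx(1) handshake[OF G(1)] G(4) by simp
  next
    case (Hi v)
    hence v: "v < n" and d: "distinct A" by simp_all
    have "length (inc v A) \<le> hi v"
      using card_mono[OF finN atA(2)[OF d Hi(2), of v]] atA(1)[OF d Hi(2), of v] dN[OF v] hi[OF v] by simp
    thus ?case using Hi by simp
  next
    case (Lo v)
    hence v: "v < n" by simp
    have "card (N v) \<le> card (set (inc v P))" by (rule card_mono[OF _ atP[OF Lo(3)]]) simp
    hence "lo v \<le> length (inc v P)" using card_length[of "inc v P"] dN[OF v] lo[OF v] by linarith
    thus ?case using Lo by simp
  next
    case (Fu v t)
    hence v: "v < n" and d: "distinct A" and l: "length (inc v A) = hi v" by simp_all
    \<comment> \<open>The known edges at \<open>v\<close> are among its actual edges and already as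
      many as the bound \<open>hi v\<close> permits, so they are all of them.\<close>
    have "N v = set (inc v A)"
      using card_seteq[OF finN atA(2)[OF d Fu.prems(2), of v]] atA(1)[OF d Fu.prems(2), of v] l dN[OF v] hi[OF v] by simp
    hence "N v \<subseteq> set A" by (auto simp: inc_def)
    hence s: "R \<subseteq> set (filter (\<lambda>(i, j). (i \<noteq> v \<and> j \<noteq> v) \<or> (i, j) \<in> set A) P)"
      using Fu.prems(3) by (auto simp: N_def)
    have c: "chk n k m lo hi T A (filter (\<lambda>(i, j). (i \<noteq> v \<and> j \<noteq> v) \<or> (i, j) \<in> set A) P) t" using Fu.prems(1) by simp
    show ?case by (rule Fu.IH[OF c Fu.prems(2) s])
  next
    case (Fo v t)
    hence v: "v < n" and l: "length (inc v P) = lo v" by simp_all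
    have "card (set (inc v P)) \<le> card (N v)" using card_length[of "inc v P"] dN[OF v] lo[OF v] l by simp
    hence "N v = set (inc v P)" using card_seteq[OF _ atP[OF Fo.prems(3)]] by auto
    hence s: "set (inc v P @ noninc v A) \<subseteq> R" using Fo.prems(2) by (auto simp: N_def noninc_def)
    have c: "chk n k m lo hi T (inc v P @ noninc v A) P t" using Fo.prems(1) by simp
    show ?case by (rule Fo.IH[OF c s Fo.prems(3)])
  next
    case (To t)
    hence d: "distinct A" and l: "length A = m" by simp_all
    have "R = set A" using card_seteq[OF finR To.prems(2)] distinct_card[OF d] l cR G(4) by simp
    hence s: "R \<subseteq> set (filter (\<lambda>e. e \<in> set A) P)" using To.prems(3) by auto
    have c: "chk n k m lo hi T A (filter (\<lambda>e. e \<in> set A) P) t" using To.prems(1) by simp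
    show ?case by (rule To.IH[OF c To.prems(2) s])
  next
    case (Co c r)
    obtain s es where se: "T ! c = (s, es)" by (cases "T ! c")
    have mem: "(s, es) \<in> set T" using Co.prems(1) se by (metis chk.simps(9) nth_mem)
    have "copy s es V E"
    proof (rule embeds_copy[OF _ inj])
      show "embeds n A s es r" using Co.prems(1) se by simp
      show "{f i, f j} \<in> E" if "(i, j) \<in> set A" for i j using that Co.prems(2) by (auto simp: R_def)
    qed (use fV T[OF mem] in auto)
    thus ?case using mem by auto
  qed
  show ?thesis by (rule main[OF assms(1) AR PR])
qed

section \<open>Labelled copies inside a graph\<close>

definition ordered_pairs :: "nat \<Rightarrow> (nat \<times> nat) list \<Rightarrow> bool" where
  "ordered_pairs n es \<longleftrightarrow> distinct es \<and> list_all (\<lambda>(i, j). i < j \<and> j < n) es"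

definition pairs :: "nat \<Rightarrow> (nat \<times> nat) list" where
  "pairs n = concat (map (\<lambda>i. map (Pair i) [Suc i..<n]) [0..<n])"

lemma set_pairs: "set (pairs n) = {(i, j). i < j \<and> j < n}"
  by (force simp: pairs_def)

lemma copy_card_le:
  assumes "copy r es V E" "ordered_pairs r es" "finite E"
  shows "length es \<le> card E"
proof -
  obtain f where f: "inj_on f {..<r}" "\<And>i j. (i, j) \<in> set es \<Longrightarrow> {f i, f j} \<in> E"
    using assms(1) by (auto simp: copy_def)
  have o: "distinct es" "\<And>i j. (i, j) \<in> set es \<Longrightarrow> i < j \<and> j < r"
    using assms(2) by (auto simp: ordered_pairs_def list_all_iff)
  have ff: "i = j" if "i < r" "j < r" "f i = f j" for i j using f(1) that by (auto dest: inj_onD)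
  have "inj_on (\<lambda>(i, j). {f i, f j}) (set es)"
  proof (rule inj_onI, clarify)
    fix i j i' j' assume H: "(i, j) \<in> set es" "(i', j') \<in> set es" "{f i, f j} = {f i', f j'}"
    have l: "i < j" "j < r" "i' < j'" "j' < r" "i < r" "i' < r" using o(2)[OF H(1)] o(2)[OF H(2)] by linarith+
    have "f i = f i' \<and> f j = f j' \<or> f i = f j' \<and> f j = f i'" using H(3) by (simp only: doubleton_eq_iff)
    thus "i = i' \<and> j = j'"
    proof (elim disjE conjE)
      assume "f i = f i'" "f j = f j'"
      thus ?thesis using ff[of i i'] ff[of j j'] l by simp
    next
      assume "f i = f j'" "f j = f i'"
      hence "i = j'" "j = i'" using ff[of i j'] ff[of j i'] l by simp_all
      thus ?thesis using l by simp
    qed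
  qed
  moreover have "(\<lambda>(i, j). {f i, f j}) ` set es \<subseteq> E" using f(2) by auto
  ultimately have "card (set es) \<le> card E" using assms(3) by (metis card_image card_mono)
  thus ?thesis using o(1) by (simp add: distinct_card)
qed

lemma extend_injection:
  fixes g :: "nat \<Rightarrow> 'a"
  assumes "inj_on g {..<r}" "g ` {..<r} \<subseteq> V" "finite V" "card V = n"
  obtains f where "bij_betw f {..<n} V" "\<And>i. i < r \<Longrightarrow> f i = g i" "r \<le> n"
proof -
  have rn: "r \<le> n" using card_inj_on_le[OF assms(1-3)] assms(4) by simp
  have "card (V - g ` {..<r}) = card {r..<n}"
    using assms by (simp add: card_Diff_subset card_image)
  then obtain h where h: "bij_betw h {r..<n} (V - g ` {..<r})"
    using finite_same_card_bij[of "{r..<n}" "V - g ` {..<r}"] assms(3) by auto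
  define f where "f i = (if i \<in> {..<r} then g i else h i)" for i
  have "bij_betw f ({..<r} \<union> {r..<n}) (g ` {..<r} \<union> (V - g ` {..<r}))"
    unfolding f_def by (rule bij_betw_disjoint_Un) (use assms h in \<open>auto simp: bij_betw_def\<close>)
  moreover have "{..<r} \<union> {r..<n} = {..<n}" "g ` {..<r} \<union> (V - g ` {..<r}) = V" using rn assms(2) by auto
  ultimately have "bij_betw f {..<n} V" by simp
  thus thesis using that rn by (simp add: f_def)
qed

lemma copy_extend:
  assumes "copy r es V E" "ordered_pairs r es" "finite V" "card V = n"
  obtains f where "bij_betw f {..<n} V" "\<And>i j. (i, j) \<in> set es \<Longrightarrow> {f i, f j} \<in> E" "r \<le> n"
proof -
  obtain g where g: "inj_on g {..<r}" "g ` {..<r} \<subseteq> V" "\<And>i j. (i, j) \<in> set es \<Longrightarrow> {g i, g j} \<in> E"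
    using assms(1) by (auto simp: copy_def)
  obtain f where f: "bij_betw f {..<n} V" "\<And>i. i < r \<Longrightarrow> f i = g i" "r \<le> n"
    using extend_injection[OF g(1,2) assms(3,4)] by metis
  have "{f i, f j} \<in> E" if "(i, j) \<in> set es" for i j
    using g(3)[OF that] f(2) that assms(2) by (fastforce simp: ordered_pairs_def list_all_iff)
  thus thesis using that f(1,3) by blast
qed

text \<open>With equal numbers of vertices and edges, a copy fills the whole graph and is an
  isomorphism. This lets a search treat a recognised graph as completely known.\<close>

lemma copy_exact:
  assumes "copy r es V E" "ordered_pairs r es" "simple_graph V E" "card V = r" "card E = length es"
  obtains f where "bij_betw f {..<r} V" "E = (\<lambda>(i, j). {f i, f j}) ` set es"
    "\<And>i j. i < j \<Longrightarrow> j < r \<Longrightarrow> {f i, f j} \<in> E \<Longrightarrow> (i, j) \<in> set es"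
proof -
  have fin: "finite V" using assms by (simp add: simple_graph_def)
  obtain f where f: "bij_betw f {..<r} V" "\<And>i j. (i, j) \<in> set es \<Longrightarrow> {f i, f j} \<in> E"
    using copy_extend[OF assms(1,2) fin assms(4)] by metis
  define R where "R = {(i, j). i < j \<and> j < r \<and> {f i, f j} \<in> E}"
  have bij: "bij_betw (\<lambda>(i, j). {f i, f j}) R E" unfolding R_def by (rule edge_pairs_bij[OF assms(3) f(1)])
  have "finite R" using bij simple_graph_finite_edges[OF assms(3)] bij_betw_finite by blast
  moreover have "set es \<subseteq> R" using f(2) assms(2) by (auto simp: R_def ordered_pairs_def list_all_iff)
  moreover have "card R = card (set es)"
    using bij_betw_same_card[OF bij] assms(2,5) by (simp add: ordered_pairs_def distinct_card)
  ultimately have "set es = R" by (simp add: card_subset_eq)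
  thus thesis using that[OF f(1)] bij by (auto simp: bij_betw_def R_def)
qed

lemma copy_mono: "copy r es V E \<Longrightarrow> V \<subseteq> V' \<Longrightarrow> E \<subseteq> E' \<Longrightarrow> copy r es V' E'"
  unfolding copy_def by (elim exE conjE, rule_tac x = f in exI) (simp add: subset_iff)

section \<open>Certificates\<close>

text \<open>
  The graphs \<open>seeds\<close> are, up to isomorphism, the subdivisions of \<open>K\<^sub>3\<^sub>,\<^sub>3\<close> and \<open>K\<^sub>5\<close> with at most 12 edges.
  The search trees of this section were found by a computer search.
\<close>

definition seeds :: "(nat \<times> (nat \<times> nat) list) list" where
  "seeds = [(6, [(0,3), (0,4), (0,5), (1,3), (1,4), (1,5), (2,3), (2,4), (2,5)]), (7, [(0,4),
    (0,5), (0,6), (1,3), (1,4), (1,5), (2,3), (2,4), (2,5), (3,6)]), (8, [(0,5), (0,6), (0,7),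
    (1,3), (1,4), (1,5), (2,3), (2,4), (2,5), (3,6), (4,7)]), (8, [(0,4), (0,5), (0,7), (1,3),
    (1,4), (1,5), (2,3), (2,4), (2,5), (3,6), (6,7)]), (8, [(0,4), (0,5), (0,6), (1,3), (1,5),
    (1,7), (2,3), (2,4), (2,5), (3,6), (4,7)]), (9, [(0,6), (0,7), (0,8), (1,3), (1,4), (1,5),
    (2,3), (2,4), (2,5), (3,6), (4,7), (5,8)]), (9, [(0,5), (0,7), (0,8), (1,3), (1,4), (1,5),
    (2,3), (2,4), (2,5), (3,6), (4,7), (6,8)]), (9, [(0,5), (0,6), (0,7), (1,4), (1,5), (1,8),
    (2,3), (2,4), (2,5), (3,6), (3,8), (4,7)]), (9, [(0,5), (0,6), (0,7), (1,3), (1,4), (1,8),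
    (2,3), (2,4), (2,5), (3,6), (4,7), (5,8)]), (9, [(0,4), (0,5), (0,8), (1,3), (1,4), (1,5),
    (2,3), (2,4), (2,5), (3,6), (6,7), (7,8)]), (9, [(0,4), (0,5), (0,7), (1,3), (1,5), (1,8),
    (2,3), (2,4), (2,5), (3,6), (4,8), (6,7)]), (9, [(0,4), (0,5), (0,6), (1,3), (1,5), (1,7),
    (2,3), (2,4), (2,8), (3,6), (4,7), (5,8)]), (5, [(0,1), (0,2), (0,3), (0,4), (1,2), (1,3),
    (1,4), (2,3), (2,4), (3,4)]), (6, [(0,2), (0,3), (0,4), (0,5), (1,2), (1,3), (1,4), (1,5),
    (2,3), (2,4), (3,4)]), (7, [(0,3), (0,4), (0,5), (0,6), (1,2), (1,3), (1,4), (1,5), (2,3),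
    (2,4), (2,6), (3,4)]), (7, [(0,2), (0,3), (0,4), (0,6), (1,2), (1,3), (1,4), (1,5), (2,3),
    (2,4), (3,4), (5,6)]), (7, [(0,2), (0,3), (0,4), (0,5), (1,2), (1,3), (1,4), (1,5), (2,4),
    (2,6), (3,4), (3,6)])]"

text \<open>Members of the Petersen family: \<open>K\<^sub>4\<^sub>,\<^sub>4\<close> minus an edge, \<open>P\<^sub>8\<close>, \<open>P\<^sub>9\<close> and the Petersen graph.\<close>

definition k44e :: "(nat \<times> nat) list" where
  "k44e = [(0,5), (0,6), (0,7), (1,4), (1,5), (1,6), (1,7), (2,4), (2,5), (2,6), (2,7), (3,4),
    (3,5), (3,6), (3,7)]"

definition p8 :: "(nat \<times> nat) list" where
  "p8 = [(0,4), (0,5), (0,6), (1,3), (1,4), (1,5), (1,7), (2,3), (2,4), (2,5), (2,7), (3,6),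
    (4,7), (5,7), (6,7)]"

definition p9 :: "(nat \<times> nat) list" where
  "p9 = [(0,4), (0,5), (0,6), (1,3), (1,5), (1,7), (2,3), (2,4), (2,5), (2,8), (3,6), (4,7),
    (5,8), (6,8), (7,8)]"

definition p10 :: "(nat \<times> nat) list" where
  "p10 = [(0,4), (0,5), (0,6), (1,3), (1,5), (1,7), (2,3), (2,4), (2,8), (3,6), (4,7), (5,8),
    (6,9), (7,9), (8,9)]"

text \<open>The new vertex gets the first free label \<open>r\<close>, so the two new pairs are
  again increasing.\<close>

definition subdivide :: "nat \<Rightarrow> nat \<Rightarrow> nat \<Rightarrow> (nat \<times> nat) list \<Rightarrow> (nat \<times> nat) list" where
  "subdivide r i j es = (i, r) # (j, r) # removeAll (i, j) es"

text \<open>All pairs that a newly added vertex \<open>n\<close> can form with the old ones: the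
  undetermined part when a known graph is extended by one vertex.\<close>

definition star :: "nat \<Rightarrow> (nat \<times> nat) list" where
  "star n = map (\<lambda>i. (i, n)) [0..<n]"

definition small_seeds :: "nat \<Rightarrow> nat \<Rightarrow> (nat \<times> (nat \<times> nat) list) list" where
  "small_seeds n l = filter (\<lambda>(r, es). r \<le> n \<and> length es \<le> l) seeds"

lemma ordered_seeds:
  "list_all (\<lambda>(r, es). ordered_pairs r es) seeds"
  by code_simp

lemma ordered_named:
  "ordered_pairs 8 k44e \<and> ordered_pairs 8 p8 \<and> ordered_pairs 9 p9 \<and> ordered_pairs
    10 p10"
  by code_simp

text \<open>Closure of the list under subdivision, as long as the result has at most 12 edges; this
  is what carries seeds back through smoothing. Each entry consists of the index of a seed contained
  in the subdivided graph and the relabelling that finds it. The bound 9 on vertices holds for all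
  seeds.\<close>

lemma seeds_subdivide:
  "list_all2 (\<lambda>(r, es). list_all2 (\<lambda>(i, j) (c, p). c < length seeds \<and> embeds
    (Suc r) (subdivide r i j es) (fst (seeds ! c)) (snd (seeds ! c)) p) es) (small_seeds 9 11)
    [[(1, [0,1,2,3,4,5,6]), (1, [0,1,2,4,3,5,6]), (1, [0,1,2,5,3,4,6]), (1, [1,0,2,3,4,5,6]), (1,
    [1,0,2,4,3,5,6]), (1, [1,0,2,5,3,4,6]), (1, [2,0,1,3,4,5,6]), (1, [2,0,1,4,3,5,6]), (1,
    [2,0,1,5,3,4,6])], [(2, [0,1,2,3,4,5,6,7]), (2, [0,1,2,3,5,4,6,7]), (3, [0,1,2,3,4,5,6,7]),
    (2, [3,4,5,0,1,2,6,7]), (4, [0,1,2,3,4,5,6,7]), (4, [0,1,2,3,5,4,6,7]), (2,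
    [3,4,5,0,2,1,6,7]), (4, [0,2,1,3,4,5,6,7]), (4, [0,2,1,3,5,4,6,7]), (3, [0,1,2,3,4,5,7,6])],
    [(5, [0,1,2,3,4,5,6,7,8]), (6, [0,1,2,3,4,5,6,7,8]), (6, [0,1,2,4,3,5,7,6,8]), (7,
    [0,1,2,3,4,5,6,7,8]), (7, [0,1,2,4,3,5,7,6,8]), (8, [0,1,2,3,4,5,6,7,8]), (7,
    [0,2,1,3,4,5,6,7,8]), (7, [0,2,1,4,3,5,7,6,8]), (8, [0,2,1,3,4,5,6,7,8]), (6,
    [0,1,2,3,4,5,8,7,6]), (6, [0,1,2,4,3,5,8,6,7])], [(6, [0,1,2,3,4,5,6,8,7]), (6,
    [0,1,2,3,5,4,6,8,7]), (9, [0,1,2,3,4,5,6,7,8]), (6, [3,4,5,0,1,2,7,8,6]), (10,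
    [0,1,2,3,4,5,6,7,8]), (10, [0,1,2,3,5,4,6,7,8]), (6, [3,4,5,0,2,1,7,8,6]), (10,
    [0,2,1,3,4,5,6,7,8]), (10, [0,2,1,3,5,4,6,7,8]), (9, [0,1,2,3,4,5,8,6,7]), (9,
    [0,1,2,3,4,5,6,8,7])], [(7, [0,1,2,4,3,5,8,6,7]), (8, [0,1,2,3,5,4,6,8,7]), (10,
    [0,1,2,3,4,5,6,8,7]), (7, [1,0,2,3,4,5,8,7,6]), (8, [1,0,2,4,5,3,7,8,6]), (10,
    [1,0,2,4,3,5,7,8,6]), (8, [3,4,5,0,2,1,6,8,7]), (8, [4,3,5,1,2,0,7,8,6]), (11,
    [0,1,2,3,4,5,6,7,8]), (10, [0,1,2,3,4,5,8,6,7]), (10, [1,0,2,4,3,5,8,7,6])], [(13,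
    [0,1,2,3,4,5]), (13, [0,2,1,3,4,5]), (13, [0,3,1,2,4,5]), (13, [0,4,1,2,3,5]), (13,
    [1,2,0,3,4,5]), (13, [1,3,0,2,4,5]), (13, [1,4,0,2,3,5]), (13, [2,3,0,1,4,5]), (13,
    [2,4,0,1,3,5]), (13, [3,4,0,1,2,5])], [(14, [0,1,2,3,4,5,6]), (14, [0,1,3,2,4,5,6]), (14,
    [0,1,4,2,3,5,6]), (15, [0,1,2,3,4,5,6]), (14, [1,0,2,3,4,5,6]), (14, [1,0,3,2,4,5,6]), (14,
    [1,0,4,2,3,5,6]), (15, [0,1,2,3,4,6,5]), (16, [0,1,2,3,4,5,6]), (16, [0,1,2,4,3,5,6]), (16,
    [0,1,3,4,2,5,6])]]"
  by code_simp

text \<open>Deleting any edge of \<open>K\<^sub>5\<close> makes it planar, so each negative branch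
  ends in a drawing at once.\<close>

lemma cert_kuratowski_5:
  "chk 5 0 11 (\<lambda>_. 0) (\<lambda>_. 4) seeds [] (pairs 5) (Br 0 1 (Br 0 2 (Br 0 3 (Br 0 4
    (Br 1 2 (Br 1 3 (Br 1 4 (Br 2 3 (Br 2 4 (Br 3 4 (Co 12 [0,1,2,3,4]) (Dr [0,1,3,2,4])) (Dr
    [0,1,2,3,4])) (Dr [0,1,2,4,3])) (Dr [0,1,2,4,3])) (Dr [0,1,2,3,4])) (Dr [0,1,3,2,4])) (Dr
    [1,0,2,3,4])) (Dr [1,0,2,3,4])) (Dr [1,0,3,2,4])) (Dr [2,0,3,1,4]))"
  by code_simp

text \<open>Vertex 0 has degree 3, with its neighbours labelled 1 to 3: six vertices of degree at
  least 4 would need 12 edges.\<close>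

lemma cert_kuratowski_6:
  "chk 6 0 11 (\<lambda>_. 3) (\<lambda>i. if i = 0 then 3 else 5) seeds [(0,1), (0,2), (0,3)]
    (pairs 6) (Fu 0 (Br 1 4 (Br 1 5 (Br 2 4 (Br 3 4 (Br 4 5 (Br 2 5 (Br 3 5 (Co 0 [0,4,5,1,2,3])
    (Dr [1,0,2,3,4,5])) (Dr [1,0,2,3,5,4])) (Fo 5 (Co 0 [0,4,5,1,2,3]))) (Dr [1,0,2,3,5,4])) (Dr
    [1,0,2,3,4,5])) (Dr [2,0,1,3,5,4])) (Dr [2,0,1,3,4,5])))"
  by code_simp

text \<open>With minimum degree 3, seven vertices and at most 11 edges, the degree sequence is
  forced: it consists of one 4 and six 3s. The exceptional vertex and its neighbours get the labels
  0 to 4.\<close>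

lemma cert_kuratowski_7:
  "chk 7 0 11 (\<lambda>i. if i = 0 then 4 else 3) (\<lambda>i. if i = 0 then 4 else 3) seeds
    [(0,1), (0,2), (0,3), (0,4)] (pairs 7) (Fu 0 (Br 1 2 (Br 1 3 (Fu 1 (Br 2 5 (Fu 2 (Fo 6 (Fu 3
    (Fo 4 (Dr [0,1,2,5,4,6,3]))))) (Dr [3,0,1,2,4,5,6]))) (Br 2 3 (Fu 2 (Br 1 5 (Fu 1 (Fo 6 (Fu 3
    (Fo 4 (Dr [0,1,2,3,6,4,5]))))) (Dr [3,0,2,1,4,5,6]))) (Br 1 4 (Fu 1 (Br 2 5 (Fu 2 (Fo 6 (Fu 4
    (Fo 5 (Dr [0,1,2,5,3,6,4]))))) (Dr [4,0,1,2,6,3,5]))) (Br 1 5 (Fu 1 (Br 2 6 (Fu 2 (Br 3 4 (Br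
    3 5 (Fu 3 (Fo 6 (To (Dr [0,1,2,6,4,3,5])))) (Dr [0,1,2,6,3,4,5])) (Fo 3 (Fo 4 (Fu 5 (Co 1
    [1,3,4,6,0,5,2])))))) (Dr [4,0,2,1,5,3,6]))) (Fo 1 (Br 2 5 (Fu 2 (Br 3 4 (Br 3 5 (Fu 3 (Fo 6
    (To (Dr [0,1,2,5,3,4,6])))) (Dr [0,1,2,5,4,3,6])) (Fo 3 (Fo 4 (Fu 5 (Co 1
    [1,3,4,5,0,6,2])))))) (Dr [4,0,2,1,6,3,5]))))))) (Br 1 3 (Br 2 3 (Fu 3 (Br 1 5 (Fu 1 (Fo 6 (Fu
    2 (Fo 4 (Dr [0,1,3,2,6,4,5]))))) (Dr [2,0,3,1,4,5,6]))) (Br 1 4 (Fu 1 (Br 3 5 (Fu 3 (Fo 6 (Fu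
    4 (Fo 5 (Dr [0,1,3,5,2,6,4]))))) (Dr [4,0,1,3,6,2,5]))) (Br 1 5 (Fu 1 (Br 3 6 (Fu 3 (Br 2 4
    (Br 2 5 (Fu 2 (Fo 6 (To (Dr [0,1,3,6,4,2,5])))) (Dr [0,1,3,6,2,4,5])) (Fo 2 (Fo 4 (Fu 5 (Co 1
    [1,2,4,6,0,5,3])))))) (Dr [4,0,2,6,5,1,3]))) (Fo 1 (Br 3 5 (Fu 3 (Br 2 4 (Br 2 5 (Fu 2 (Fo 6
    (To (Dr [0,1,3,5,2,4,6])))) (Dr [0,1,3,5,4,2,6])) (Fo 2 (Fo 4 (Fu 5 (Co 1
    [1,2,4,5,0,6,3])))))) (Dr [4,0,2,5,6,1,3])))))) (Br 1 4 (Br 2 4 (Fu 4 (Br 1 5 (Fu 1 (Fo 6 (Fu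
    2 (Fo 3 (Dr [0,1,4,2,6,3,5]))))) (Dr [2,0,3,5,6,1,4]))) (Br 1 5 (Fu 1 (Br 4 6 (Fu 4 (Br 2 3
    (Br 2 5 (Fu 2 (Fo 6 (To (Dr [0,1,4,6,3,2,5])))) (Dr [0,1,4,6,2,3,5])) (Fo 2 (Fo 3 (Fu 5 (Co 1
    [1,2,3,6,0,5,4])))))) (Dr [3,0,2,6,5,1,4]))) (Fo 1 (Br 4 5 (Fu 4 (Br 2 3 (Br 2 5 (Fu 2 (Fo 6
    (To (Dr [0,1,4,5,2,3,6])))) (Dr [0,1,4,5,3,2,6])) (Fo 2 (Fo 3 (Fu 5 (Co 1
    [1,2,3,5,0,6,4])))))) (Dr [3,0,2,5,6,1,4]))))) (Fo 1 (Br 2 3 (Br 2 4 (Fu 2 (Br 3 5 (Fu 3 (Fo 6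
    (To (Dr [0,1,5,3,2,4,6])))) (Dr [4,0,1,5,6,3,2]))) (Br 3 5 (Fu 3 (Fo 4 (Fu 5 (Fo 6 (Co 1
    [2,1,4,5,0,6,3]))))) (Br 2 5 (Fu 2 (Br 3 4 (Fu 3 (Fo 6 (To (Dr [0,1,5,2,3,4,6])))) (Fo 3 (Fo 4
    (Fu 5 (Co 1 [2,1,4,6,0,5,3])))))) (Dr [6,1,0,2,3,4,5])))) (Br 2 4 (Br 3 5 (Br 2 5 (Fu 2 (Fu 5
    (Fo 6 (To (Co 1 [2,1,3,6,0,5,4]))))) (Fo 2 (Br 3 4 (Fu 3 (Fu 4 (Fo 5 (Dr [0,1,5,3,4,2,6]))))
    (Fo 3 (Fu 6 (Fo 4 (Co 1 [2,1,3,5,0,6,4]))))))) (Fo 3 (Fu 4 (Fo 5 (Fu 6 (Dr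
    [0,1,5,2,4,3,6])))))) (Fo 2 (Br 3 5 (Fu 5 (Fo 4 (Fu 6 (Co 1 [3,1,2,6,0,5,4])))) (Fo 3 (Fu 6
    (Fo 4 (Co 1 [3,1,2,5,0,6,4])))))))))))))"
  by code_simp

text \<open>Here the graphs are cubic with 12 edges, the one case in which more than 11 edges are
  searched for seeds directly.\<close>

lemma cert_kuratowski_8:
  "chk 8 0 12 (\<lambda>_. 3) (\<lambda>_. 3) seeds [(0,1), (0,2), (0,3)] (pairs 8) (Fu 0 (Br 1 2
    (Br 1 3 (Fu 1 (Br 2 3 (Fu 2 (Fu 3 (Fo 4 (Fo 5 (Fo 6 (Dr [0,1,2,3,4,5,6,7])))))) (Br 2 4 (Fu 2
    (Br 3 5 (Fu 3 (Fo 6 (Fo 7 (To (Dr [0,1,2,4,6,5,7,3]))))) (Dr [3,0,1,2,4,5,6,7]))) (Br 3 5 (Fu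
    3 (Fo 4 (Dr [2,0,1,3,5,4,6,7]))) (Br 2 5 (Fu 2 (Br 3 4 (Fu 3 (Fo 6 (Fo 7 (To (Dr
    [0,1,2,5,6,4,7,3]))))) (Dr [3,0,1,2,5,4,6,7]))) (Dr [3,0,1,2,6,5,7,4])))))) (Br 2 3 (Fu 2 (Br
    1 4 (Fu 1 (Br 3 5 (Fu 3 (Fo 6 (Fo 7 (To (Dr [0,1,2,3,5,6,4,7]))))) (Dr [3,0,1,2,4,5,6,7])))
    (Br 3 5 (Fu 3 (Fo 4 (Dr [1,0,2,3,5,4,6,7]))) (Br 1 5 (Fu 1 (Br 3 4 (Fu 3 (Fo 6 (Fo 7 (To (Dr
    [0,1,2,3,4,6,5,7]))))) (Dr [3,0,1,2,5,4,6,7]))) (Dr [3,0,1,2,6,4,5,7]))))) (Br 1 4 (Fu 1 (Br 2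
    4 (Fu 2 (Br 4 5 (Fu 4 (Fo 6 (Fo 7 (To (Dr [0,1,2,4,5,6,3,7]))))) (Dr [3,0,1,2,4,6,5,7]))) (Br
    2 5 (Fu 2 (Br 3 6 (Br 3 7 (Fu 3 (Br 4 5 (Br 4 6 (Fu 4 (Fo 7 (To (Dr [0,1,2,5,4,7,3,6])))) (Dr
    [5,2,0,1,4,7,3,6])) (Fo 4 (Fo 5 (Fu 6 (Co 2 [0,6,7,4,5,3,1,2])))))) (Dr [4,1,0,2,5,3,6,7]))
    (Dr [4,1,0,2,5,3,7,6]))) (Br 3 5 (Br 2 6 (Fu 2 (Br 3 7 (Fu 3 (Br 4 5 (Br 4 6 (Fu 4 (Fo 7 (To
    (Dr [0,1,2,6,4,7,3,5])))) (Fo 4 (Fo 6 (Fu 7 (Co 2 [0,5,7,4,6,3,1,2]))))) (Dr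
    [6,2,0,1,4,7,3,5]))) (Dr [4,1,0,2,6,3,5,7]))) (Fo 2 (Br 3 6 (Fu 3 (Br 4 5 (Br 4 6 (Fu 4 (Fo 7
    (To (Co 2 [0,5,6,4,7,3,1,2])))) (Dr [5,3,0,1,2,4,7,6])) (Dr [6,3,0,1,2,4,7,5]))) (Dr
    [4,1,0,2,7,3,5,6])))) (Fo 5 (Br 2 6 (Fu 2 (Dr [4,1,0,2,6,3,7,5])) (Dr [4,1,0,2,7,3,6,5])))))))
    (Br 2 4 (Fu 2 (Br 1 5 (Fu 1 (Br 3 6 (Br 3 7 (Fu 3 (Br 4 5 (Br 4 6 (Fu 4 (Fo 7 (To (Dr
    [0,1,2,4,5,6,3,7])))) (Dr [5,1,0,2,4,7,3,6])) (Fo 4 (Fo 5 (Fu 6 (Co 2 [0,6,7,4,5,3,2,1]))))))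
    (Dr [4,2,0,1,5,3,6,7])) (Dr [4,2,0,1,5,3,7,6]))) (Br 3 5 (Br 1 6 (Fu 1 (Br 3 7 (Fu 3 (Br 4 5
    (Br 4 6 (Fu 4 (Fo 7 (To (Dr [0,1,2,4,5,3,7,6])))) (Fo 4 (Fo 6 (Fu 7 (Co 2
    [0,5,7,4,6,3,2,1]))))) (Dr [6,1,0,2,4,7,3,5]))) (Dr [4,2,0,1,6,3,5,7]))) (Fo 1 (Br 3 6 (Fu 3
    (Br 4 5 (Br 4 6 (Fu 4 (Fo 7 (To (Co 2 [0,5,6,4,7,3,2,1])))) (Dr [5,3,0,1,6,7,4,2])) (Dr
    [6,3,0,1,5,7,4,2]))) (Dr [4,2,0,1,7,3,5,6])))) (Fo 5 (Br 1 6 (Fu 1 (Dr [4,2,0,1,6,3,7,5])) (Dr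
    [4,2,0,1,7,3,6,5])))))) (Br 3 4 (Br 1 5 (Fu 1 (Br 2 5 (Fu 2 (Br 3 6 (Fu 3 (Fo 7 (Fu 5 (Fo 6
    (Dr [0,1,2,5,7,4,3,6]))))) (Dr [5,1,0,2,3,4,6,7]))) (Br 2 6 (Fu 2 (Br 3 7 (Fu 3 (Br 4 5 (Br 4
    6 (Fu 4 (Fo 7 (To (Co 2 [0,4,7,5,6,3,1,2])))) (Dr [5,1,0,2,6,7,3,4])) (Dr [6,2,0,1,5,7,3,4])))
    (Dr [5,1,0,2,6,3,4,7]))) (Fo 2 (Br 3 6 (Fu 3 (Br 4 5 (Br 4 6 (Fu 4 (Fo 7 (To (Dr
    [0,1,2,7,5,6,3,4])))) (Fo 4 (Fo 6 (Fu 7 (Co 2 [0,4,6,5,7,3,1,2]))))) (Dr [6,3,0,1,2,5,7,4])))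
    (Dr [5,1,0,2,7,3,4,6])))))) (Br 1 6 (Fu 1 (Br 2 5 (Fu 2 (Br 3 7 (Fu 3 (Br 4 5 (Br 4 6 (Fu 4
    (Fo 7 (To (Co 2 [0,4,7,5,6,3,2,1])))) (Dr [5,2,0,1,6,7,3,4])) (Dr [6,1,0,2,5,7,3,4]))) (Dr
    [5,2,0,1,6,3,4,7]))) (Br 3 5 (Fu 3 (Br 2 6 (Fu 2 (Fo 7 (Fu 6 (Fo 4 (Dr [0,1,2,6,7,4,3,5])))))
    (Fo 2 (Br 4 5 (Br 4 6 (Fu 4 (Fo 7 (To (Dr [0,1,2,7,5,3,4,6])))) (Dr [5,3,0,1,2,6,7,4])) (Fo 4
    (Fo 5 (Fu 6 (Co 2 [0,4,5,6,7,3,1,2])))))))) (Dr [6,1,0,2,7,3,4,5])))) (Fo 1 (Br 2 5 (Fu 2 (Br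
    3 6 (Fu 3 (Br 4 5 (Br 4 6 (Fu 4 (Fo 7 (To (Dr [0,1,2,5,4,3,6,7])))) (Fo 4 (Fo 6 (Fu 7 (Co 2
    [0,4,6,5,7,3,2,1]))))) (Dr [6,3,0,1,4,7,5,2]))) (Dr [5,2,0,1,7,3,4,6]))) (Br 3 5 (Fu 3 (Br 2 6
    (Fu 2 (Br 4 5 (Br 4 6 (Fu 4 (Fo 7 (To (Dr [0,1,2,6,4,3,5,7])))) (Dr [5,3,0,1,4,7,6,2])) (Fo 4
    (Fo 5 (Fu 6 (Co 2 [0,4,5,6,7,3,2,1])))))) (Dr [7,1,0,2,3,4,5,6]))) (Dr [7,1,0,2,6,3,4,5]))))))
    (Fo 4 (Br 1 5 (Fu 1 (Br 2 6 (Fu 2 (Dr [5,1,0,2,6,3,7,4])) (Dr [5,1,0,2,7,3,6,4]))) (Br 2 6 (Fu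
    2 (Dr [6,1,0,2,3,5,4,7])) (Br 1 6 (Fu 1 (Br 2 5 (Fu 2 (Dr [5,2,0,1,6,3,7,4])) (Dr
    [6,1,0,2,7,3,5,4]))) (Dr [7,1,0,2,5,3,6,4])))))))))) (Br 1 3 (Br 2 3 (Fu 3 (Br 1 4 (Fu 1 (Br 2
    5 (Fu 2 (Fo 6 (Fo 7 (To (Dr [0,1,3,2,5,6,4,7]))))) (Dr [2,0,1,3,4,5,6,7]))) (Br 2 5 (Fu 2 (Fo
    4 (Dr [1,0,2,3,5,4,6,7]))) (Br 1 5 (Fu 1 (Br 2 4 (Fu 2 (Fo 6 (Fo 7 (To (Dr
    [0,1,3,2,4,6,5,7]))))) (Dr [2,0,1,3,5,4,6,7]))) (Dr [2,0,1,3,6,4,5,7]))))) (Br 1 4 (Fu 1 (Br 3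
    4 (Fu 3 (Br 4 5 (Fu 4 (Fo 6 (Fo 7 (To (Dr [0,1,3,4,5,6,2,7]))))) (Dr [2,0,1,3,4,6,5,7]))) (Br
    3 5 (Fu 3 (Br 2 6 (Br 2 7 (Fu 2 (Br 4 5 (Br 4 6 (Fu 4 (Fo 7 (To (Dr [0,1,3,5,4,7,2,6])))) (Dr
    [5,3,0,1,4,7,2,6])) (Fo 4 (Fo 5 (Fu 6 (Co 2 [0,6,7,4,5,2,1,3])))))) (Dr [4,1,0,2,6,7,5,3]))
    (Dr [4,1,0,2,7,6,5,3]))) (Br 2 5 (Br 3 6 (Fu 3 (Br 2 7 (Fu 2 (Br 4 5 (Br 4 6 (Fu 4 (Fo 7 (To
    (Dr [0,1,3,6,4,7,2,5])))) (Fo 4 (Fo 6 (Fu 7 (Co 2 [0,5,7,4,6,2,1,3]))))) (Dr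
    [6,3,0,1,4,7,2,5]))) (Dr [4,1,0,2,5,7,6,3]))) (Fo 3 (Br 2 6 (Fu 2 (Br 4 5 (Br 4 6 (Fu 4 (Fo 7
    (To (Co 2 [0,5,6,4,7,2,1,3])))) (Dr [5,2,0,1,3,4,7,6])) (Dr [6,2,0,1,3,4,7,5]))) (Dr
    [4,1,0,2,5,6,7,3])))) (Fo 5 (Br 3 6 (Fu 3 (Dr [4,1,0,2,7,5,6,3])) (Dr [4,1,0,2,6,5,7,3])))))))
    (Br 3 4 (Fu 3 (Br 1 5 (Fu 1 (Br 2 6 (Br 2 7 (Fu 2 (Br 4 5 (Br 4 6 (Fu 4 (Fo 7 (To (Dr
    [0,1,3,4,5,6,2,7])))) (Dr [5,1,0,2,6,7,4,3])) (Fo 4 (Fo 5 (Fu 6 (Co 2 [0,6,7,4,5,2,3,1]))))))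
    (Dr [4,2,0,3,1,5,6,7])) (Dr [4,2,0,3,1,5,6,7]))) (Br 2 5 (Br 1 6 (Fu 1 (Br 2 7 (Fu 2 (Br 4 5
    (Br 4 6 (Fu 4 (Fo 7 (To (Dr [0,1,3,4,5,2,7,6])))) (Fo 4 (Fo 6 (Fu 7 (Co 2
    [0,5,7,4,6,2,3,1]))))) (Dr [6,1,0,2,5,7,4,3]))) (Dr [4,2,0,3,1,6,5,7]))) (Fo 1 (Br 2 6 (Fu 2
    (Br 4 5 (Br 4 6 (Fu 4 (Fo 7 (To (Co 2 [0,5,6,4,7,2,3,1])))) (Dr [5,2,0,1,6,7,4,3])) (Dr
    [6,2,0,1,5,7,4,3]))) (Dr [4,2,0,3,1,7,5,6])))) (Fo 5 (Br 1 6 (Fu 1 (Dr [4,2,0,3,1,6,5,7])) (Dr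
    [4,2,0,3,1,7,5,6])))))) (Br 2 4 (Br 1 5 (Fu 1 (Br 2 5 (Fu 2 (Br 3 6 (Fu 3 (Fo 7 (Fu 5 (Fo 6
    (Dr [0,1,3,6,4,2,7,5]))))) (Dr [5,1,0,2,4,6,7,3]))) (Br 2 6 (Fu 2 (Br 3 7 (Fu 3 (Br 4 5 (Br 4
    6 (Fu 4 (Fo 7 (To (Dr [0,1,3,7,5,6,2,4])))) (Fo 4 (Fo 6 (Fu 7 (Co 2 [0,4,6,5,7,2,1,3]))))) (Dr
    [6,2,0,1,3,4,7,5]))) (Dr [5,1,0,2,4,7,6,3]))) (Fo 2 (Br 3 6 (Fu 3 (Br 4 5 (Br 4 6 (Fu 4 (Fo 7
    (To (Co 2 [0,4,7,5,6,2,1,3])))) (Dr [5,1,0,2,4,7,6,3])) (Dr [6,3,0,1,5,7,2,4]))) (Dr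
    [5,1,0,2,4,6,7,3])))))) (Br 1 6 (Fu 1 (Br 2 5 (Fu 2 (Br 3 7 (Fu 3 (Br 4 5 (Br 4 6 (Fu 4 (Fo 7
    (To (Dr [0,1,3,7,5,2,4,6])))) (Dr [5,2,0,1,3,4,7,6])) (Fo 4 (Fo 5 (Fu 6 (Co 2
    [0,4,5,6,7,2,1,3])))))) (Dr [5,2,0,1,4,7,6,3]))) (Br 3 5 (Fu 3 (Br 2 6 (Fu 2 (Fo 7 (Fu 6 (Fo 4
    (Dr [0,1,3,5,4,2,7,6]))))) (Fo 2 (Br 4 5 (Br 4 6 (Fu 4 (Fo 7 (To (Co 2 [0,4,7,5,6,2,3,1]))))
    (Dr [5,3,0,1,6,7,2,4])) (Dr [6,1,0,2,4,7,5,3]))))) (Dr [6,1,0,2,4,5,7,3])))) (Fo 1 (Br 2 5 (Fu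
    2 (Br 3 6 (Fu 3 (Br 4 5 (Br 4 6 (Fu 4 (Fo 7 (To (Dr [0,1,3,6,4,2,5,7])))) (Dr
    [5,2,0,1,4,7,6,3])) (Fo 4 (Fo 5 (Fu 6 (Co 2 [0,4,5,6,7,2,3,1])))))) (Dr [5,2,0,1,4,6,7,3])))
    (Br 3 5 (Fu 3 (Br 2 6 (Fu 2 (Br 4 5 (Br 4 6 (Fu 4 (Fo 7 (To (Dr [0,1,3,5,4,2,6,7])))) (Fo 4
    (Fo 6 (Fu 7 (Co 2 [0,4,6,5,7,2,3,1]))))) (Dr [6,2,0,1,4,7,5,3]))) (Dr [7,1,0,2,4,6,5,3]))) (Dr
    [7,1,0,2,4,5,6,3])))))) (Fo 4 (Br 1 5 (Fu 1 (Br 3 6 (Fu 3 (Dr [5,1,0,2,7,4,6,3])) (Dr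
    [5,1,0,2,6,4,7,3]))) (Br 3 6 (Fu 3 (Dr [6,1,0,3,2,5,4,7])) (Br 1 6 (Fu 1 (Br 3 5 (Fu 3 (Dr
    [5,2,0,3,1,6,4,7])) (Dr [6,1,0,2,5,4,7,3]))) (Dr [7,1,0,2,6,4,5,3]))))))))) (Br 1 4 (Br 1 5
    (Fu 1 (Br 2 3 (Br 2 4 (Fu 2 (Br 3 6 (Fu 3 (Fo 7 (Fu 4 (Fo 5 (Dr [0,1,4,2,3,6,7,5]))))) (Dr
    [4,1,0,2,3,5,6,7]))) (Br 3 4 (Fu 3 (Br 2 6 (Fu 2 (Fo 7 (Fu 4 (Fo 5 (Dr [0,1,4,3,2,6,7,5])))))
    (Dr [4,1,0,2,5,6,7,3]))) (Br 2 5 (Fu 2 (Br 3 6 (Fu 3 (Fo 7 (Fu 5 (Fo 6 (Dr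
    [0,1,4,6,3,2,7,5]))))) (Dr [5,1,0,2,3,7,4,6]))) (Br 2 6 (Fu 2 (Br 3 7 (Fu 3 (Br 4 5 (Br 4 6
    (Fu 4 (Fo 7 (To (Dr [0,1,4,5,7,3,2,6])))) (Dr [5,1,0,2,3,4,7,6])) (Fo 4 (Fo 5 (Fu 6 (Co 2
    [0,4,5,6,7,1,2,3])))))) (Dr [5,1,0,2,4,7,6,3]))) (Fo 2 (Br 3 6 (Fu 3 (Br 4 5 (Br 4 6 (Fu 4 (Fo
    7 (To (Dr [0,1,4,5,7,2,3,6])))) (Dr [5,1,0,2,4,7,6,3])) (Fo 4 (Fo 5 (Fu 6 (Co 2
    [0,4,5,6,7,1,3,2])))))) (Dr [5,1,0,2,4,6,7,3]))))))) (Br 2 4 (Br 3 4 (Fu 4 (Br 2 6 (Fu 2 (Fo 7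
    (Fu 3 (Fo 5 (Co 2 [5,0,4,2,3,1,6,7]))))) (Fo 6 (Fu 3 (Fo 7 (To (Co 2 [5,0,4,2,3,1,7,6])))))))
    (Br 2 5 (Fu 2 (Br 4 6 (Fu 4 (Fo 7 (Fu 5 (Fo 6 (Co 2 [3,1,2,4,5,0,6,7]))))) (Fo 6 (Fu 5 (Fo 7
    (Co 2 [3,1,2,4,5,0,7,6])))))) (Br 2 6 (Fu 2 (Br 4 7 (Fu 4 (Br 3 5 (Br 3 6 (Fu 3 (Fo 7 (To (Dr
    [0,1,4,2,6,3,7,5])))) (Fo 3 (Fo 6 (Fu 7 (Co 4 [0,6,4,7,1,2,3,5]))))) (Fo 3 (Fo 5 (Fu 6 (Co 4
    [0,5,4,7,2,1,3,6])))))) (Dr [5,1,0,2,4,6,3,7]))) (Fo 2 (Br 4 6 (Fu 4 (Br 3 5 (Br 3 6 (Fu 3 (Fo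
    7 (To (Co 4 [0,7,4,6,1,2,3,5])))) (Dr [5,1,0,2,4,6,7,3])) (Fo 3 (Fo 5 (Fu 6 (Co 4
    [0,5,4,6,2,1,3,7])))))) (Dr [5,1,0,2,4,7,3,6])))))) (Br 2 5 (Br 3 5 (Fu 5 (Br 2 6 (Fu 2 (Fo 7
    (Fu 3 (Fo 4 (Co 2 [4,0,5,2,3,1,6,7]))))) (Fo 2 (Fo 6 (Fu 3 (Fo 4 (Co 2
    [4,0,5,2,3,1,7,6]))))))) (Br 2 6 (Fu 2 (Br 5 7 (Fu 5 (Br 3 4 (Br 3 6 (Fu 3 (Fo 7 (To (Dr
    [0,1,4,3,6,2,7,5])))) (Fo 3 (Fo 6 (Fu 7 (Co 4 [0,7,4,6,1,3,2,5]))))) (Fo 3 (Fo 4 (Fu 6 (Co 4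
    [0,4,5,7,2,1,3,6])))))) (Dr [4,1,0,2,5,6,3,7]))) (Fo 2 (Br 5 6 (Fu 5 (Br 3 4 (Br 3 6 (Fu 3 (Fo
    7 (To (Co 4 [0,6,4,7,1,3,2,5])))) (Dr [4,1,0,2,5,6,7,3])) (Fo 3 (Fo 4 (Fu 6 (Co 4
    [0,4,5,6,2,1,3,7])))))) (Dr [4,1,0,2,5,7,3,6]))))) (Fo 2 (Br 3 4 (Br 3 5 (Fu 3 (Br 4 6 (Fu 4
    (Fo 7 (To (Co 2 [2,1,3,4,5,0,6,7])))) (Fo 6 (Fu 5 (Fo 7 (Co 2 [2,1,3,4,5,0,7,6])))))) (Br 4 6
    (Fu 4 (Fo 5 (Fu 6 (Fo 7 (Co 4 [0,5,4,6,3,1,2,7]))))) (Br 3 6 (Fu 3 (Br 4 5 (Fu 4 (Fo 7 (To (Dr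
    [0,1,4,3,6,2,7,5])))) (Fo 4 (Fo 5 (Fu 6 (Co 4 [0,5,4,7,3,1,2,6])))))) (Dr
    [7,2,0,1,6,5,4,3])))) (Br 3 5 (Br 4 6 (Br 3 6 (Fu 3 (Fu 6 (Fo 7 (To (Co 4
    [0,4,5,7,3,1,2,6]))))) (Fo 3 (Br 4 5 (Fu 4 (Fu 5 (Fo 6 (Dr [0,1,4,5,3,7,2,6])))) (Fo 4 (Fu 7
    (Fo 5 (Co 4 [0,4,5,6,3,1,2,7]))))))) (Fo 4 (Fu 5 (Fo 6 (Fu 7 (Dr [0,1,4,5,3,6,2,7])))))) (Fo 3
    (Br 4 6 (Fu 6 (Fo 5 (Fu 7 (Co 2 [1,2,3,6,7,0,4,5])))) (Fo 4 (Fu 7 (Fo 5 (Co 2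
    [1,2,3,6,7,0,5,4]))))))))))))) (Br 1 6 (Fu 1 (Br 2 3 (Br 2 4 (Fu 2 (Br 3 5 (Fu 3 (Fo 7 (Fu 4
    (Fo 5 (Dr [0,1,4,2,3,5,7,6]))))) (Dr [4,1,0,2,3,6,5,7]))) (Br 3 4 (Fu 3 (Br 2 5 (Fu 2 (Fo 7
    (Fu 4 (Fo 5 (Dr [0,1,4,3,2,5,7,6]))))) (Dr [4,1,0,2,6,5,7,3]))) (Br 2 5 (Fu 2 (Br 3 7 (Fu 3
    (Br 4 5 (Br 4 6 (Fu 4 (Fo 7 (To (Dr [0,1,4,5,2,3,7,6])))) (Fo 4 (Fo 6 (Fu 7 (Co 2
    [0,4,6,5,7,1,2,3]))))) (Dr [6,1,0,2,3,4,7,5]))) (Dr [5,2,0,1,4,7,6,3]))) (Br 3 6 (Fu 3 (Fo 5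
    (Fu 6 (Fo 7 (Dr [0,1,4,5,6,3,2,7]))))) (Br 3 5 (Fu 3 (Br 2 6 (Fu 2 (Fo 7 (Fu 6 (Fo 4 (Dr
    [0,1,4,5,3,2,7,6]))))) (Fo 2 (Br 4 5 (Br 4 6 (Fu 4 (Fo 7 (To (Dr [0,1,4,5,3,2,7,6])))) (Fo 4
    (Fo 6 (Fu 7 (Co 2 [0,4,6,5,7,1,3,2]))))) (Dr [6,1,0,2,4,7,5,3]))))) (Dr
    [6,1,0,2,3,7,4,5])))))) (Br 2 4 (Br 3 4 (Fu 4 (Br 2 5 (Fu 2 (Fo 7 (Fu 3 (Fo 5 (Co 2
    [5,0,4,1,3,2,6,7]))))) (Fo 5 (Fu 3 (Fo 7 (To (Co 2 [5,0,4,1,2,3,6,7]))))))) (Br 2 5 (Fu 2 (Br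
    4 7 (Fu 4 (Br 3 5 (Br 3 6 (Fu 3 (Fo 7 (To (Dr [0,1,4,2,5,3,7,6])))) (Fo 3 (Fo 6 (Fu 7 (Co 4
    [0,6,4,7,2,1,3,5]))))) (Fo 3 (Fo 5 (Fu 6 (Co 4 [0,5,4,7,1,2,3,6])))))) (Dr
    [5,2,0,1,4,6,3,7]))) (Br 3 5 (Br 4 6 (Fu 4 (Fo 5 (Fu 6 (Fo 7 (Dr [0,1,4,2,7,3,5,6]))))) (Br 5
    7 (Br 4 5 (Fu 4 (Fu 5 (Br 2 6 (Fu 2 (Fo 7 (To (Co 2 [3,1,2,4,6,0,5,7])))) (Fo 2 (Fo 6 (Fu 7
    (Co 4 [0,7,4,5,1,2,3,6]))))))) (Fo 4 (Fo 5 (Br 2 6 (Co 2 [5,1,2,0,4,6,3,7]) (Dr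
    [7,2,0,1,4,6,3,5]))))) (Fo 5 (Fu 4 (Fo 7 (To (Co 4 [0,6,4,5,2,1,3,7]))))))) (Fo 3 (Fo 5 (Fu 6
    (Fo 2 (Fu 4 (Dr [0,1,4,2,7,3,5,6]))))))))) (Br 2 5 (Br 2 6 (Fu 2 (Br 3 6 (Fu 6 (Fo 7 (Fu 3 (Fo
    4 (Co 2 [4,0,6,2,3,1,5,7]))))) (Br 6 7 (Fu 6 (Br 3 4 (Br 3 5 (Fu 3 (Fo 7 (To (Dr
    [0,1,4,3,5,2,7,6])))) (Fo 3 (Fo 5 (Fu 7 (Co 4 [0,7,4,5,1,3,2,6]))))) (Fo 3 (Fo 4 (Fu 5 (Co 4
    [0,7,5,4,2,3,1,6])))))) (Dr [4,1,0,2,6,5,3,7])))) (Fo 2 (Br 3 4 (Br 3 5 (Fu 3 (Br 4 6 (Fu 4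
    (Fo 7 (To (Dr [0,1,4,3,5,2,7,6])))) (Fo 6 (Fu 5 (Fo 7 (Co 4 [0,6,4,7,3,1,2,5])))))) (Br 4 6
    (Fu 4 (Fo 5 (Fu 6 (Fo 7 (Dr [0,1,4,3,7,2,5,6]))))) (Br 3 6 (Fu 3 (Br 4 5 (Fu 4 (Fo 7 (To (Co 2
    [2,1,3,4,6,0,5,7])))) (Fo 4 (Fo 5 (Fu 6 (Co 2 [2,1,3,4,6,0,7,5])))))) (Fo 3 (Fo 6 (Fu 7 (Fo 4
    (Co 4 [0,6,4,5,3,1,2,7])))))))) (Br 3 5 (Br 4 6 (Br 3 6 (Fu 3 (Fu 6 (Fo 7 (To (Dr
    [0,1,4,6,3,5,2,7]))))) (Fo 3 (Br 4 5 (Fu 4 (Fu 5 (Fo 6 (Co 2 [1,2,3,5,7,0,4,6])))) (Fo 4 (Fu 7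
    (Fo 5 (Co 2 [1,2,3,5,7,0,6,4]))))))) (Fo 4 (Fu 5 (Fo 6 (Fu 7 (Co 4 [0,7,5,4,3,2,1,6])))))) (Fo
    3 (Br 4 6 (Fu 6 (Fo 5 (Fu 7 (Dr [0,1,4,5,2,7,3,6])))) (Fo 4 (Fu 7 (Fo 5 (Co 4
    [0,4,6,5,3,1,2,7])))))))))) (Fo 2 (Br 3 5 (Br 3 6 (Fu 3 (Fu 6 (Fo 7 (Fo 4 (Co 2
    [4,0,6,2,3,1,7,5]))))) (Br 5 6 (Fu 6 (Br 3 4 (Fu 3 (Fo 7 (To (Co 4 [0,5,4,7,1,3,2,6])))) (Fo 3
    (Fo 4 (Fu 5 (Co 4 [0,4,6,5,2,1,3,7])))))) (Dr [4,1,0,2,6,7,3,5]))) (Fo 5 (Fu 6 (Fo 3 (Fu 4 (Dr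
    [0,1,4,3,7,2,5,6]))))))))))) (Fo 1 (Br 2 3 (Br 2 4 (Fu 2 (Br 3 5 (Fu 3 (Fo 6 (Fu 4 (Fo 5 (Dr
    [0,1,4,2,3,5,6,7]))))) (Dr [4,1,0,2,3,6,5,7]))) (Br 3 4 (Fu 3 (Br 2 5 (Fu 2 (Fo 6 (Fu 4 (Fo 5
    (Dr [0,1,4,3,2,5,6,7]))))) (Dr [4,1,0,2,7,5,6,3]))) (Br 2 5 (Fu 2 (Br 3 6 (Fu 3 (Br 4 5 (Br 4
    6 (Fu 4 (Fo 7 (To (Co 2 [0,4,7,5,6,1,2,3])))) (Dr [5,2,0,1,4,7,6,3])) (Dr [6,3,0,1,4,7,5,2])))
    (Dr [5,2,0,1,4,6,7,3]))) (Br 3 6 (Fu 3 (Fo 5 (Dr [6,2,0,1,7,5,4,3]))) (Br 2 6 (Fu 2 (Br 3 5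
    (Fu 3 (Br 4 5 (Br 4 6 (Fu 4 (Fo 7 (To (Co 2 [0,4,7,5,6,1,3,2])))) (Dr [5,3,0,1,4,7,6,2])) (Dr
    [6,2,0,1,4,7,5,3]))) (Dr [7,1,0,2,4,5,6,3]))) (Dr [7,1,0,2,3,5,4,6])))))) (Br 2 4 (Br 3 4 (Fu
    4 (Br 2 5 (Fu 2 (Fo 6 (Fu 3 (Fo 5 (Co 2 [5,0,4,1,3,2,7,6]))))) (Fo 5 (Fu 3 (Fo 6 (Fu 7 (Co 2
    [5,0,4,1,2,3,7,6]))))))) (Br 2 5 (Fu 2 (Br 4 6 (Fu 4 (Br 3 5 (Br 3 6 (Fu 3 (Fo 7 (To (Co 4
    [0,7,4,6,2,1,3,5])))) (Dr [5,2,0,1,4,6,7,3])) (Fo 3 (Fo 5 (Fu 6 (Co 4 [0,5,4,6,1,2,3,7]))))))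
    (Dr [5,2,0,1,4,7,3,6]))) (Br 3 5 (Br 4 7 (Fu 4 (Fo 5 (Fu 7 (Fo 2 (Fo 3 (Dr
    [0,1,4,2,6,3,5,7])))))) (Br 5 6 (Br 4 5 (Fu 4 (Fu 5 (Br 2 6 (Fu 2 (Fo 7 (To (Co 4
    [0,6,4,5,1,2,3,7])))) (Fo 2 (Fo 6 (Fu 7 (Co 2 [3,1,2,4,7,0,5,6]))))))) (Fo 4 (Fo 5 (Br 2 6 (Fu
    2 (Fu 6 (Fo 7 (Dr [0,1,4,2,6,5,3,7])))) (Fo 2 (Fu 7 (Fo 3 (Co 2 [3,1,2,4,7,0,6,5])))))))) (Fo
    5 (Fu 4 (Fo 6 (Fu 7 (Co 4 [0,7,4,5,2,1,3,6]))))))) (Fo 3 (Fo 5 (Fu 7 (Fo 2 (Fu 4 (Dr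
    [0,1,4,2,6,3,5,7]))))))))) (Br 2 5 (Br 2 6 (Fu 2 (Br 3 4 (Br 3 5 (Fu 3 (Br 4 6 (Fu 4 (Fo 7 (To
    (Co 4 [0,7,4,6,3,1,2,5])))) (Dr [5,2,0,1,6,7,4,3]))) (Br 4 6 (Fu 4 (Fo 5 (Fu 6 (Fo 7 (Co 2
    [2,1,3,4,7,0,6,5]))))) (Br 3 6 (Fu 3 (Br 4 5 (Fu 4 (Fo 7 (To (Co 4 [0,7,4,5,3,1,2,6])))) (Dr
    [6,2,0,1,5,7,4,3]))) (Fo 3 (Fo 6 (Fu 7 (Fo 4 (Co 2 [2,1,3,4,7,0,5,6])))))))) (Br 3 5 (Br 4 6
    (Br 3 6 (Fu 3 (Fu 6 (Fo 7 (To (Co 2 [1,2,3,5,6,0,7,4]))))) (Fo 3 (Br 4 5 (Fu 4 (Fu 5 (Fo 6 (Co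
    4 [0,6,5,4,3,2,1,7])))) (Dr [7,1,0,2,4,6,5,3])))) (Fo 4 (Fu 5 (Fo 6 (Fu 7 (Co 2
    [1,2,3,5,6,0,4,7])))))) (Fo 3 (Br 4 6 (Fu 6 (Fo 5 (Fu 7 (Co 4 [0,5,6,4,3,2,1,7])))) (Dr
    [7,1,0,2,4,5,6,3])))))) (Fo 2 (Br 3 6 (Br 3 7 (Fu 3 (Fu 7 (Fo 4 (Fo 5 (Co 2
    [4,0,7,2,3,1,5,6]))))) (Br 6 7 (Fu 7 (Br 3 4 (Fu 3 (Fo 5 (Fu 6 (Co 4 [0,6,4,5,1,3,2,7])))) (Fo
    3 (Fo 4 (Fu 5 (Co 4 [0,6,5,4,2,3,1,7])))))) (Dr [4,1,0,2,7,5,3,6]))) (Fo 6 (Fu 7 (Fo 3 (Fu 4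
    (Dr [0,1,4,3,5,2,6,7])))))))) (Fo 2 (Br 3 5 (Br 3 7 (Fu 3 (Fu 7 (Fo 4 (Fo 5 (Co 2
    [4,0,7,2,3,1,6,5]))))) (Br 5 7 (Fu 7 (Br 3 4 (Fu 3 (Fo 6 (To (Co 4 [0,5,4,6,1,3,2,7])))) (Fo 3
    (Fo 4 (Fu 5 (Co 4 [0,5,6,4,2,3,1,7])))))) (Dr [4,1,0,2,7,6,3,5]))) (Fo 5 (Fu 7 (Fo 3 (Fu 4 (Dr
    [0,1,4,3,6,2,5,7]))))))))))))) (Br 1 5 (Br 1 6 (Fu 1 (Br 2 3 (Br 2 4 (Fu 2 (Br 3 4 (Fu 3 (Fo 7
    (Fu 4 (Fo 5 (Dr [0,1,5,6,7,4,2,3]))))) (Br 3 5 (Fu 3 (Fo 7 (Fu 5 (Fo 6 (Dr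
    [0,1,5,3,2,4,7,6]))))) (Br 3 6 (Fu 3 (Fo 7 (Fu 6 (Fo 4 (Dr [0,1,5,4,2,3,7,6]))))) (Fo 3 (Br 4
    5 (Br 4 6 (Fu 4 (Fo 7 (To (Co 2 [0,5,6,4,7,1,2,3])))) (Dr [5,1,0,2,3,4,7,6])) (Dr
    [6,1,0,2,3,4,7,5]))))))) (Br 3 5 (Fu 3 (Fo 4 (Fu 5 (Fo 7 (To (Dr [0,1,5,3,2,7,4,6])))))) (Br 3
    6 (Fu 3 (Fo 4 (Fu 6 (Fo 7 (To (Dr [0,1,5,4,6,3,2,7])))))) (Br 4 7 (Br 3 4 (Fu 3 (Br 2 5 (Fu 2
    (Fo 7 (Fu 5 (Fo 6 (Dr [0,1,5,2,3,4,7,6]))))) (Br 4 5 (Fu 4 (Dr [2,0,1,5,4,3,7,6])) (Fo 4 (Fo 5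
    (Fu 6 (Fo 7 (Dr [0,1,5,6,4,3,2,7])))))))) (Fo 3 (Fo 4 (Br 2 5 (Fu 2 (Fu 5 (Fo 6 (Dr
    [0,1,5,2,3,7,4,6])))) (Dr [6,1,0,2,3,7,4,5]))))) (Fo 4 (Fu 3 (Fo 7 (To (Co 2
    [0,5,6,4,7,1,3,2]))))))))) (Br 2 4 (Br 2 5 (Fu 2 (Br 3 5 (Fu 5 (Fo 7 (Fu 3 (Fo 4 (Co 2
    [4,0,5,1,3,2,6,7]))))) (Br 5 7 (Fu 5 (Br 3 4 (Br 3 6 (Fu 3 (Fo 7 (To (Dr [0,1,5,2,4,3,7,6]))))
    (Fo 3 (Fo 6 (Fu 7 (Co 4 [0,7,4,6,2,3,1,5]))))) (Fo 3 (Fo 4 (Fu 6 (Co 4 [0,4,5,7,1,2,3,6]))))))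
    (Dr [4,2,0,1,5,6,3,7])))) (Br 2 6 (Fu 2 (Br 3 6 (Fu 6 (Fo 7 (Fu 3 (Fo 4 (Co 2
    [4,0,6,1,3,2,5,7]))))) (Br 6 7 (Fu 6 (Br 3 4 (Br 3 5 (Fu 3 (Fo 7 (To (Dr [0,1,5,3,4,2,7,6]))))
    (Fo 3 (Fo 5 (Fu 7 (Co 4 [0,7,4,5,2,3,1,6]))))) (Fo 3 (Fo 4 (Fu 5 (Co 4 [0,7,5,4,1,3,2,6]))))))
    (Dr [4,2,0,1,6,5,3,7])))) (Fo 2 (Br 3 4 (Br 3 5 (Fu 3 (Br 4 6 (Fu 4 (Fo 7 (To (Co 4
    [0,7,4,6,3,2,1,5])))) (Dr [5,1,0,2,6,7,4,3]))) (Br 4 6 (Fu 4 (Fo 5 (Fu 6 (Fo 7 (Co 2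
    [1,2,3,4,7,0,6,5]))))) (Br 3 6 (Fu 3 (Br 4 5 (Fu 4 (Fo 7 (To (Co 4 [0,7,4,5,3,2,1,6])))) (Dr
    [6,1,0,2,5,7,4,3]))) (Fo 3 (Fo 6 (Fu 7 (Fo 4 (Co 2 [1,2,3,4,7,0,5,6])))))))) (Br 3 5 (Br 4 6
    (Br 3 6 (Fu 3 (Fu 6 (Fo 7 (To (Co 2 [2,1,3,5,6,0,7,4]))))) (Fo 3 (Br 4 5 (Fu 4 (Fu 5 (Fo 6 (Co
    4 [0,6,5,4,3,1,2,7])))) (Dr [7,2,0,1,4,6,5,3])))) (Fo 4 (Fu 5 (Fo 6 (Fu 7 (Co 2
    [2,1,3,5,6,0,4,7])))))) (Fo 3 (Br 4 6 (Fu 6 (Fo 5 (Fu 7 (Co 4 [0,5,6,4,3,1,2,7])))) (Dr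
    [7,2,0,1,4,5,6,3])))))))) (Br 3 4 (Br 2 5 (Br 3 5 (Fu 3 (Fu 5 (Fo 7 (Fu 2 (Fo 4 (Co 2
    [4,0,5,1,2,3,6,7])))))) (Br 4 7 (Br 5 6 (Fu 5 (Fo 4 (Fu 6 (Fo 7 (Dr [0,1,5,2,7,3,4,6]))))) (Br
    4 5 (Fu 4 (Fu 5 (Br 2 6 (Fu 2 (Fo 7 (To (Co 2 [3,1,2,5,6,0,4,7])))) (Fo 2 (Fo 6 (Fu 7 (Co 4
    [0,7,5,4,1,2,3,6]))))))) (Fo 4 (Fo 5 (Br 2 6 (Co 2 [4,1,2,0,5,6,3,7]) (Dr
    [7,2,0,1,5,6,3,4])))))) (Fo 4 (Fu 5 (Fo 7 (To (Co 4 [0,6,5,4,2,1,3,7]))))))) (Fo 2 (Br 3 6 (Fu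
    3 (Fu 6 (Fo 7 (Fo 4 (Co 2 [4,0,6,1,2,3,5,7]))))) (Br 4 6 (Fu 6 (Br 3 5 (Fu 3 (Fo 7 (To (Co 4
    [0,4,5,7,1,3,2,6])))) (Fo 3 (Fo 5 (Fu 7 (Co 4 [0,5,6,4,2,1,3,7])))))) (Dr
    [5,1,0,2,6,7,3,4]))))) (Fo 4 (Br 2 5 (Fu 5 (Fo 3 (Fu 6 (Fo 7 (Dr [0,1,5,2,7,3,4,6]))))) (Fo 2
    (Fu 6 (Fo 3 (Fu 5 (Dr [0,1,5,3,7,2,4,6]))))))))))) (Fo 1 (Br 2 3 (Br 2 4 (Fu 2 (Br 3 4 (Fu 3
    (Fo 6 (Fu 4 (Fo 5 (Dr [0,1,5,6,4,2,3,7]))))) (Br 3 5 (Fu 3 (Fo 6 (Fu 5 (Fo 7 (Dr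
    [0,1,5,3,2,4,6,7]))))) (Br 3 6 (Fu 3 (Br 4 5 (Br 4 6 (Fu 4 (Fo 7 (To (Dr [0,1,5,4,2,3,6,7]))))
    (Fo 4 (Fo 6 (Fu 7 (Co 2 [0,5,7,4,6,1,2,3]))))) (Dr [6,3,0,1,5,7,4,2]))) (Dr
    [7,1,0,2,5,6,4,3]))))) (Br 3 5 (Fu 3 (Fo 4 (Fu 5 (Fo 6 (Fu 7 (Dr [0,1,5,3,2,6,4,7])))))) (Br 3
    7 (Fu 3 (Fo 4 (Fu 7 (Fo 6 (To (Dr [0,1,5,4,6,2,3,7])))))) (Br 4 6 (Br 3 4 (Fu 3 (Br 2 5 (Fu 2
    (Fo 6 (Fu 5 (Fo 7 (Dr [0,1,5,2,3,4,6,7]))))) (Br 4 5 (Fu 4 (Dr [2,0,1,5,4,3,6,7])) (Fo 4 (Fo 5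
    (Fu 7 (Fo 2 (Dr [0,1,5,6,2,3,4,7])))))))) (Fo 3 (Fo 4 (Br 2 5 (Fu 2 (Fu 5 (Fo 6 (Dr
    [0,1,5,2,3,6,4,7])))) (Dr [6,2,0,1,7,4,5,3]))))) (Fo 4 (Fu 3 (Fo 6 (Fu 7 (To (Co 2
    [0,5,7,4,6,1,3,2])))))))))) (Br 2 4 (Br 2 5 (Fu 2 (Br 3 5 (Fu 5 (Fo 6 (Fu 3 (Fo 4 (Co 2
    [4,0,5,1,3,2,7,6]))))) (Br 5 6 (Fu 5 (Br 3 4 (Br 3 6 (Fu 3 (Fo 7 (To (Co 4
    [0,6,4,7,2,3,1,5])))) (Dr [4,2,0,1,5,6,7,3])) (Fo 3 (Fo 4 (Fu 6 (Co 4 [0,4,5,6,1,2,3,7]))))))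
    (Dr [4,2,0,1,5,7,3,6])))) (Br 2 6 (Fu 2 (Br 3 4 (Br 3 5 (Fu 3 (Br 4 6 (Fu 4 (Fo 7 (To (Dr
    [0,1,5,3,4,2,6,7])))) (Fo 6 (Fu 5 (Fo 7 (Co 4 [0,6,4,7,3,2,1,5])))))) (Br 4 6 (Fu 4 (Fo 5 (Fu
    6 (Fo 7 (Dr [0,1,5,6,2,4,3,7]))))) (Br 3 6 (Fu 3 (Br 4 5 (Fu 4 (Fo 7 (To (Co 2
    [1,2,3,4,6,0,5,7])))) (Fo 4 (Fo 5 (Fu 6 (Co 2 [1,2,3,4,6,0,7,5])))))) (Fo 3 (Fo 6 (Fu 7 (Fo 4
    (Co 4 [0,6,4,5,3,2,1,7])))))))) (Br 3 5 (Br 4 6 (Br 3 6 (Fu 3 (Fu 6 (Fo 7 (To (Dr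
    [0,1,5,3,6,2,4,7]))))) (Fo 3 (Br 4 5 (Fu 4 (Fu 5 (Fo 6 (Co 2 [2,1,3,5,7,0,4,6])))) (Fo 4 (Fu 7
    (Fo 5 (Co 2 [2,1,3,5,7,0,6,4]))))))) (Fo 4 (Fu 5 (Fo 6 (Fu 7 (Co 4 [0,7,5,4,3,1,2,6])))))) (Fo
    3 (Br 4 6 (Fu 6 (Fo 5 (Fu 7 (Dr [0,1,5,4,2,6,3,7])))) (Fo 4 (Fu 7 (Fo 5 (Co 4
    [0,4,6,5,3,2,1,7]))))))))) (Fo 2 (Br 3 6 (Br 3 7 (Fu 3 (Fu 7 (Fo 4 (Fo 5 (Co 2
    [4,0,7,1,3,2,5,6]))))) (Br 6 7 (Fu 7 (Br 3 4 (Fu 3 (Fo 5 (Fu 6 (Co 4 [0,6,4,5,2,3,1,7])))) (Fo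
    3 (Fo 4 (Fu 5 (Co 4 [0,6,5,4,1,3,2,7])))))) (Dr [4,2,0,1,7,5,3,6]))) (Fo 6 (Fu 7 (Fo 3 (Fu 4
    (Dr [0,1,5,3,4,2,6,7]))))))))) (Br 3 4 (Br 2 5 (Br 3 5 (Fu 3 (Fu 5 (Fo 6 (Fu 2 (Fo 4 (Co 2
    [4,0,5,1,2,3,7,6])))))) (Br 4 6 (Br 5 7 (Fu 5 (Fo 4 (Fu 7 (Fo 2 (Fo 3 (Dr
    [0,1,5,2,6,3,4,7])))))) (Br 4 5 (Fu 4 (Fu 5 (Br 2 6 (Fu 2 (Fo 7 (To (Co 4
    [0,6,5,4,1,2,3,7])))) (Fo 2 (Fo 6 (Fu 7 (Co 2 [3,1,2,5,7,0,4,6]))))))) (Fo 4 (Fo 5 (Br 2 6 (Fu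
    2 (Fu 6 (Fo 7 (Dr [0,1,5,2,6,4,3,7])))) (Fo 2 (Fu 7 (Fo 3 (Co 2 [3,1,2,5,7,0,6,4]))))))))) (Fo
    4 (Fu 5 (Fo 6 (Fu 7 (Co 4 [0,7,5,4,2,1,3,6]))))))) (Fo 2 (Br 3 7 (Fu 3 (Fu 7 (Fo 4 (Fo 5 (Co 2
    [4,0,7,1,2,3,5,6]))))) (Br 4 7 (Fu 7 (Br 3 5 (Fu 3 (Fo 6 (To (Co 4 [0,4,5,6,1,3,2,7])))) (Fo 3
    (Fo 5 (Fu 6 (Co 4 [0,4,6,5,2,3,1,7])))))) (Dr [5,1,0,2,7,6,3,4]))))) (Fo 4 (Br 2 5 (Fu 5 (Fo 3
    (Fu 7 (Fo 2 (Dr [0,1,5,2,6,3,4,7]))))) (Fo 2 (Fu 7 (Fo 3 (Fu 5 (Dr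
    [0,1,5,3,6,2,4,7])))))))))))) (Fo 1 (Br 2 3 (Br 2 4 (Fu 2 (Br 3 4 (Fu 3 (Fo 5 (Fu 4 (Fo 6 (Dr
    [0,1,6,5,4,2,3,7]))))) (Br 3 6 (Fu 3 (Fo 5 (Fu 6 (Fo 7 (Dr [0,1,6,3,2,4,5,7]))))) (Br 3 5 (Fu
    3 (Br 4 5 (Br 4 6 (Fu 4 (Fo 7 (To (Dr [0,1,6,4,2,3,5,7])))) (Dr [5,3,0,1,6,7,4,2])) (Fo 4 (Fo
    5 (Fu 6 (Co 2 [0,6,7,4,5,1,2,3])))))) (Dr [7,1,0,2,6,5,4,3]))))) (Br 3 6 (Fu 3 (Fo 4 (Fu 6 (Fo
    5 (Fu 7 (Dr [0,1,6,3,2,5,4,7])))))) (Br 3 7 (Fu 3 (Fo 4 (Fu 7 (Fo 5 (Fu 6 (Dr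
    [0,1,6,4,5,2,3,7])))))) (Br 4 5 (Br 3 4 (Fu 3 (Br 2 6 (Fu 2 (Fo 5 (Fu 6 (Fo 7 (Dr
    [0,1,6,2,3,4,5,7]))))) (Br 4 6 (Fu 4 (Dr [2,0,1,6,4,3,5,7])) (Fo 4 (Fo 6 (Fu 7 (Fo 2 (Dr
    [0,1,6,5,2,3,4,7])))))))) (Fo 3 (Fo 4 (Br 2 6 (Fu 2 (Fu 6 (Fo 7 (Dr [0,1,6,2,3,5,4,7])))) (Dr
    [5,2,0,1,7,4,6,3]))))) (Fo 4 (Fu 3 (Fo 5 (Fu 6 (Fu 7 (Co 2 [0,6,7,4,5,1,3,2])))))))))) (Br 2 4
    (Br 2 5 (Fu 2 (Br 3 4 (Br 3 5 (Fu 3 (Br 4 6 (Fu 4 (Fo 7 (To (Co 2 [1,2,3,4,5,0,6,7])))) (Fo 6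
    (Fu 5 (Fo 7 (Co 2 [1,2,3,4,5,0,7,6])))))) (Br 4 6 (Fu 4 (Fo 5 (Fu 6 (Fo 7 (Co 4
    [0,5,4,6,3,2,1,7]))))) (Br 3 6 (Fu 3 (Br 4 5 (Fu 4 (Fo 7 (To (Dr [0,1,6,3,4,2,5,7])))) (Fo 4
    (Fo 5 (Fu 6 (Co 4 [0,5,4,7,3,2,1,6])))))) (Dr [7,1,0,2,6,5,4,3])))) (Br 3 5 (Br 4 6 (Br 3 6
    (Fu 3 (Fu 6 (Fo 7 (To (Co 4 [0,4,5,7,3,2,1,6]))))) (Fo 3 (Br 4 5 (Fu 4 (Fu 5 (Fo 6 (Dr
    [0,1,6,4,2,5,3,7])))) (Fo 4 (Fu 7 (Fo 5 (Co 4 [0,4,5,6,3,2,1,7]))))))) (Fo 4 (Fu 5 (Fo 6 (Fu 7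
    (Dr [0,1,6,3,5,2,4,7])))))) (Fo 3 (Br 4 6 (Fu 6 (Fo 5 (Fu 7 (Co 2 [2,1,3,6,7,0,4,5])))) (Fo 4
    (Fu 7 (Fo 5 (Co 2 [2,1,3,6,7,0,5,4]))))))))) (Br 3 5 (Br 2 6 (Fu 2 (Br 3 6 (Fu 3 (Fu 6 (Fo 7
    (Fo 4 (Co 2 [4,0,6,1,3,2,7,5]))))) (Br 5 6 (Fu 6 (Br 3 4 (Fu 3 (Fo 7 (To (Co 4
    [0,5,4,7,2,3,1,6])))) (Fo 3 (Fo 4 (Fu 5 (Co 4 [0,4,6,5,1,2,3,7])))))) (Dr
    [4,2,0,1,6,7,3,5])))) (Fo 2 (Br 3 7 (Fu 3 (Fu 7 (Fo 4 (Fo 5 (Co 2 [4,0,7,1,3,2,6,5]))))) (Br 5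
    7 (Fu 7 (Br 3 4 (Fu 3 (Fo 6 (To (Co 4 [0,5,4,6,2,3,1,7])))) (Fo 3 (Fo 4 (Fu 5 (Co 4
    [0,5,6,4,1,3,2,7])))))) (Dr [4,2,0,1,7,6,3,5]))))) (Fo 5 (Br 2 6 (Fu 2 (Fu 6 (Fo 3 (Fu 4 (Dr
    [0,1,6,2,4,3,5,7]))))) (Fo 2 (Fu 7 (Fo 3 (Fu 4 (Dr [0,1,6,3,4,2,5,7]))))))))) (Br 3 4 (Br 2 5
    (Br 2 6 (Fu 2 (Br 3 6 (Fu 3 (Fu 6 (Fo 7 (Fo 4 (Co 2 [4,0,6,1,2,3,7,5]))))) (Br 4 6 (Fu 6 (Br 3
    5 (Fu 3 (Fo 7 (To (Co 4 [0,4,5,7,2,3,1,6])))) (Fo 3 (Fo 5 (Fu 7 (Co 4 [0,5,6,4,1,2,3,7]))))))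
    (Dr [5,2,0,1,6,7,3,4])))) (Fo 2 (Br 3 7 (Fu 3 (Fu 7 (Fo 4 (Fo 5 (Co 2 [4,0,7,1,2,3,6,5])))))
    (Br 4 7 (Fu 7 (Br 3 5 (Fu 3 (Fo 6 (To (Co 4 [0,4,5,6,2,3,1,7])))) (Fo 3 (Fo 5 (Fu 6 (Co 4
    [0,4,6,5,1,3,2,7])))))) (Dr [5,2,0,1,7,6,3,4]))))) (Fo 2 (Br 4 6 (Fu 6 (Fo 5 (Fu 7 (Co 2
    [3,1,2,6,7,0,4,5])))) (Fo 4 (Fu 7 (Fo 5 (Fu 6 (Co 2 [3,1,2,6,7,0,5,4])))))))) (Fo 4 (Br 2 6
    (Fu 6 (Fo 3 (Fu 7 (Fo 2 (Dr [0,1,6,2,5,3,4,7]))))) (Fo 2 (Fu 7 (Fo 3 (Fu 5 (Dr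
    [0,1,6,3,5,2,4,7]))))))))))))))))"
  by code_simp

text \<open>In the names of this and the next eleven certificates the first number after the 14 is
  the number of vertices and the second is the maximum degree \<open>d\<close>. The last label is a
  vertex of degree \<open>d\<close>; without it at most 14 - \<open>d\<close> edges remain, so the
  trees start from the seeds that fit this bound. The empty target list says that nothing
  survives.\<close>

lemma cert_apex14_6_3:
  "list_all2 (\<lambda>(r, es). chk 6 1 14 (\<lambda>i. if i = 5 then 3 else 3) (\<lambda>_. 3) []
    es (pairs 6)) (small_seeds 5 11) [Hi 0]"
  by code_simp

lemma cert_apex14_6_4:
  "list_all2 (\<lambda>(r, es). chk 6 1 14 (\<lambda>i. if i = 5 then 4 else 3) (\<lambda>_. 4) []
    es (pairs 6)) (small_seeds 5 10) [Fu 0 (Fu 1 (Fu 2 (Fu 3 (Fu 4 (Lo 5)))))]"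
  by code_simp

lemma cert_apex14_6_5:
  "list_all2 (\<lambda>(r, es). chk 6 1 14 (\<lambda>i. if i = 5 then 5 else 3) (\<lambda>_. 5) []
    es (pairs 6)) (small_seeds 5 9) []"
  by code_simp

lemma cert_apex14_7_3:
  "list_all2 (\<lambda>(r, es). chk 7 1 14 (\<lambda>i. if i = 6 then 3 else 3) (\<lambda>_. 3) []
    es (pairs 7)) (small_seeds 6 11) [Fu 0 (Fu 1 (Fu 2 (Fu 3 (Fu 4 (Fu 5 (Lo 6)))))), Hi 0, Hi 0]"
  by code_simp

lemma cert_apex14_7_4:
  "list_all2 (\<lambda>(r, es). chk 7 1 14 (\<lambda>i. if i = 6 then 4 else 3) (\<lambda>_. 4) []
    es (pairs 7)) (small_seeds 6 10) [Br 0 1 (Fu 0 (Fu 1 (Fo 6 (To (Dr [4,0,1,5,2,6]))))) (Br 0 2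
    (Fu 0 (Fu 2 (Fo 6 (To (Dr [4,0,2,5,1,6]))))) (Br 1 6 (Fu 1 (Br 0 6 (Br 2 6 (Br 3 4 (Fu 3 (Fu 4
    (Fo 6 (Dr [1,3,2,4,5,6])))) (Br 5 6 (Fu 5 (Fu 6 (Dr [1,3,2,4,5,6]))) (Dr [1,3,2,5,4,6]))) (Dr
    [4,0,5,2,1,6])) (Dr [4,0,5,1,6,2]))) (Dr [4,0,5,1,2,6]))), Fu 0 (Fu 1 (Fu 2 (Fu 3 (Fu 4 (Lo
    5)))))]"
  by code_simp

lemma cert_apex14_7_5:
  "list_all2 (\<lambda>(r, es). chk 7 1 14 (\<lambda>i. if i = 6 then 5 else 3) (\<lambda>_. 5) []
    es (pairs 7)) (small_seeds 6 9) [Br 0 6 (Br 1 6 (Br 2 6 (Br 3 6 (Br 4 6 (Fu 6 (To (Dr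
    [1,3,2,5,4,6]))) (Fo 6 (To (Dr [1,3,2,4,5,6])))) (Fo 6 (To (Dr [1,3,2,4,6,5])))) (Fo 6 (To (Dr
    [4,0,5,2,1,6])))) (Fo 6 (To (Dr [4,0,5,1,2,6])))) (Fo 6 (To (Dr [4,0,5,1,6,2])))]"
  by code_simp

lemma cert_apex14_8_3:
  "list_all2 (\<lambda>(r, es). chk 8 1 14 (\<lambda>i. if i = 7 then 3 else 3) (\<lambda>_. 3) []
    es (pairs 8)) (small_seeds 7 11) [Fu 0 (Fu 1 (Fu 2 (Fu 3 (Fu 4 (Fu 5 (Lo 6)))))), Fu 0 (Fu 1
    (Fu 2 (Fu 3 (Fu 4 (Fu 5 (Fo 6 (Lo 7))))))), Hi 0, Hi 0]"
  by code_simp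

lemma cert_apex14_8_4:
  "list_all2 (\<lambda>(r, es). chk 8 1 14 (\<lambda>i. if i = 7 then 4 else 3) (\<lambda>_. 4) []
    es (pairs 8)) (small_seeds 7 10) [Br 0 1 (Fu 0 (Fu 1 (Br 2 6 (Fu 2 (Fo 7 (Fu 3 (Fu 4 (Fu 5 (Lo
    6)))))) (Dr [4,0,1,5,2,7,6])))) (Br 3 4 (Fu 3 (Fu 4 (Br 5 6 (Fu 5 (Fo 7 (Fu 0 (Fu 1 (Fu 2 (Lo
    6)))))) (Dr [0,3,1,4,5,7,6])))) (Br 0 2 (Fu 0 (Fu 2 (Br 1 6 (Fu 1 (Fo 7 (Fu 3 (Fu 4 (Fu 5 (Lo
    6)))))) (Dr [3,0,2,4,1,7,6])))) (Br 3 5 (Fu 3 (Fu 5 (Br 0 6 (Fu 0 (Fo 7 (Fu 1 (Fu 2 (Fu 4 (Lo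
    6)))))) (Dr [2,3,0,4,6,7,5])))) (Br 1 2 (Fu 1 (Fu 2 (Br 0 6 (Fu 0 (Fo 7 (Fu 3 (Fu 4 (Fu 5 (Lo
    6)))))) (Dr [3,0,5,1,2,6,7])))) (Br 4 5 (Fu 4 (Fu 5 (Br 0 6 (Fu 0 (Fo 7 (Fu 1 (Fu 2 (Fu 3 (Lo
    6)))))) (Dr [2,3,6,7,0,4,5])))) (Br 0 6 (Fu 0 (Br 1 6 (Fu 1 (Br 2 7 (Fu 2 (Br 3 7 Mx (Fo 7 (Fu
    4 (Fu 5 Mx))))) (Fo 7 (Fu 3 (Fu 4 (Fu 5 Mx)))))) (Br 6 7 (Br 2 6 (Fu 2 (Br 3 7 (Fu 3 (Br 1 7
    Mx (Fo 7 (Fu 4 (Fu 5 Mx))))) (Fo 7 (Fu 4 (Fu 5 Mx))))) (Br 1 7 (Br 2 7 (Br 3 6 Mx (Br 3 7 Mx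
    (Dr [0,3,2,4,6,7,5]))) (Dr [4,0,5,2,1,7,6])) (Dr [4,0,5,1,2,7,6]))) (Dr [4,0,5,1,7,2,6]))))
    (Br 1 6 (Fu 1 (Br 6 7 (Br 2 6 (Fu 2 (Br 3 7 (Fu 3 (Br 0 7 Mx (Fo 7 (Fu 4 (Fu 5 Mx))))) (Fo 7
    (Fu 4 (Fu 5 Mx))))) (Br 0 7 (Br 2 7 (Br 3 6 Mx (Br 3 7 Mx (Dr [1,3,2,4,6,7,5]))) (Dr
    [4,0,5,2,1,6,7])) (Dr [4,0,5,1,6,7,2]))) (Dr [4,0,5,1,6,2,7]))) (Br 2 6 (Fu 2 (Br 0 7 (Br 1 7
    (Br 3 6 Mx (Br 3 7 Mx (Dr [1,3,2,4,6,7,5]))) (Dr [4,0,5,1,2,6,7])) (Dr [4,0,5,1,7,6,2]))) (Br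
    6 7 (Br 3 6 (Fu 3 (Br 4 6 (Fu 4 (Br 5 7 (Fu 5 (Br 0 7 Mx (Dr [4,0,5,2,7,1,6]))) (Fo 7 Mx)))
    (Fo 6 (Fu 5 (Br 0 7 (Br 1 7 Mx (Dr [4,0,5,6,7,2,1])) (Dr [4,0,5,1,7,6,2])))))) (Fo 6 (Fu 4 (Fu
    5 (Br 0 7 (Br 1 7 Mx (Dr [3,0,5,6,7,2,1])) (Dr [3,0,5,1,7,6,2])))))) (Fo 6 (Fu 3 (Fu 4 (Fu 5
    (Lo 7)))))))))))))), Br 0 1 (Fu 0 (Fu 1 (Br 2 6 (Fu 2 (Fo 7 (Fu 3 (Fu 4 (Fu 5 Mx))))) (Dr
    [5,0,1,3,2,7,6])))) (Br 3 4 (Fu 3 (Fu 4 (Br 5 6 (Fu 5 (Fo 7 (Fu 0 (Fu 1 (Fu 2 Mx))))) (Dr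
    [1,3,4,0,6,7,5])))) (Br 0 2 (Fu 0 (Fu 2 (Br 1 6 (Fu 1 (Fo 7 (Fu 3 (Fu 4 (Fu 5 Mx))))) (Dr
    [4,0,2,3,1,7,6])))) (Br 3 5 (Fu 3 (Fu 5 (Br 4 6 (Fu 4 (Fo 7 (Fu 1 (Fu 2 Mx)))) (Dr
    [2,3,5,0,6,7,4])))) (Br 1 2 (Fu 1 (Fu 2 (Br 0 3 Mx (Dr [5,0,6,3,1,2,7])))) (Br 4 5 (Fu 4 (Fu 5
    (Br 0 3 Mx (Dr [2,3,6,0,7,4,5])))) (Br 0 3 (Fu 0 (Fu 3 (Br 1 7 (Fu 1 (Br 2 7 Mx (Fo 7 (Fu 4
    (Fu 5 Mx))))) (Fo 7 (Fu 2 (Fu 4 (Fu 5 Mx))))))) (Br 1 6 (Fu 1 (Br 2 6 (Fu 2 (Fu 6 (Fo 7 Mx)))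
    (Dr [5,0,6,1,3,2,7]))) (Br 2 7 (Fu 2 (Br 1 7 (Br 4 6 (Fu 4 (Br 0 7 Mx (Dr [1,3,2,4,0,5,7])))
    (Br 5 7 (Fu 5 (Fo 6 (Fu 7 (Dr [2,3,6,0,7,5,4])))) (Dr [7,0,4,2,3,5,6]))) (Dr
    [5,0,6,3,1,2,7]))) (Dr [5,0,6,2,3,1,7]))))))))), Mx]"
  by code_simp

lemma cert_apex14_8_5:
  "list_all2 (\<lambda>(r, es). chk 8 1 14 (\<lambda>i. if i = 7 then 5 else 3) (\<lambda>_. 5) []
    es (pairs 8)) (small_seeds 7 9) [Br 0 1 (Br 0 2 Mx (Br 0 6 Mx (Br 0 7 Mx (Br 1 7 Mx (Fo 7
    Mx))))) (Br 0 2 (Br 0 6 Mx (Br 0 7 Mx (Br 1 7 Mx (Fo 7 (Fu 2 Mx))))) (Br 0 6 (Br 1 2 Mx (Br 3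
    4 Mx (Br 3 5 Mx (Br 4 5 Mx (Br 0 7 (Br 1 6 Mx (Br 1 7 Mx (Br 2 7 Mx (Fo 7 Mx)))) (Br 1 7 (Br 2
    7 Mx (Fo 7 Mx)) (Fo 7 Mx))))))) (Br 0 7 (Br 1 2 Mx (Br 3 4 Mx (Br 3 5 Mx (Br 4 5 Mx (Br 1 6
    (Br 1 7 Mx (Br 2 7 Mx (Fo 7 Mx))) (Br 1 7 (Br 2 6 Mx (Br 3 6 Mx (Fo 6 (To (Lo 7))))) (Br 2 7
    (Br 3 6 Mx (Dr [5,0,3,1,2,6,7])) (Dr [4,0,5,1,2,6,7])))))))) (Br 1 7 (Br 1 2 Mx (Br 2 7 (Br 3
    7 Mx (Fo 7 (To (Lo 6)))) (Fo 7 (To (Lo 6))))) (Fo 7 (To (Lo 6)))))))]"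
  by code_simp

lemma cert_apex14_9_3:
  "list_all2 (\<lambda>(r, es). chk 9 1 14 (\<lambda>i. if i = 8 then 3 else 3) (\<lambda>_. 3) []
    es (pairs 9)) (small_seeds 8 11) [Fu 0 (Fu 1 (Fu 2 (Fu 3 (Fu 4 (Fu 5 (Lo 6)))))), Fu 0 (Fu 1
    (Fu 2 (Fu 3 (Fu 4 (Fu 5 (Lo 7)))))), Fu 0 (Fu 1 (Fu 2 (Fu 3 (Fu 4 (Fu 5 (Lo 8)))))), Fu 0 (Fu
    1 (Fu 2 (Fu 3 (Fu 4 (Fu 5 (Fo 6 (Fo 7 (Lo 8)))))))), Fu 0 (Fu 1 (Fu 2 (Fu 3 (Fu 4 (Fu 5 (Lo
    8)))))), Hi 0, Hi 0]"
  by code_simp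

lemma cert_apex14_9_4:
  "list_all2 (\<lambda>(r, es). chk 9 1 14 (\<lambda>i. if i = 8 then 4 else 3) (\<lambda>_. 4) []
    es (pairs 9)) (small_seeds 8 10) [Br 0 1 Mx (Br 0 2 Mx (Br 0 6 Mx (Br 0 7 Mx (Br 0 8 Mx (Br 1
    2 Mx (Br 1 6 Mx (Br 1 7 Mx (Br 1 8 Mx (Br 2 6 Mx (Br 2 7 Mx (Br 3 6 Mx (Dr
    [5,0,3,1,2,8,6,7])))))))))))), Br 0 1 Mx (Br 0 2 Mx (Br 0 3 Mx (Br 0 7 Mx (Br 0 8 Mx (Br 1 2
    Mx (Br 1 6 Mx (Br 1 7 Mx (Br 1 8 Mx (Br 2 6 Mx (Br 2 7 Mx (Br 3 7 Mx (Dr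
    [5,0,6,3,1,2,8,7])))))))))))), Mx]"
  by code_simp

lemma cert_apex14_9_5:
  "list_all2 (\<lambda>(r, es). chk 9 1 14 (\<lambda>i. if i = 8 then 5 else 3) (\<lambda>_. 5) []
    es (pairs 9)) (small_seeds 8 9) [Mx]"
  by code_simp

text \<open>The same scheme for 15 edges, now with targets: what cannot be drawn after one deletion
  is recognised as a member of the Petersen family. The degree sum 30 leaves maximum degree 4 or 5
  on 8 or 9 vertices and forces regularity on 10.\<close>

lemma cert_apex15_8_4:
  "list_all2 (\<lambda>(r, es). chk 8 1 15 (\<lambda>i. if i = 7 then 4 else 3) (\<lambda>_. 4)
    [(8, k44e), (8, p8)] es (pairs 8)) (small_seeds 7 11) [Br 0 1 (Fu 0 (Fu 1 (Br 2 6 (Fu 2 (Fo 7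
    (To (Lo 6)))) (Dr [4,0,1,5,2,7,6])))) (Br 3 4 (Fu 3 (Fu 4 (Br 5 6 (Fu 5 (Fo 7 (To (Lo 6))))
    (Dr [0,3,1,4,5,7,6])))) (Br 0 2 (Fu 0 (Fu 2 (Br 1 6 (Fu 1 (Fo 7 (To (Lo 6)))) (Dr
    [3,0,2,4,1,7,6])))) (Br 3 5 (Fu 3 (Fu 5 (Br 0 6 (Fu 0 (Fo 7 (To (Lo 6)))) (Dr
    [2,3,0,4,6,7,5])))) (Br 1 2 (Fu 1 (Fu 2 (Br 0 6 (Fu 0 (Fo 7 (To (Lo 6)))) (Dr
    [3,0,5,1,2,6,7])))) (Br 4 5 (Fu 4 (Fu 5 (Br 0 6 (Fu 0 (Fo 7 (To (Lo 6)))) (Dr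
    [2,3,6,7,0,4,5])))) (Br 0 6 (Fu 0 (Br 1 6 (Fu 1 (Br 2 7 (Fu 2 (Br 3 7 (Fu 3 (Br 4 7 (Fu 4 (Br
    5 6 Mx (Fo 6 (Fu 7 (Dr [1,3,2,5,4,7,6]))))) (Fo 7 (To (Dr [1,3,2,4,5,7,6]))))) (Fo 7 (To (Dr
    [1,3,2,4,7,6,5]))))) (Fo 7 (To (Co 0 [2,0,1,7,6,3,4,5]))))) (Br 6 7 (Br 2 6 (Fu 2 (Br 3 7 (Fu
    3 (Br 4 7 (Fu 4 (Br 1 7 (Fu 7 (To (Dr [1,3,2,5,4,6,7]))) (Fo 7 (To (Co 0
    [1,0,2,7,6,3,4,5]))))) (Fo 7 (To (Dr [1,3,2,4,5,6,7]))))) (Fo 7 (To (Dr [1,3,2,4,7,6,5])))))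
    (Br 1 7 (Br 2 7 (Br 3 7 (Fu 3 (Fu 7 (Br 4 6 (To (Dr [1,3,2,5,4,6,7])) (Dr [1,3,2,4,5,6,7]))))
    (Br 3 6 (Br 4 7 (Fu 4 (Fu 7 (To (Dr [1,3,2,5,4,7,6])))) (Fo 7 (To (Dr [1,3,2,4,5,7,6])))) (Dr
    [0,3,2,4,6,7,5]))) (Dr [4,0,5,2,1,7,6])) (Dr [4,0,5,1,2,7,6]))) (Dr [4,0,5,1,7,2,6])))) (Br 1
    6 (Fu 1 (Br 6 7 (Br 2 6 (Fu 2 (Br 3 7 (Fu 3 (Br 4 7 (Fu 4 (Br 0 7 (Fu 7 (To (Dr
    [0,3,2,5,4,6,7]))) (Fo 7 (To (Co 0 [0,1,2,7,6,3,4,5]))))) (Fo 7 (To (Dr [0,3,2,4,5,6,7])))))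
    (Fo 7 (To (Dr [0,3,2,4,7,6,5]))))) (Br 0 7 (Br 2 7 (Br 3 7 (Fu 3 (Fu 7 (Br 4 6 (To (Dr
    [1,3,2,5,4,6,7])) (Dr [1,3,2,4,5,6,7])))) (Br 3 6 (Br 4 7 (Fu 4 (Fu 7 (To (Dr
    [1,3,2,5,4,7,6])))) (Fo 7 (To (Dr [1,3,2,4,5,7,6])))) (Dr [1,3,2,4,6,7,5]))) (Dr
    [4,0,5,2,1,6,7])) (Dr [4,0,5,1,6,7,2]))) (Dr [4,0,5,1,6,2,7]))) (Br 2 6 (Fu 2 (Br 0 7 (Br 1 7
    (Br 6 7 (Br 3 7 (Fu 3 (Fu 7 (Br 4 6 (To (Dr [1,3,2,5,4,6,7])) (Dr [1,3,2,4,5,6,7])))) (Br 3 6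
    (Br 4 7 (Fu 4 (Fu 7 (To (Dr [1,3,2,5,4,7,6])))) (Fo 7 (To (Dr [1,3,2,4,5,7,6])))) (Dr
    [1,3,2,4,6,7,5]))) (Dr [4,0,5,2,6,1,7])) (Dr [4,0,5,1,2,6,7])) (Dr [4,0,5,1,7,6,2]))) (Br 6 7
    (Br 3 6 (Fu 3 (Br 4 6 (Fu 4 (Br 5 7 (Fu 5 (Br 0 7 (Br 1 7 (Fu 7 (Dr [4,0,5,2,1,7,6])) (Dr
    [4,0,5,1,2,7,6])) (Dr [4,0,5,2,7,1,6]))) (Fo 7 (To (Co 0 [6,0,1,2,5,3,4,7]))))) (Fo 6 (Fu 5
    (Br 0 7 (Br 1 7 (Br 2 7 (Co 0 [6,0,1,2,4,3,5,7]) (Dr [4,0,5,6,7,1,2])) (Dr [4,0,5,6,7,2,1]))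
    (Dr [4,0,5,1,7,6,2])))))) (Fo 6 (Fu 4 (Fu 5 (Br 0 7 (Br 1 7 (Br 2 7 (Co 0 [6,0,1,2,3,4,5,7])
    (Dr [3,0,5,6,7,1,2])) (Dr [3,0,5,6,7,2,1])) (Dr [3,0,5,1,7,6,2])))))) (Fo 6 (Fu 3 (Fu 4 (Fu 5
    (Lo 7)))))))))))))), Br 0 1 (Fu 0 (Fu 1 (Br 2 6 (Fu 2 (Fo 7 (Fu 3 (Fu 4 (Fu 5 Mx))))) (Dr
    [5,0,1,3,2,7,6])))) (Br 3 4 (Fu 3 (Fu 4 (Br 5 6 (Fu 5 (Fo 7 (Fu 0 (Fu 1 (Fu 2 Mx))))) (Dr
    [1,3,4,0,6,7,5])))) (Br 0 2 (Fu 0 (Fu 2 (Br 1 6 (Fu 1 (Fo 7 (Fu 3 (Fu 4 (Fu 5 Mx))))) (Dr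
    [4,0,2,3,1,7,6])))) (Br 3 5 (Fu 3 (Fu 5 (Br 4 6 (Fu 4 (Fo 7 (Fu 1 (Fu 2 Mx)))) (Dr
    [2,3,5,0,6,7,4])))) (Br 1 2 (Fu 1 (Fu 2 (Br 0 3 (Fu 0 (Fu 3 (Lo 7))) (Dr [5,0,6,3,1,2,7]))))
    (Br 4 5 (Fu 4 (Fu 5 (Br 0 3 (Fu 0 (Fu 3 (Lo 7))) (Dr [2,3,6,0,7,4,5])))) (Br 0 3 (Fu 0 (Fu 3
    (Br 1 7 (Fu 1 (Br 2 7 (Fu 2 (Br 4 7 (Fu 4 (Br 5 6 Mx (Fo 6 (Fu 7 (Dr [1,3,2,5,4,7,6]))))) (Fo
    7 (To (Dr [1,3,2,4,5,7,6]))))) (Fo 7 (To (Dr [4,0,5,2,1,7,6]))))) (Fo 7 (To (Dr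
    [4,0,5,1,2,7,6])))))) (Br 1 6 (Fu 1 (Br 2 6 (Fu 2 (Fu 6 (Fo 7 Mx))) (Dr [5,0,6,1,3,2,7]))) (Br
    2 7 (Fu 2 (Br 1 7 (Br 4 6 (Fu 4 (Br 5 6 (Fu 5 (Fu 6 (Fo 7 Mx))) (Dr [7,0,5,2,3,4,6]))) (Br 5 7
    (Fu 5 (Fo 6 (Fu 7 (Dr [2,3,6,0,7,5,4])))) (Dr [7,0,4,2,3,5,6]))) (Dr [5,0,6,3,1,2,7]))) (Dr
    [5,0,6,2,3,1,7]))))))))), Fu 0 (Fu 1 (Fu 2 (Fu 3 (Fu 4 (Lo 5))))), Fu 0 (Fu 1 (Fu 2 (Fu 3 (Fu
    4 (Lo 6)))))]"
  by code_simp

lemma cert_apex15_8_5: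
  "list_all2 (\<lambda>(r, es). chk 8 1 15 (\<lambda>i. if i = 7 then 5 else 3) (\<lambda>_. 5)
    [(8, k44e), (8, p8)] es (pairs 8)) (small_seeds 7 10) [Br 0 1 (Br 0 2 (Fu 0 (Br 1 7 Mx (Fo 7
    (Fu 2 Mx)))) (Br 1 2 (Fu 1 (Br 0 7 Mx (Fo 7 (Fu 2 Mx)))) (Br 0 6 (Fu 0 (Br 1 7 (Fu 1 (Br 2 7
    Mx (Fo 7 Mx))) (Fo 7 Mx))) (Br 1 6 (Fu 1 (Br 0 7 (Br 2 7 Mx (Fo 7 Mx)) (Fo 7 Mx))) (Br 0 7 (Br
    3 4 Mx (Br 3 5 Mx (Br 4 5 Mx (Br 1 7 (Br 2 6 Mx (Br 3 6 Mx (Fo 6 (To (Lo 7))))) (Br 2 7 (Br 3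
    6 Mx (Dr [5,0,1,3,2,6,7])) (Dr [4,0,1,5,2,6,7])))))) (Br 1 7 (Br 2 7 (Br 3 6 Mx (Dr
    [5,0,1,3,2,7,6])) (Dr [4,0,1,5,2,6,7])) (Fo 7 (To (Lo 6))))))))) (Br 0 2 (Br 1 2 (Fu 2 (Br 0 7
    Mx (Fo 7 (Fu 1 Mx)))) (Br 0 6 (Fu 0 (Br 2 7 (Fu 2 (Br 1 7 Mx (Fo 7 Mx))) (Fo 7 Mx))) (Br 2 6
    (Fu 2 (Br 0 7 (Br 1 7 Mx (Fo 7 Mx)) (Fo 7 Mx))) (Br 0 7 (Br 3 4 Mx (Br 3 5 Mx (Br 4 5 Mx (Br 2
    7 (Br 1 6 Mx (Br 3 6 Mx (Fo 6 (To (Lo 7))))) (Br 1 7 (Br 3 6 Mx (Dr [5,0,2,3,1,6,7])) (Dr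
    [4,0,2,5,1,6,7])))))) (Br 2 7 (Br 1 7 (Br 3 6 Mx (Dr [5,0,2,3,1,7,6])) (Dr [4,0,2,5,1,6,7]))
    (Fo 7 (To (Lo 6)))))))) (Br 0 6 (Br 0 7 (Br 1 2 (Br 1 6 Mx (Br 1 7 Mx (Br 2 7 Mx (Fo 7 Mx))))
    (Br 1 6 (Br 3 4 Mx (Br 3 5 Mx (Br 4 5 Mx (Br 1 7 (Br 2 6 Mx (Br 2 7 Mx (Br 3 7 Mx (Fo 7 Mx))))
    (Br 2 7 (Br 3 7 Mx (Fo 7 Mx)) (Fo 7 Mx)))))) (Br 1 7 (Br 3 4 Mx (Br 3 5 Mx (Br 4 5 Mx (Br 2 6
    (Br 2 7 Mx (Br 3 7 Mx (Fo 7 Mx))) (Br 2 7 (Br 3 6 Mx (Br 4 6 Mx (Fo 6 (To (Lo 7))))) (Br 3 6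
    (Br 3 7 Mx (Fo 7 Mx)) (Dr [5,0,3,2,1,7,6]))))))) (Br 2 7 (Br 3 4 Mx (Br 3 5 Mx (Br 3 7 (Br 4 7
    Mx (Fo 7 (To (Lo 6)))) (Fo 7 (To (Lo 6)))))) (Fo 7 (To (Lo 6))))))) (Br 1 7 (Br 2 7 (Br 1 2 Mx
    (Br 3 4 Mx (Br 3 5 Mx (Br 3 7 (Br 4 7 Mx (Fo 7 (To (Lo 6)))) (Fo 7 (To (Lo 6))))))) (Fo 7 (To
    (Lo 6)))) (Fo 7 (To (Lo 6))))) (Br 0 7 (Br 1 2 (Br 3 4 Mx (Br 3 5 Mx (Br 4 5 Mx (Br 1 6 (Fu 1
    (Br 2 7 Mx (Fo 7 Mx))) (Br 2 6 (Fu 2 (Br 1 7 Mx (Dr [4,0,5,1,2,6,7]))) (Br 3 6 (Br 4 6 Mx (Fo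
    6 Mx)) (Fo 6 Mx))))))) (Br 1 6 (Br 1 7 (Br 3 4 Mx (Br 3 5 Mx (Br 4 5 Mx (Br 2 6 (Br 2 7 Mx (Br
    3 7 Mx (Fo 7 Mx))) (Br 2 7 (Br 3 6 Mx (Br 4 6 Mx (Fo 6 (To (Lo 7))))) (Br 3 6 (Br 3 7 Mx (Fo 7
    Mx)) (Dr [5,0,3,2,1,6,7]))))))) (Br 2 7 (Br 3 4 Mx (Br 3 5 Mx (Br 3 7 (Br 4 7 Mx (Fo 7 (To (Lo
    6)))) (Fo 7 (To (Lo 6)))))) (Fo 7 (To (Lo 6))))) (Br 1 7 (Br 2 6 (Br 3 4 Mx (Br 3 5 Mx (Br 4 5
    Mx (Br 2 7 (Br 3 6 Mx (Br 4 6 Mx (Fo 6 (To (Lo 7))))) (Br 3 7 (Br 4 7 Mx (Fo 7 (To (Lo 6))))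
    (Fo 7 (To (Lo 6)))))))) (Br 6 7 (Br 3 6 (Br 3 4 Mx (Br 3 5 Mx (Br 4 5 Mx (Br 4 6 (Br 2 7 Mx
    (Br 3 7 Mx (Fo 7 Mx))) (Fo 6 (Br 2 7 Mx (Dr [5,0,4,2,1,7,6]))))))) (Fo 6 (Br 2 7 Mx (Dr
    [5,0,3,2,1,7,6])))) (Fo 6 Mx))) (Br 2 7 (Br 3 6 (Br 3 7 (Fu 3 (Br 4 6 Mx (Dr
    [3,0,4,1,2,6,7]))) (Fo 7 (To (Lo 6)))) (Dr [5,0,3,1,2,6,7])) (Dr [4,0,5,1,2,6,7]))))) (Br 6 7
    (Br 1 7 (Br 2 7 (Br 1 2 (Fu 1 (Fu 2 (Br 3 6 Mx (Fo 6 (To (Lo 7)))))) (Br 3 7 (Br 3 4 Mx (Br 3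
    5 Mx (Br 4 5 Mx (Br 4 7 (Fu 7 (Br 3 6 Mx (Dr [1,3,0,5,2,6,7]))) (Fo 7 (Br 3 6 Mx (Dr
    [1,3,0,4,2,6,7]))))))) (Fo 7 (Br 4 6 Mx (Dr [3,0,4,1,7,2,6]))))) (Fo 7 (Br 1 2 Mx (Br 1 6 Mx
    (Dr [4,0,5,1,7,6,2]))))) (Fo 7 (Br 1 2 Mx (Br 2 6 Mx (Dr [4,0,5,1,6,7,2]))))) (Fo 7 Mx))))),
    Br 0 1 (Br 0 2 (Fu 0 (Br 1 7 Mx (Fo 7 (Fu 2 Mx)))) (Br 1 2 (Fu 1 (Br 0 7 Mx (Fo 7 (Fu 2 Mx))))
    (Br 0 3 (Fu 0 (Br 1 7 Mx (Fo 7 (Fu 3 Mx)))) (Br 1 6 (Fu 1 (Br 0 7 (Br 2 7 Mx (Fo 7 Mx)) (Fo 7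
    Mx))) (Br 0 7 (Br 3 4 Mx (Br 3 5 Mx (Br 4 5 Mx (Br 1 7 (Br 3 7 Mx (Br 2 7 Mx (Fo 7 Mx))) (Br 3
    7 (Br 2 7 Mx (Fo 7 Mx)) (Dr [0,1,3,2,4,7,5])))))) (Br 1 7 (Br 2 7 (Br 3 7 Mx (Fo 7 Mx)) (Fo 7
    Mx)) (Fo 7 Mx))))))) (Br 0 2 (Br 1 2 (Fu 2 (Br 0 7 Mx (Fo 7 (Fu 1 Mx)))) (Br 0 3 (Fu 0 (Br 1 7
    Mx (Fo 7 (Fu 2 (Fu 3 Mx))))) (Br 2 6 (Fu 2 (Br 0 7 (Br 1 7 Mx (Fo 7 Mx)) (Fo 7 Mx))) (Br 0 7
    (Br 3 4 Mx (Br 3 5 Mx (Br 4 5 Mx (Br 2 7 (Br 3 7 Mx (Br 1 7 Mx (Fo 7 Mx))) (Br 3 7 (Br 1 7 Mx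
    (Fo 7 Mx)) (Dr [0,2,3,1,4,7,5])))))) (Br 2 7 (Br 1 7 (Br 3 7 Mx (Fo 7 Mx)) (Fo 7 Mx)) (Fo 7
    Mx)))))) (Br 0 3 (Br 3 4 (Fu 3 (Br 0 7 Mx (Fo 7 (Fu 4 Mx)))) (Br 3 5 (Fu 3 (Br 0 7 Mx (Fo 7
    (Fu 5 Mx)))) (Br 0 7 (Br 1 2 Mx (Br 4 5 Mx (Br 3 7 (Br 1 6 Mx (Br 1 7 Mx (Br 2 7 Mx (Fo 7
    Mx)))) (Br 1 7 (Br 2 7 Mx (Fo 7 Mx)) (Fo 7 Mx))))) (Br 3 7 (Br 1 2 Mx (Br 1 7 (Br 2 7 Mx (Fo 7
    Mx)) (Fo 7 Mx))) (Fo 7 Mx))))) (Br 0 7 (Br 1 2 (Br 3 4 Mx (Br 3 5 Mx (Br 4 5 Mx (Br 1 6 (Fu 1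
    (Br 3 7 Mx (Dr [2,1,3,4,0,7,5]))) (Br 2 7 (Fu 2 (Br 1 7 Mx (Dr [5,0,6,3,1,2,7]))) (Dr
    [5,0,6,2,3,7,1])))))) (Br 1 6 (Br 1 7 (Br 2 6 Mx (Br 3 4 Mx (Br 3 5 Mx (Br 4 5 Mx (Br 4 6 Mx
    (Br 5 6 Mx (Br 4 7 (Br 5 7 Mx (Dr [7,0,4,2,3,5,6])) (Dr [7,0,5,2,3,4,6])))))))) (Br 2 6 (Br 2
    7 Mx (Fo 7 (Fu 6 Mx))) (Dr [5,0,6,1,3,2,7]))) (Br 2 7 (Br 1 7 (Br 3 4 Mx (Br 3 5 Mx (Br 4 5 Mx
    (Br 2 6 (Br 3 7 Mx (Br 4 7 Mx (Fo 7 Mx))) (Br 3 7 (Br 4 6 Mx (Br 5 6 Mx (Fo 6 (Fu 7 (Dr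
    [1,3,2,4,5,7,6]))))) (Br 4 7 (Br 5 7 Mx (Fo 7 (To (Dr [1,3,2,5,4,7,6])))) (Fo 7 (To (Dr
    [1,3,2,4,5,7,6]))))))))) (Br 2 6 (Br 3 4 Mx (Br 3 5 Mx (Br 3 7 (Br 4 7 Mx (Fo 7 Mx)) (Dr
    [5,0,6,3,1,2,7])))) (Dr [5,0,6,3,1,2,7]))) (Dr [5,0,6,2,3,1,7])))) (Br 1 7 (Br 2 7 (Br 3 7 (Br
    1 2 Mx (Br 3 4 Mx (Br 3 5 Mx (Br 4 5 Mx (Br 4 7 (Br 5 7 Mx (Dr [1,3,2,5,0,4,7])) (Dr
    [1,3,2,4,0,5,7])))))) (Fo 7 (To (Co 1 [0,1,2,3,4,5,6,7])))) (Fo 7 (To (Dr [4,0,5,2,1,7,6]))))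
    (Fo 7 (To (Dr [4,0,5,1,2,7,6]))))))), Mx]"
  by code_simp

lemma cert_apex15_9_4:
  "list_all2 (\<lambda>(r, es). chk 9 1 15 (\<lambda>i. if i = 8 then 4 else 3) (\<lambda>_. 4)
    [(9, p9)] es (pairs 9)) (small_seeds 8 11) [Br 0 1 (Fu 0 (Fu 1 (Br 2 6 Mx (Br 2 7 Mx (Br 3 6
    Mx (Dr [5,0,1,3,2,8,6,7])))))) (Br 3 4 (Fu 3 (Fu 4 (Br 5 6 Mx (Br 5 7 Mx (Br 0 6 Mx (Dr
    [1,3,0,4,5,8,6,7])))))) (Br 0 2 (Fu 0 (Fu 2 (Br 1 6 Mx (Br 1 7 Mx (Br 3 6 Mx (Dr
    [4,0,2,3,1,8,6,7])))))) (Br 3 5 (Fu 3 (Fu 5 (Br 0 6 Mx (Br 0 7 Mx (Br 4 6 Mx (Dr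
    [2,3,0,4,7,6,8,5])))))) (Br 1 2 (Fu 1 (Fu 2 (Br 0 6 Mx (Br 0 7 Mx (Br 3 6 Mx (Dr
    [5,0,3,1,2,7,6,8])))))) (Br 4 5 (Fu 4 (Fu 5 (Br 0 6 Mx (Br 0 7 Mx (Br 1 6 Mx (Dr
    [1,3,7,6,8,0,4,5])))))) (Br 0 6 (Fu 0 (Br 1 6 (Fu 1 (Br 2 6 Mx (Br 2 7 Mx (Br 2 8 Mx (Br 3 8
    Mx (Fo 8 (To (Lo 7)))))))) (Br 2 6 (Fu 2 (Br 1 7 Mx (Br 1 8 Mx (Br 3 8 Mx (Fo 8 (To (Lo
    7))))))) (Br 3 6 (Fu 3 (Br 1 7 Mx (Br 1 8 Mx (Br 2 7 Mx (Dr [5,0,3,1,2,8,6,7]))))) (Br 4 6 (Fu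
    4 (Br 1 7 Mx (Br 1 8 Mx (Br 2 7 Mx (Dr [3,0,4,1,2,8,6,7]))))) (Br 5 6 (Fu 5 (Br 1 7 Mx (Br 1 8
    Mx (Br 2 7 Mx (Dr [4,0,5,1,2,8,6,7]))))) (Fo 6 (Br 1 7 (Fu 1 (Br 2 7 Mx (Br 2 8 Mx (Br 3 8 Mx
    (Dr [5,0,3,2,1,7,6,8]))))) (Br 2 7 (Fu 2 (Br 1 8 Mx (Br 3 8 Mx (Dr [5,0,3,1,2,7,6,8])))) (Br 3
    7 (Fu 3 (Br 1 8 Mx (Br 2 8 Mx (Dr [5,0,3,1,2,7,6,8])))) (Br 1 8 (Br 2 8 Mx (Dr
    [5,0,3,2,1,8,6,7])) (Dr [5,0,3,1,2,8,6,7])))))))))))) (Br 1 6 (Fu 1 (Br 2 6 (Fu 2 (Br 0 7 Mx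
    (Br 0 8 Mx (Br 3 8 Mx (Fo 8 (To (Lo 7))))))) (Br 3 6 (Fu 3 (Br 0 7 Mx (Br 0 8 Mx (Br 2 7 Mx
    (Dr [5,0,3,1,6,7,8,2]))))) (Br 4 6 (Fu 4 (Br 0 7 Mx (Br 0 8 Mx (Br 2 7 Mx (Dr
    [3,0,4,1,6,7,8,2]))))) (Br 5 6 (Fu 5 (Br 0 7 Mx (Br 0 8 Mx (Br 2 7 Mx (Dr
    [4,0,5,1,6,7,8,2]))))) (Fo 6 (Br 0 7 (Fu 0 (Br 2 7 Mx (Br 2 8 Mx (Br 3 8 Mx (Dr
    [5,0,3,2,1,6,7,8]))))) (Br 2 7 (Fu 2 (Br 0 8 Mx (Br 3 8 Mx (Dr [5,0,3,1,6,8,7,2])))) (Br 3 7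
    (Fu 3 (Br 0 8 Mx (Br 2 8 Mx (Dr [5,0,3,1,6,8,7,2])))) (Br 0 8 (Br 2 8 Mx (Dr
    [5,0,3,2,1,6,7,8])) (Dr [5,0,3,1,6,7,8,2]))))))))))) (Br 2 6 (Fu 2 (Br 3 6 (Fu 3 (Br 0 7 Mx
    (Br 0 8 Mx (Br 1 7 Mx (Dr [5,0,3,1,8,7,6,2]))))) (Br 4 6 (Fu 4 (Br 0 7 Mx (Br 0 8 Mx (Br 1 7
    Mx (Dr [3,0,4,1,8,7,6,2]))))) (Br 5 6 (Fu 5 (Br 0 7 Mx (Br 0 8 Mx (Br 1 7 Mx (Dr
    [4,0,5,1,8,7,6,2]))))) (Fo 6 (Br 0 7 (Fu 0 (Br 1 7 Mx (Br 1 8 Mx (Br 3 8 Mx (Dr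
    [5,0,3,1,2,6,7,8]))))) (Br 1 7 (Fu 1 (Br 0 8 Mx (Br 3 8 Mx (Dr [5,0,3,1,7,8,6,2])))) (Br 3 7
    (Fu 3 (Br 0 8 Mx (Br 1 8 Mx (Dr [5,0,3,1,2,6,8,7])))) (Br 0 8 (Br 1 8 Mx (Dr
    [5,0,3,1,2,6,7,8])) (Dr [5,0,3,1,8,7,6,2])))))))))) (Br 3 6 (Fu 3 (Br 4 6 (Fu 4 (Br 0 7 Mx (Br
    0 8 Mx (Br 1 8 Mx (Fo 8 (To (Lo 7))))))) (Br 5 6 (Fu 5 (Br 0 7 Mx (Br 0 8 Mx (Br 1 8 Mx (Fo 8
    (To (Lo 7))))))) (Fo 6 (Br 0 7 (Fu 0 (Br 1 7 Mx (Br 1 8 Mx (Br 2 7 Mx (Dr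
    [5,0,3,1,2,8,6,7]))))) (Br 1 7 (Fu 1 (Br 0 8 Mx (Br 2 7 Mx (Dr [5,0,3,1,7,6,8,2])))) (Br 2 7
    (Fu 2 (Br 0 8 Mx (Dr [5,0,3,1,8,6,7,2]))) (Br 4 8 (Fu 4 (Fo 7 (To (Lo 8)))) (Br 5 8 (Fu 5 (Fo
    7 (To (Lo 8)))) (Br 0 8 (Br 1 8 Mx (Fo 8 (To (Lo 7)))) (Fo 8 (To (Lo 7))))))))))))) (Br 4 6
    (Fu 4 (Br 5 6 (Fu 5 (Br 0 7 Mx (Br 0 8 Mx (Br 1 8 Mx (Fo 8 (To (Lo 7))))))) (Fo 6 (Br 0 7 (Fu
    0 (Br 1 7 Mx (Br 1 8 Mx (Br 2 7 Mx (Dr [5,0,4,1,2,8,6,7]))))) (Br 1 7 (Fu 1 (Br 0 8 Mx (Br 2 7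
    Mx (Dr [5,0,4,1,7,6,8,2])))) (Br 2 7 (Fu 2 (Br 0 8 Mx (Dr [5,0,4,1,8,6,7,2]))) (Br 3 8 (Fu 3
    (Fo 7 (To (Lo 8)))) (Br 5 8 (Fu 5 (Fo 7 (To (Lo 8)))) (Br 0 8 (Br 1 8 Mx (Fo 8 (To (Lo 7))))
    (Fo 8 (To (Lo 7)))))))))))) (Fo 6 (Fu 5 (Br 0 7 (Fu 0 (Br 1 7 Mx (Br 1 8 Mx (Br 2 7 Mx (Dr
    [4,0,5,1,2,8,6,7]))))) (Br 1 7 (Fu 1 (Br 0 8 Mx (Br 2 7 Mx (Dr [4,0,5,1,7,6,8,2])))) (Br 2 7
    (Fu 2 (Br 0 8 Mx (Dr [4,0,5,1,8,6,7,2]))) (Br 3 8 (Fu 3 (Fo 7 (To (Lo 8)))) (Br 4 8 (Fu 4 (Fo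
    7 (To (Lo 8)))) (Br 0 8 (Br 1 8 Mx (Fo 8 (To (Lo 7)))) (Fo 8 (To (Lo 7))))))))))))))))))))),
    Br 0 1 (Fu 0 (Fu 1 (Br 2 6 Mx (Br 2 7 Mx (Br 3 7 Mx (Dr [5,0,1,3,2,8,6,7])))))) (Br 3 4 (Fu 3
    (Fu 4 (Br 0 2 Mx (Br 0 7 Mx (Br 0 8 Mx (Br 5 7 Mx (Dr [2,3,4,0,6,5,8,7]))))))) (Br 0 2 (Fu 0
    (Fu 2 (Br 1 6 Mx (Br 1 7 Mx (Br 3 7 Mx (Dr [4,0,2,3,1,8,6,7])))))) (Br 3 5 (Fu 3 (Fu 5 (Br 0 7
    Mx (Br 0 8 Mx (Br 4 7 Mx (Dr [2,3,5,0,6,4,8,7])))))) (Br 1 2 (Fu 1 (Fu 2 (Br 0 3 Mx (Br 0 7 Mx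
    (Br 3 8 Mx (Dr [5,0,6,3,1,2,7,8])))))) (Br 4 5 (Fu 4 (Fu 5 (Br 0 3 Mx (Br 0 7 Mx (Br 3 8 Mx
    (Dr [2,3,6,7,8,0,4,5])))))) (Br 0 3 (Fu 0 (Fu 3 (Br 1 6 Mx (Br 1 7 Mx (Br 1 8 Mx (Br 2 7 Mx
    (Dr [5,0,3,1,2,6,7,8]))))))) (Br 1 6 (Fu 1 (Br 2 6 Mx (Br 4 6 Mx (Br 5 6 Mx (Br 0 7 (Fu 0 (Br
    2 7 Mx (Br 3 7 Mx (Dr [5,0,6,1,3,2,8,7])))) (Br 2 7 (Fu 2 (Br 3 8 Mx (Dr [5,0,6,1,3,2,7,8])))
    (Br 4 7 (Fu 4 (Br 5 7 Mx (Dr [8,0,5,1,2,3,6,7]))) (Dr [8,0,4,1,2,3,6,7])))))))) (Br 2 6 (Fu 2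
    (Br 4 6 Mx (Br 5 6 Mx (Br 0 7 (Fu 0 (Br 1 7 Mx (Br 3 7 Mx (Dr [5,0,6,2,3,1,8,7])))) (Br 1 7
    (Fu 1 (Br 3 8 Mx (Dr [5,0,6,2,3,1,7,8]))) (Br 4 7 (Fu 4 (Br 5 7 Mx (Dr [8,0,5,1,3,2,6,7])))
    (Dr [8,0,4,1,3,2,6,7]))))))) (Br 4 6 (Fu 4 (Br 5 6 Mx (Br 0 7 (Fu 0 (Br 1 7 Mx (Br 3 7 Mx (Dr
    [6,0,4,1,3,8,5,7])))) (Br 1 7 (Fu 1 (Br 3 8 Mx (Dr [6,0,4,1,3,7,5,8]))) (Br 5 7 (Fu 5 (Br 0 8
    Mx (Br 1 8 Mx (Dr [6,0,4,1,3,8,7,5])))) (Dr [8,0,5,1,3,4,6,7])))))) (Br 5 6 (Fu 5 (Br 0 7 (Fu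
    0 (Br 1 7 Mx (Br 3 7 Mx (Dr [6,0,5,1,3,8,4,7])))) (Br 1 7 (Fu 1 (Br 3 8 Mx (Dr
    [6,0,5,1,3,7,4,8]))) (Br 4 7 (Fu 4 (Br 0 8 Mx (Br 1 8 Mx (Dr [6,0,4,1,5,3,7,8])))) (Dr
    [8,0,4,1,3,5,6,7]))))) (Br 0 7 (Fu 0 (Br 1 7 (Fu 1 (Br 2 7 Mx (Br 2 8 Mx (Br 3 8 Mx (Fo 8 (Fu
    4 (Fu 5 Mx))))))) (Br 2 7 (Fu 2 (Br 1 8 Mx (Br 3 8 Mx (Fo 8 (Fu 4 (Fu 5 Mx)))))) (Br 3 7 (Fu 3
    (Br 1 8 Mx (Br 2 8 Mx (Fo 8 (Fu 4 (Fu 5 Mx)))))) (Br 1 8 (Br 2 8 Mx (Dr [5,0,6,3,2,1,8,7]))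
    (Dr [5,0,6,3,1,2,8,7])))))) (Br 1 7 (Fu 1 (Br 2 7 (Fu 2 (Br 0 8 Mx (Br 3 8 Mx (Fo 8 (Fu 4 (Fu
    5 Mx)))))) (Br 7 8 (Br 3 7 (Fu 3 (Br 2 8 Mx (Dr [5,0,6,3,2,1,7,8]))) (Br 4 7 (Fu 4 (Br 2 8 Mx
    (Dr [5,0,4,2,1,7,6,8]))) (Br 4 8 (Br 5 7 Mx (Fo 7 (Br 5 8 Mx (Dr [8,2,3,1,5,4,7,6])))) (Dr
    [8,2,3,1,4,5,7,6])))) (Dr [3,1,5,0,7,6,8,2])))) (Br 2 7 (Fu 2 (Br 7 8 (Br 3 7 (Fu 3 (Br 1 8 Mx
    (Dr [5,0,6,3,1,2,7,8]))) (Br 4 7 (Fu 4 (Br 1 8 Mx (Dr [5,0,4,1,2,7,6,8]))) (Br 4 8 (Br 5 7 Mx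
    (Fo 7 (Br 5 8 Mx (Dr [8,1,3,2,5,4,7,6])))) (Dr [8,1,3,2,4,5,7,6])))) (Dr [3,1,5,0,8,6,7,2])))
    (Br 3 7 (Fu 3 (Br 4 7 (Fu 4 (Br 0 8 Mx (Br 1 8 Mx (Fo 8 (Fu 5 Mx))))) (Br 1 8 (Br 2 8 Mx (Dr
    [8,0,4,1,3,2,6,7])) (Dr [8,0,4,1,3,6,7,2])))) (Br 4 7 (Fu 4 (Br 5 7 (Fu 5 (Br 0 8 Mx (Br 1 8
    Mx (Dr [3,1,5,0,6,7,8,2])))) (Fo 7 (Br 1 8 (Br 2 8 Mx (Dr [8,0,5,2,4,1,7,6])) (Dr
    [8,0,5,1,4,2,7,6]))))) (Fo 7 (Fu 5 (Br 1 8 (Br 2 8 Mx (Dr [8,0,4,2,5,1,7,6])) (Dr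
    [8,0,4,1,5,2,7,6]))))))))))))))))))), Br 0 1 (Fu 0 (Fu 1 (Br 2 6 Mx (Br 2 7 Mx (Br 2 8 Mx (Br
    3 8 Mx (Fo 8 (Fu 4 (Fu 5 Mx))))))))) (Br 3 4 (Fu 3 (Fu 4 (Br 0 2 Mx (Br 1 8 Mx (Dr
    [2,1,3,4,7,0,8,5]))))) (Br 0 2 (Fu 0 (Fu 2 (Br 1 6 Mx (Br 1 7 Mx (Br 1 8 Mx (Br 3 8 Mx (Fo 8
    (Fu 4 (Fu 5 Mx))))))))) (Br 3 5 (Fu 3 (Fu 5 (Br 0 4 Mx (Br 0 8 Mx (Br 4 6 Mx (Dr
    [2,3,5,0,6,7,4,8])))))) (Br 1 2 (Fu 1 (Fu 2 (Br 0 3 Mx (Br 0 4 Mx (Br 3 7 Mx (Dr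
    [4,1,2,3,6,0,7,8])))))) (Br 4 5 (Fu 4 (Fu 5 (Br 0 3 Mx (Br 0 8 Mx (Br 3 7 Mx (Dr
    [2,3,6,8,7,0,5,4])))))) (Br 0 3 (Fu 0 (Fu 3 (Br 4 6 Mx (Br 4 8 Mx (Br 1 8 Mx (Fo 8 (Fu 2 (Fu 5
    Mx)))))))) (Br 0 4 (Fu 0 (Fu 4 (Br 3 7 Mx (Br 3 8 Mx (Br 1 8 Mx (Fo 8 (Fu 2 (Fu 5 Mx))))))))
    (Br 1 6 (Fu 1 (Br 4 6 Mx (Br 2 6 Mx (Br 4 8 (Br 0 8 Mx (Br 2 7 Mx (Br 3 7 Mx (Dr
    [6,0,7,4,1,3,2,8])))) (Dr [5,0,6,1,3,8,2,4]))))) (Br 2 6 (Fu 2 (Br 4 6 Mx (Br 4 8 (Br 0 8 Mx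
    (Br 1 7 Mx (Br 3 7 Mx (Dr [6,0,7,4,1,8,3,2])))) (Dr [5,0,6,2,3,8,1,4])))) (Br 5 6 (Fu 5 (Br 4
    6 Mx (Br 1 7 (Fu 1 (Br 4 8 Mx (Dr [2,3,1,6,0,8,5,4]))) (Br 2 8 (Fu 2 (Br 1 8 Mx (Dr
    [8,0,6,3,1,2,4,7]))) (Dr [7,0,6,3,1,8,4,2]))))) (Br 1 7 (Fu 1 (Br 2 7 Mx (Br 7 8 (Fu 7 (Br 3 8
    Mx (Dr [8,0,5,1,3,2,4,7]))) (Dr [4,1,5,0,7,6,8,2])))) (Br 2 7 (Fu 2 (Br 7 8 (Fu 7 (Br 3 8 Mx
    (Dr [8,0,5,1,3,2,7,4]))) (Dr [4,1,5,0,8,6,7,2]))) (Br 3 7 (Fu 3 (Br 5 7 Mx (Br 4 6 (Fu 4 (Br 0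
    8 Mx (Br 1 8 Mx (Fo 8 (Fu 6 Mx))))) (Br 1 8 (Br 2 8 Mx (Dr [8,0,5,1,4,2,7,6])) (Dr
    [8,0,5,1,2,4,7,6]))))) (Br 1 8 (Br 2 8 (Br 0 8 Mx (Br 3 8 Mx (Br 4 6 Mx (Br 5 8 Mx (Dr
    [7,0,5,2,3,6,8,4]))))) (Dr [8,0,6,7,4,1,2,3])) (Dr [8,0,6,3,1,2,4,7]))))))))))))))), Br 0 1
    (Fu 0 (Fu 1 (Br 2 6 Mx (Br 2 7 Mx (Br 4 6 Mx (Dr [3,1,0,4,2,8,6,7])))))) (Br 3 4 (Fu 3 (Fu 4
    (Br 0 2 Mx (Br 0 6 Mx (Br 0 8 Mx (Br 5 8 Mx (Fo 8 (Fu 1 (Fu 2 Mx))))))))) (Br 0 2 (Fu 0 (Fu 2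
    (Br 1 6 Mx (Br 1 7 Mx (Br 4 6 Mx (Dr [3,1,4,0,2,7,6,8])))))) (Br 3 5 (Fu 3 (Fu 5 (Br 0 6 Mx
    (Br 0 8 Mx (Br 4 8 Mx (Fo 8 (Fu 1 (Fu 2 Mx)))))))) (Br 1 2 (Fu 1 (Fu 2 (Br 0 3 Mx (Br 0 6 Mx
    (Br 3 7 Mx (Dr [5,0,7,6,3,1,2,8])))))) (Br 4 5 (Fu 4 (Fu 5 (Br 0 3 Mx (Br 0 6 Mx (Br 3 7 Mx
    (Dr [2,3,6,7,0,8,4,5])))))) (Br 0 3 (Fu 0 (Fu 3 (Br 1 6 Mx (Br 1 7 Mx (Br 1 8 Mx (Br 2 8 Mx
    (Fo 8 (Fu 4 (Fu 5 Mx))))))))) (Br 1 6 (Fu 1 (Br 0 6 Mx (Br 2 6 Mx (Br 4 6 Mx (Br 5 6 Mx (Br 2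
    7 (Fu 2 (Br 3 8 Mx (Dr [7,0,5,1,2,3,6,8]))) (Br 3 7 (Fu 3 (Br 2 8 Mx (Dr [5,0,7,3,2,1,6,8])))
    (Dr [8,0,5,1,2,3,6,7])))))))) (Br 2 6 (Fu 2 (Br 0 6 Mx (Br 4 6 Mx (Br 5 6 Mx (Br 1 7 (Fu 1 (Br
    3 8 Mx (Dr [7,0,5,1,3,2,6,8]))) (Br 3 7 (Fu 3 (Br 1 8 Mx (Dr [5,0,7,3,1,2,6,8]))) (Dr
    [8,0,5,1,3,2,6,7]))))))) (Br 4 6 (Fu 4 (Br 0 6 Mx (Br 5 6 Mx (Br 1 7 (Fu 1 (Br 2 7 Mx (Dr
    [7,0,5,1,3,2,8,6]))) (Br 2 8 (Fu 2 (Br 1 8 Mx (Dr [8,0,5,1,2,3,6,7]))) (Dr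
    [7,0,5,1,2,3,6,8])))))) (Br 5 6 (Fu 5 (Br 0 6 Mx (Br 1 7 (Fu 1 (Br 2 7 Mx (Dr
    [7,0,4,1,3,2,8,6]))) (Br 2 8 (Fu 2 (Br 1 8 Mx (Dr [8,0,4,1,2,3,6,7]))) (Dr
    [7,0,4,1,2,3,6,8]))))) (Br 0 6 (Fu 0 (Br 1 7 (Fu 1 (Br 6 8 Mx (Br 2 8 Mx (Fo 8 (Fu 3 (Fu 4 (Fu
    5 (Fu 7 Mx)))))))) (Br 2 7 (Fu 2 (Br 7 8 Mx (Dr [3,1,5,0,8,6,7,2]))) (Br 3 7 (Fu 3 (Br 1 8 Mx
    (Br 2 8 Mx (Fo 8 (Fu 4 (Fu 5 Mx)))))) (Br 1 8 (Br 2 8 Mx (Dr [5,0,6,3,2,1,8,7])) (Dr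
    [5,0,6,3,1,2,8,7])))))) (Fo 6 (Br 1 7 (Fu 1 (Br 2 7 Mx (Dr [7,0,5,1,3,2,8,6]))) (Br 2 8 (Fu 2
    (Br 1 8 (Br 0 8 Mx (Br 4 8 Mx (Dr [8,1,3,6,2,4,0,5]))) (Dr [8,0,5,1,2,3,6,7]))) (Dr
    [7,0,5,1,2,3,6,8]))))))))))))))), Br 0 1 (Fu 0 (Fu 1 (Br 2 6 Mx (Br 2 7 Mx (Br 2 8 Mx (Br 3 8
    Mx (Fo 8 (Fu 4 (Fu 5 Mx))))))))) (Br 3 4 (Fu 3 (Fu 4 (Br 0 2 Mx (Br 0 7 Mx (Br 0 8 Mx (Br 1 8
    Mx (Fo 8 (Fu 2 (Fu 5 Mx))))))))) (Br 0 2 (Fu 0 (Fu 2 (Br 1 4 Mx (Br 1 6 Mx (Br 4 8 Mx (Dr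
    [3,1,7,4,0,2,6,8])))))) (Br 3 5 (Fu 3 (Fu 5 (Br 0 7 Mx (Br 0 8 Mx (Br 2 7 Mx (Dr
    [6,0,4,7,8,2,3,5])))))) (Br 1 2 (Fu 1 (Fu 2 (Br 0 3 Mx (Br 0 7 Mx (Br 3 8 Mx (Dr
    [4,0,6,3,1,2,7,8])))))) (Br 4 5 (Fu 4 (Fu 5 (Br 1 6 Mx (Br 1 8 Mx (Br 0 8 Mx (Dr
    [2,3,8,6,0,4,5,1])))))) (Br 0 3 (Fu 0 (Fu 3 (Br 1 4 Mx (Br 1 6 Mx (Br 1 8 Mx (Br 4 8 Mx (Fo 8
    (Fu 2 (Fu 5 Mx))))))))) (Br 1 4 (Fu 1 (Fu 4 (Br 0 7 Mx (Br 0 8 Mx (Br 3 8 Mx (Fo 8 (Fu 2 (Fu 5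
    Mx)))))))) (Br 2 6 (Fu 2 (Br 1 6 Mx (Br 4 6 Mx (Br 5 6 Mx (Br 4 8 (Br 1 8 Mx (Br 0 7 Mx (Br 3
    8 Mx (Dr [6,0,4,2,3,1,7,8])))) (Dr [8,0,5,1,3,2,4,6])))))) (Br 5 6 (Fu 5 (Br 1 6 Mx (Br 4 6 Mx
    (Br 1 8 (Br 4 8 Mx (Br 0 7 Mx (Br 0 8 Mx (Br 2 8 Mx (Dr [3,1,5,0,4,2,6,8]))))) (Dr
    [8,0,4,2,3,1,5,6]))))) (Br 0 7 (Fu 0 (Br 2 7 Mx (Br 3 7 Mx (Br 5 8 (Fu 5 (Br 2 8 Mx (Br 3 8 Mx
    (Br 1 8 Mx (Fo 8 (Fu 4 (Fu 7 Mx))))))) (Dr [7,0,4,2,3,8,1,5]))))) (Br 1 6 (Fu 1 (Br 4 6 Mx (Br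
    5 8 (Fu 5 (Br 0 8 Mx (Br 4 8 Mx (Br 2 8 Mx (Fo 8 (Fu 3 (Fu 6 Mx))))))) (Dr
    [8,0,4,2,3,1,5,6])))) (Br 2 7 (Fu 2 (Br 6 7 (Fu 7 (Br 1 8 Mx (Dr [4,0,6,3,1,7,2,8]))) (Dr
    [8,0,5,1,7,2,4,6]))) (Br 3 7 (Fu 3 (Br 5 7 Mx (Br 2 8 (Br 0 8 Mx (Br 1 8 Mx (Br 5 8 Mx (Dr
    [2,3,1,5,0,4,7,8])))) (Dr [8,0,5,1,3,2,6,7])))) (Br 4 6 (Fu 4 (Br 2 8 (Br 0 8 Mx (Br 5 8 Mx
    (Dr [1,3,2,4,0,5,7,8]))) (Dr [8,0,5,1,3,2,4,6]))) (Br 5 7 (Fu 5 (Br 6 7 (Fu 7 (Br 0 8 Mx (Dr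
    [1,3,2,4,0,5,7,8]))) (Dr [8,1,3,6,2,4,5,7]))) (Br 6 7 (Br 0 8 (Br 1 8 (Br 2 8 Mx (Br 3 8 Mx
    (Dr [8,0,5,1,3,2,6,7]))) (Br 5 8 (Br 7 8 Mx (Dr [8,0,5,1,7,6,3,2])) (Dr [8,2,3,1,5,4,7,6])))
    (Br 5 8 (Br 6 8 (Br 1 8 Mx (Br 7 8 Mx (Dr [3,1,5,0,7,6,8,2]))) (Dr [8,1,5,0,6,7,4,2])) (Dr
    [8,2,3,6,5,4,0,7]))) (Fo 6 (Fo 7 (Br 2 8 (Br 5 8 (Co 0 [0,1,2,3,4,5,6,7,8]) (Dr
    [8,1,3,6,2,4,5,7])) (Dr [8,0,4,2,7,1,5,6])))))))))))))))))))), Mx, Mx]"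
  by code_simp

lemma cert_apex15_9_5:
  "list_all2 (\<lambda>(r, es). chk 9 1 15 (\<lambda>i. if i = 8 then 5 else 3) (\<lambda>_. 5)
    [(9, p9)] es (pairs 9)) (small_seeds 8 10) [Br 0 1 Mx (Br 0 2 Mx (Br 1 2 Mx (Br 3 4 Mx (Br 3 5
    Mx (Br 4 5 Mx (Br 0 6 (Br 0 7 Mx (Br 0 8 Mx (Br 1 6 Mx (Br 1 7 Mx (Br 1 8 Mx (Br 2 8 Mx (Fo 8
    (To (Lo 6))))))))) (Br 0 7 (Br 0 8 Mx (Br 1 6 Mx (Br 1 7 Mx (Br 1 8 Mx (Br 2 8 Mx (Fo 8 (To
    (Lo 6)))))))) (Br 0 8 (Br 1 6 Mx (Br 1 7 Mx (Br 1 8 Mx (Br 2 6 Mx (Br 2 7 Mx (Br 2 8 Mx (Br 3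
    6 Mx (Dr [5,0,3,1,2,7,6,8])))))))) (Br 1 6 (Br 1 7 Mx (Br 1 8 Mx (Br 2 8 Mx (Fo 8 (To (Lo
    6)))))) (Br 1 7 (Br 1 8 Mx (Br 2 8 Mx (Fo 8 (To (Lo 6))))) (Br 1 8 (Br 2 6 Mx (Br 2 7 Mx (Br 2
    8 Mx (Br 3 6 Mx (Dr [5,0,3,1,8,6,7,2]))))) (Br 2 8 (Br 3 8 Mx (Fo 8 Mx)) (Fo 8
    Mx))))))))))))), Br 0 1 Mx (Br 0 2 Mx (Br 0 3 Mx (Br 1 2 Mx (Br 3 4 Mx (Br 3 5 Mx (Br 4 5 Mx
    (Br 0 7 (Br 0 8 Mx (Br 3 7 Mx (Br 3 8 Mx (Br 1 8 Mx (Fo 8 Mx))))) (Br 0 8 (Br 3 7 Mx (Br 3 8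
    Mx (Br 1 6 Mx (Br 1 7 Mx (Br 1 8 Mx (Br 2 8 Mx (Dr [4,0,5,1,3,2,7,8]))))))) (Br 3 7 (Br 3 8 Mx
    (Br 1 8 Mx (Fo 8 Mx))) (Br 3 8 (Br 1 6 Mx (Br 1 7 Mx (Br 1 8 Mx (Br 2 8 Mx (Fo 8 (To (Lo
    7))))))) (Br 1 8 (Br 2 8 Mx (Fo 8 (To (Lo 7)))) (Fo 8 (To (Lo 7)))))))))))))), Mx]"
  by code_simp

text \<open>A cubic graph with 15 edges loses only 3 of them with a vertex, so here seeds with 12
  edges on 9 vertices are required. This is one of the two uses of the 12-edge case.\<close>

lemma cert_apex15_10_3:
  "list_all2 (\<lambda>(r, es). chk 10 1 15 (\<lambda>i. if i = 9 then 3 else 3) (\<lambda>_. 3)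
    [(10, p10)] es (pairs 10)) (small_seeds 9 12) [Fu 0 (Fu 1 (Fu 2 (Fu 3 (Fu 4 (Fu 5 (Fo 6 (Fo 7
    (Fo 8 (Dr [1,3,2,4,5,6,7,8,9]))))))))), Fu 0 (Fu 1 (Fu 2 (Fu 3 (Fu 4 (Fu 5 (Fo 7 (Fo 8 (Fo 9
    (Hi 6))))))))), Fu 0 (Fu 1 (Fu 2 (Fu 3 (Fu 4 (Fu 5 (Fo 8 (Fo 9 (Hi 6)))))))), Fu 0 (Fu 1 (Fu 2
    (Fu 3 (Fu 4 (Fu 5 (Fo 8 (Fo 9 (Hi 6)))))))), Fu 0 (Fu 1 (Fu 2 (Fu 3 (Fu 4 (Fu 5 (Fo 8 (Fo 9
    (Hi 6)))))))), Fu 0 (Fu 1 (Fu 2 (Fu 3 (Fu 4 (Fu 5 (Fo 9 (To (Dr [0,6,9,7,4,1,5,2,8])))))))),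
    Fu 0 (Fu 1 (Fu 2 (Fu 3 (Fu 4 (Fu 5 (Fo 9 (To (Dr [1,3,2,5,4,7,9,6,8])))))))), Fu 0 (Fu 1 (Fu 2
    (Fu 3 (Fu 4 (Fu 5 (Fo 9 (To (Dr [1,4,2,3,5,8,9,6,7])))))))), Fu 0 (Fu 1 (Fu 2 (Fu 3 (Fu 4 (Fu
    5 (Fo 9 (To (Dr [0,5,2,4,1,8,9,6,7])))))))), Fu 0 (Fu 1 (Fu 2 (Fu 3 (Fu 4 (Fu 5 (Fo 7 (Fo 9
    (To (Dr [1,3,2,4,5,6,7,8,9]))))))))), Fu 0 (Fu 1 (Fu 2 (Fu 3 (Fu 4 (Fu 5 (Fo 9 (To (Dr
    [1,3,2,4,5,8,9,6,7])))))))), Fu 0 (Fu 1 (Fu 2 (Fu 3 (Fu 4 (Fu 5 (Fo 9 (To (Co 0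
    [0,1,2,3,4,5,6,7,8,9])))))))), Hi 0, Hi 0, Hi 0, Hi 0, Hi 0]"
  by code_simp

text \<open>Labels 6 and 7 are two nonadjacent vertices of a 5-regular graph. Removing both takes
  away 10 of the 20 edges, and the pair (6,7) is excluded from the start.\<close>

lemma cert_regular_8:
  "list_all2 (\<lambda>(r, es). chk 8 2 20 (\<lambda>_. 5) (\<lambda>_. 5) [] es (removeAll (6,7)
    (pairs 8))) (small_seeds 6 10) [Br 0 6 (Br 0 1 (Fu 0 (Fo 7 (Fu 1 (Fo 2 (Fo 6 (To (Dr
    [5,0,1,7,2,6]))))))) (Br 0 2 (Fu 0 (Fo 7 (Fu 2 (Fo 6 (To (Dr [5,0,2,7,1,6])))))) (Fo 0 (Br 1 6
    (Br 1 2 (Fu 1 (Fo 7 (Fu 2 (Fo 6 (To (Dr [5,0,6,1,2,7])))))) (Fo 1 (Fo 2 (Br 3 4 (Br 3 5 (Fu 3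
    (Fo 6 (Fo 7 (Hi 4)))) (Dr [1,3,2,6,5,7])) (Dr [1,3,2,6,4,7]))))) (Dr [5,0,6,2,1,7]))))) (Fo 6
    (Br 0 1 (Fu 1 (Fo 7 (To (Dr [5,0,1,6,2,7])))) (Dr [4,0,5,6,1,7]))), Br 0 6 (Fu 0 (Fo 7 (Fu 1
    (Fu 2 (Fu 3 (Fu 4 (Lo 5))))))) (Fo 6 (Fu 1 (Fu 2 (Fu 3 (Fu 4 (Lo 5))))))]"
  by code_simp

text \<open>Deleting two nonadjacent vertices of a 4-regular graph with 20 edges leaves 12 edges on
  8 vertices, the other use of the 12-edge case.\<close>

lemma cert_regular_10:
  "list_all2 (\<lambda>(r, es). chk 10 2 20 (\<lambda>_. 4) (\<lambda>_. 4) [] es (removeAll (8,9)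
    (pairs 10))) (small_seeds 8 12) [Br 0 1 (Fu 0 (Fu 1 (Br 2 6 (Fu 2 (Dr [5,0,1,2,6,8,7,9])) (Br
    2 8 (Fu 2 (Dr [5,0,1,2,8,6,9,7])) (Dr [5,0,1,2,7,8,6,9]))))) (Br 3 4 (Fu 3 (Fu 4 (Br 5 6 (Fu 5
    (Dr [2,3,4,5,6,8,7,9])) (Br 5 8 (Fu 5 (Dr [2,3,4,5,8,6,9,7])) (Dr [2,3,4,5,7,8,6,9]))))) (Br 0
    2 (Fu 0 (Fu 2 (Br 1 6 (Fu 1 (Dr [5,0,2,1,6,8,7,9])) (Br 1 8 (Fu 1 (Dr [5,0,2,1,8,6,9,7])) (Dr
    [5,0,2,1,7,8,6,9]))))) (Br 3 5 (Fu 3 (Fu 5 (Br 0 6 (Fu 0 (Dr [4,0,3,5,6,8,7,9])) (Br 0 8 (Fu 0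
    (Dr [4,0,3,5,6,8,7,9])) (Dr [0,3,5,4,6,8,7,9]))))) (Br 1 2 (Fu 1 (Fu 2 (Br 0 6 (Fu 0 (Dr
    [5,0,6,8,7,9,1,2])) (Br 0 8 (Fu 0 (Dr [5,0,8,6,9,7,1,2])) (Dr [5,0,7,8,6,9,1,2]))))) (Br 4 5
    (Fu 4 (Fu 5 (Br 0 6 (Fu 0 (Dr [3,0,4,5,6,8,7,9])) (Br 0 8 (Fu 0 (Dr [3,0,4,5,6,8,7,9])) (Dr
    [0,3,6,8,7,9,4,5]))))) (Br 0 6 (Fu 0 (Br 1 6 (Fu 1 (Br 2 6 (Fu 2 (Dr [4,0,5,1,2,8,7,9])) (Br 2
    8 (Fu 2 (Dr [5,0,6,1,2,8,7,9])) (Dr [5,0,6,1,8,7,2,9])))) (Br 2 6 (Fu 2 (Br 1 8 (Fu 1 (Dr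
    [5,0,6,2,1,8,7,9])) (Dr [5,0,6,2,8,7,1,9]))) (Br 3 6 (Fu 3 (Br 1 8 (Fu 1 (Dr
    [6,0,3,1,8,2,7,9])) (Br 2 8 (Fu 2 (Dr [6,0,3,1,9,7,8,2])) (Fo 8 (Fu 4 (Fu 5 (Fo 9 (Fu 1 (Fu 2
    (Fu 6 (Lo 7))))))))))) (Br 4 6 (Fu 4 (Br 1 8 (Fu 1 (Dr [6,0,4,1,8,2,7,9])) (Br 2 8 (Fu 2 (Dr
    [6,0,4,1,9,7,8,2])) (Fo 8 (Fu 3 (Fu 5 (Fo 9 (Fu 1 (Fu 2 (Fu 6 (Lo 7))))))))))) (Br 5 6 (Fu 5
    (Br 1 8 (Fu 1 (Dr [6,0,5,1,8,2,7,9])) (Br 2 8 (Fu 2 (Dr [6,0,5,1,9,7,8,2])) (Fo 8 (Fu 3 (Fu 4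
    (Fo 9 (Fu 1 (Fu 2 (Fu 6 (Lo 7))))))))))) (Fo 6 (Br 1 7 (Fu 1 (Br 2 8 (Fu 2 (Dr
    [5,0,6,8,2,1,7,9])) (Dr [5,0,6,8,7,1,2,9]))) (Br 1 8 (Fu 1 (Br 2 8 (Fu 2 (Dr
    [5,0,6,8,1,2,7,9])) (Dr [5,0,6,8,1,7,2,9]))) (Fo 1 (Br 2 8 (Fu 2 (Dr [5,0,6,8,2,7,9,1])) (Dr
    [5,0,6,8,7,2,9,1])))))))))))) (Br 1 6 (Fu 1 (Br 2 6 (Fu 2 (Br 0 8 (Fu 0 (Dr
    [5,0,8,6,1,2,9,7])) (Dr [5,0,7,8,6,1,2,9]))) (Br 3 6 (Fu 3 (Br 0 8 (Fu 0 (Dr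
    [6,1,3,0,8,2,7,9])) (Br 2 8 (Fu 2 (Dr [6,1,3,0,9,7,8,2])) (Fo 8 (Fu 4 (Fu 5 (Fo 9 (Fu 0 (Fu 2
    (Fu 6 (Lo 7))))))))))) (Br 4 6 (Fu 4 (Br 0 8 (Fu 0 (Dr [6,1,4,0,8,2,7,9])) (Br 2 8 (Fu 2 (Dr
    [6,1,4,0,9,7,8,2])) (Fo 8 (Fu 3 (Fu 5 (Fo 9 (Fu 0 (Fu 2 (Fu 6 (Lo 7))))))))))) (Br 5 6 (Fu 5
    (Br 0 8 (Fu 0 (Dr [6,1,5,0,8,2,7,9])) (Br 2 8 (Fu 2 (Dr [6,1,5,0,9,7,8,2])) (Fo 8 (Fu 3 (Fu 4
    (Fo 9 (Fu 0 (Fu 2 (Fu 6 (Lo 7))))))))))) (Fo 6 (Br 0 7 (Fu 0 (Br 2 8 (Fu 2 (Dr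
    [5,0,7,8,2,1,6,9])) (Dr [5,0,7,2,9,6,1,8]))) (Br 0 8 (Fu 0 (Br 2 8 (Fu 2 (Dr
    [5,0,8,2,1,6,9,7])) (Dr [5,0,8,6,1,9,2,7]))) (Fo 0 (Br 2 8 (Fu 2 (Dr [5,0,9,6,1,2,8,7])) (Dr
    [5,0,9,2,7,8,6,1]))))))))))) (Br 2 6 (Fu 2 (Br 3 6 (Fu 3 (Br 0 8 (Fu 0 (Dr [6,2,3,0,8,1,7,9]))
    (Br 1 8 (Fu 1 (Dr [6,2,3,0,9,7,8,1])) (Fo 8 (Fu 4 (Fu 5 (Fo 9 (Fu 0 (Fu 1 (Fu 6 (Lo
    7))))))))))) (Br 4 6 (Fu 4 (Br 0 8 (Fu 0 (Dr [6,2,4,0,8,1,7,9])) (Br 1 8 (Fu 1 (Dr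
    [6,2,4,0,9,7,8,1])) (Fo 8 (Fu 3 (Fu 5 (Fo 9 (Fu 0 (Fu 1 (Fu 6 (Lo 7))))))))))) (Br 5 6 (Fu 5
    (Br 0 8 (Fu 0 (Dr [6,2,5,0,8,1,7,9])) (Br 1 8 (Fu 1 (Dr [6,2,5,0,9,7,8,1])) (Fo 8 (Fu 3 (Fu 4
    (Fo 9 (Fu 0 (Fu 1 (Fu 6 (Lo 7))))))))))) (Fo 6 (Br 0 7 (Fu 0 (Br 1 8 (Fu 1 (Dr
    [5,0,7,6,8,1,2,9])) (Dr [5,0,7,1,9,6,2,8]))) (Br 0 8 (Fu 0 (Br 1 8 (Fu 1 (Dr
    [5,0,8,1,2,6,9,7])) (Dr [5,0,8,6,2,9,1,7]))) (Fo 0 (Br 1 8 (Fu 1 (Dr [5,0,9,6,2,1,8,7])) (Dr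
    [5,0,9,1,7,8,6,2])))))))))) (Br 3 6 (Fu 3 (Br 4 6 (Fu 4 (Br 0 8 (Fu 0 (Dr [6,3,0,4,5,8,7,9]))
    (Br 1 8 (Fu 1 (Dr [0,3,1,4,5,9,7,8])) (Fo 8 (Fu 2 (Fu 5 (Fo 9 (Fu 0 (Fu 1 (Fu 6 (Lo
    7))))))))))) (Br 6 8 (Br 6 9 (Br 5 6 (Fu 5 (Fu 6 (Br 4 8 (Fu 4 (Dr [2,3,6,5,4,8,7,9])) (Dr
    [2,3,6,5,8,7,4,9])))) (Fo 6 (Br 0 7 (Fu 0 (Br 1 7 (Fu 1 (Br 2 7 (Fu 2 (Fu 7 (Lo 8))) (Dr
    [5,0,7,1,8,2,6,9]))) (Br 2 8 (Fu 2 (Dr [5,0,3,2,1,9,6,7])) (Dr [5,0,7,2,9,1,6,8])))) (Br 4 8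
    (Fu 4 (Dr [0,3,6,7,8,4,5,9])) (Br 5 9 (Fu 5 (Dr [0,3,6,7,8,4,9,5])) (Dr
    [0,3,6,7,8,5,4,9])))))) (Fo 6 (Fu 5 (Dr [2,3,6,5,7,9,4,8])))) (Fo 6 (Fu 5 (Dr
    [2,3,6,5,7,8,4,9])))))) (Br 6 8 (Br 6 9 (Br 4 6 (Fu 4 (Br 5 6 (Fu 5 (Fu 6 (Br 3 8 (Fu 3 (Dr
    [2,3,8,6,4,5,9,7])) (Dr [2,3,7,8,6,4,5,9])))) (Fo 6 (Br 0 7 (Fu 0 (Br 1 7 (Fu 1 (Br 2 7 (Fu 2
    (Fu 7 (Lo 8))) (Dr [5,0,7,1,8,2,6,9]))) (Br 2 8 (Fu 2 (Dr [5,0,4,2,1,9,6,7])) (Dr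
    [5,0,7,2,9,1,6,8])))) (Br 3 8 (Fu 3 (Dr [0,3,8,5,7,6,9,4])) (Br 5 9 (Fu 5 (Dr
    [0,3,7,6,8,4,5,9])) (Dr [0,3,7,5,8,6,4,9]))))))) (Fo 6 (Fu 5 (Br 0 7 (Fu 0 (Br 1 7 (Fu 1 (Br 2
    7 (Fu 2 (Fu 7 (Lo 8))) (Dr [4,0,7,1,8,2,6,9]))) (Br 2 8 (Fu 2 (Dr [4,0,5,2,1,9,6,7])) (Dr
    [4,0,7,2,9,1,6,8])))) (Br 3 8 (Fu 3 (Dr [0,3,8,4,7,6,9,5])) (Br 4 9 (Fu 4 (Dr
    [0,3,7,6,8,5,4,9])) (Dr [0,3,7,4,8,6,5,9]))))))) (Fo 6 (Fu 4 (Fu 5 (Dr [2,3,8,6,4,5,7,9])))))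
    (Fo 6 (Fu 4 (Fu 5 (Dr [2,3,8,7,6,4,5,9])))))))))))))), Br 0 1 (Fu 0 (Fu 1 (Br 2 6 (Fu 2 (Dr
    [3,1,0,6,2,8,7,9])) (Br 2 8 (Fu 2 (Dr [3,1,0,6,8,2,7,9])) (Dr [3,1,0,6,8,7,2,9]))))) (Br 3 4
    (Fu 3 (Fu 4 (Br 0 2 (Fu 0 (Fu 2 (Fo 8 (Fo 9 (To (Hi 1)))))) (Br 0 8 (Fu 0 (Dr
    [6,0,4,3,5,8,7,9])) (Br 5 8 (Fu 5 (Dr [0,4,3,6,8,5,7,9])) (Fo 8 (Fu 1 (Fu 2 (Fo 9 (Fu 0 (Fu 5
    (Fu 6 (Lo 7))))))))))))) (Br 0 2 (Fu 0 (Fu 2 (Br 1 6 (Fu 1 (Dr [3,1,6,0,2,8,7,9])) (Br 1 8 (Fu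
    1 (Dr [3,1,8,6,0,2,9,7])) (Dr [3,1,7,8,6,0,2,9]))))) (Br 3 5 (Fu 3 (Fu 5 (Br 0 8 (Fu 0 (Dr
    [6,0,4,9,7,8,3,5])) (Br 4 8 (Fu 4 (Dr [0,4,8,6,3,5,9,7])) (Fo 8 (Fu 1 (Fu 2 (Fo 9 (Fu 0 (Fu 4
    (Fu 6 (Lo 7)))))))))))) (Br 1 2 (Fu 1 (Fu 2 (Br 0 3 (Fu 0 (Fu 3 (Fo 8 (Fo 9 (To (Hi 4))))))
    (Br 0 8 (Fu 0 (Dr [3,1,2,0,6,8,7,9])) (Dr [3,1,2,6,8,7,0,9]))))) (Br 4 5 (Fu 4 (Fu 5 (Br 0 3
    (Fu 0 (Fu 3 (Fo 8 (Fo 9 (To (Hi 1)))))) (Br 0 8 (Fu 0 (Dr [6,0,4,5,3,8,7,9])) (Dr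
    [0,4,5,6,7,8,3,9]))))) (Br 0 3 (Fu 0 (Fu 3 (Br 1 6 (Fu 1 (Dr [4,0,3,1,5,8,7,9])) (Br 1 8 (Fu 1
    (Dr [4,0,3,1,5,9,7,8])) (Br 2 8 (Fu 2 (Dr [6,0,3,1,9,7,8,2])) (Fo 8 (Fu 4 (Fu 5 (Fo 9 (Fu 1
    (Fu 2 (Fu 6 (Lo 7))))))))))))) (Br 1 6 (Fu 1 (Br 2 6 (Fu 2 (Fu 6 (Dr [4,1,5,8,7,9,2,6]))) (Br
    4 6 (Fu 4 (Fu 6 (Dr [3,1,4,6,5,8,7,9]))) (Br 5 6 (Fu 5 (Fu 6 (Dr [3,1,4,8,7,9,5,6]))) (Br 0 7
    (Fu 0 (Br 2 8 (Fu 2 (Dr [3,1,6,8,2,7,0,9])) (Dr [3,1,6,8,7,0,9,2]))) (Br 0 8 (Fu 0 (Br 2 8 (Fu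
    2 (Dr [5,0,6,1,9,7,8,2])) (Dr [5,0,6,1,9,2,7,8]))) (Fo 0 (Br 2 8 (Fu 2 (Dr [5,0,6,1,2,8,7,9]))
    (Dr [5,0,6,1,8,7,2,9]))))))))) (Br 2 6 (Fu 2 (Br 4 6 (Fu 4 (Fu 6 (Dr [3,2,4,6,5,8,7,9]))) (Br
    5 6 (Fu 5 (Fu 6 (Dr [3,2,4,8,7,9,5,6]))) (Br 0 7 (Fu 0 (Br 1 8 (Fu 1 (Dr [3,1,8,6,0,7,9,2]))
    (Dr [3,1,7,0,8,6,2,9]))) (Br 0 8 (Fu 0 (Br 1 8 (Fu 1 (Dr [5,0,6,2,9,7,8,1])) (Dr
    [5,0,6,2,9,1,7,8]))) (Fo 0 (Br 1 8 (Fu 1 (Dr [5,0,6,2,1,8,7,9])) (Dr [5,0,6,2,8,7,1,9]))))))))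
    (Br 4 6 (Fu 4 (Br 5 6 (Fu 5 (Fu 6 (Dr [2,3,6,4,5,8,7,9]))) (Br 0 7 (Fu 0 (Br 5 8 (Fu 5 (Dr
    [6,0,4,5,8,3,7,9])) (Dr [2,3,6,8,4,5,0,9]))) (Br 3 8 (Fu 3 (Dr [6,0,4,3,8,5,7,9])) (Dr
    [6,0,4,8,5,7,3,9]))))) (Br 5 6 (Fu 5 (Br 0 7 (Fu 0 (Br 4 8 (Fu 4 (Dr [6,0,4,8,3,9,7,5])) (Dr
    [2,3,6,8,5,4,0,9]))) (Br 3 8 (Fu 3 (Dr [6,0,5,3,8,4,7,9])) (Dr [6,0,5,8,4,7,3,9])))) (Br 0 7
    (Fu 0 (Br 1 7 (Fu 1 (Br 2 8 (Fu 2 (Dr [3,1,5,0,9,6,8,2])) (Dr [3,1,5,0,8,6,9,2]))) (Br 1 8 (Fu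
    1 (Br 2 8 (Fu 2 (Dr [3,1,8,2,6,7,0,9])) (Dr [3,1,5,0,8,6,9,2]))) (Fo 1 (Br 2 8 (Fu 2 (Dr
    [3,1,9,6,7,0,8,2])) (Dr [3,1,9,2,7,6,0,8])))))) (Br 0 8 (Fu 0 (Br 1 7 (Fu 1 (Br 2 8 (Fu 2 (Dr
    [5,0,6,8,2,1,7,9])) (Dr [3,1,5,0,8,6,9,2]))) (Br 4 8 (Fu 4 (Dr [8,0,4,1,3,7,9,5])) (Br 5 9 (Fu
    5 (Br 1 8 (Fu 1 (Dr [8,0,5,1,2,7,9,6])) (Dr [0,4,1,5,2,7,8,6]))) (Dr [2,3,6,0,9,4,5,8])))))
    (Fo 0 (Br 1 7 (Fu 1 (Br 2 8 (Fu 2 (Dr [5,0,6,8,2,1,7,9])) (Dr [3,1,5,0,8,6,9,2]))) (Br 4 9 (Fu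
    4 (Dr [9,0,4,1,3,7,8,5])) (Br 5 8 (Fu 5 (Br 1 8 (Fu 1 (Dr [0,4,1,5,2,7,9,6])) (Dr
    [9,0,5,1,2,7,8,6]))) (Dr [2,3,6,0,8,4,5,9]))))))))))))))))), Br 0 1 (Fu 0 (Fu 1 (Br 3 4 (Fu 3
    (Fu 4 (Fo 8 (Fo 9 (Hi 2))))) (Br 3 5 (Fu 3 (Fu 5 (Fo 8 (Fo 9 (Hi 2))))) (Br 4 5 (Fu 4 (Fu 5
    (Fo 8 (Fo 9 (Hi 2))))) (Br 2 6 (Fu 2 (Br 3 8 (Fu 3 (Fo 9 (Fu 4 (Fu 5 (Fu 6 (Fo 7 (Lo 8)))))))
    (Dr [4,1,0,7,3,2,9,8]))) (Br 4 8 (Fu 4 (Dr [5,0,1,3,6,9,2,4])) (Br 3 8 (Fu 3 (Dr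
    [2,3,1,0,8,7,4,9])) (Fo 8 (Fu 2 (Fu 5 (Fo 9 (To (Dr [9,3,1,4,7,8,5,6])))))))))))))) (Br 3 4
    (Fu 3 (Fu 4 (Br 0 8 (Fu 0 (Dr [2,3,4,7,9,5,0,8])) (Dr [1,3,4,7,8,5,0,9])))) (Br 0 2 (Fu 0 (Fu
    2 (Br 3 5 (Fu 3 (Fu 5 (Fo 8 (Fo 9 (Hi 1))))) (Br 4 5 (Fu 4 (Fu 5 (Fo 8 (Fo 9 (Hi 1))))) (Br 1
    6 (Fu 1 (Br 3 8 (Fu 3 (Fo 9 (Fu 4 (Fu 5 (Fu 6 (Fo 7 (Lo 8))))))) (Dr [4,1,3,2,0,7,8,9]))) (Br
    4 8 (Fu 4 (Dr [5,0,2,3,6,9,1,4])) (Br 3 8 (Fu 3 (Dr [1,3,2,4,9,7,0,8])) (Fo 8 (Fu 1 (Fu 5 (Fo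
    9 (To (Dr [9,3,2,4,7,8,5,6]))))))))))))) (Br 3 5 (Fu 3 (Fu 5 (Br 0 4 (Fu 0 (Fu 4 (Fo 8 (Fo 9
    (Hi 1))))) (Br 0 8 (Fu 0 (Dr [6,0,5,3,7,8,4,9])) (Dr [6,0,5,3,7,8,4,9]))))) (Br 1 2 (Fu 1 (Fu
    2 (Br 0 3 (Fu 0 (Fu 3 (Fo 8 (Fo 9 (Hi 4))))) (Br 0 8 (Fu 0 (Dr [4,1,2,6,9,7,0,8])) (Dr
    [3,1,2,6,8,7,0,9]))))) (Br 4 5 (Fu 4 (Fu 5 (Br 0 3 (Fu 0 (Fu 3 (Fo 8 (Fo 9 (Hi 1))))) (Br 0 8
    (Fu 0 (Dr [7,0,5,4,6,8,3,9])) (Dr [7,0,5,4,6,8,3,9]))))) (Br 0 3 (Fu 0 (Fu 3 (Br 5 8 (Fu 5 (Dr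
    [6,0,3,5,8,4,7,9])) (Dr [1,3,0,5,2,9,4,8])))) (Br 0 4 (Fu 0 (Fu 4 (Br 5 8 (Fu 5 (Dr
    [7,0,4,5,8,3,6,9])) (Dr [1,3,2,8,4,0,5,9])))) (Br 1 6 (Fu 1 (Br 2 6 (Fu 2 (Fu 6 (Dr
    [4,1,6,0,8,7,9,2]))) (Br 4 8 (Fu 4 (Dr [5,0,6,1,3,9,2,4])) (Br 3 7 (Fu 3 (Dr
    [2,3,1,4,9,0,5,8])) (Dr [6,0,7,2,4,1,3,8]))))) (Br 2 6 (Fu 2 (Br 4 8 (Fu 4 (Dr
    [5,0,6,2,3,9,1,4])) (Br 3 7 (Fu 3 (Dr [1,3,2,4,9,0,5,8])) (Dr [6,0,7,1,4,2,3,8])))) (Br 5 6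
    (Fu 5 (Br 4 6 (Fu 4 (Fu 6 (Br 0 8 (Fu 0 (Fo 9 (Fu 1 (Fu 2 (Fu 3 (Fo 7 (Lo 8))))))) (Dr
    [7,0,5,6,4,3,8,9])))) (Br 0 8 (Fu 0 (Br 4 8 (Fu 4 (Dr [2,3,6,9,5,0,8,4])) (Dr
    [2,3,6,9,4,5,0,8]))) (Fo 0 (Br 4 8 (Fu 4 (Dr [2,3,6,8,4,5,0,9])) (Dr [2,3,6,8,5,0,9,4]))))))
    (Br 4 8 (Fu 4 (Dr [8,0,5,2,4,3,9,6])) (Br 3 9 (Fu 3 (Br 0 8 (Fu 0 (Dr [2,3,9,4,7,0,5,8])) (Dr
    [2,3,9,4,7,0,5,8]))) (Dr [2,3,6,4,9,0,5,8]))))))))))))), Br 0 1 (Fu 0 (Fu 1 (Br 2 6 (Fu 2 (Dr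
    [3,1,0,7,8,6,2,9])) (Br 2 8 (Fu 2 (Dr [3,1,0,7,8,2,6,9])) (Dr [3,1,0,7,2,9,6,8]))))) (Br 3 4
    (Fu 3 (Fu 4 (Br 0 2 (Fu 0 (Fu 2 (Fo 8 (Fo 9 (Hi 1))))) (Br 5 6 (Fu 5 (Dr [0,4,3,6,5,8,7,9]))
    (Br 5 8 (Fu 5 (Dr [0,4,3,6,8,5,7,9])) (Dr [0,4,3,6,8,7,5,9])))))) (Br 0 2 (Fu 0 (Fu 2 (Br 1 6
    (Fu 1 (Dr [3,1,6,8,7,0,2,9])) (Br 1 8 (Fu 1 (Dr [3,1,8,6,9,7,0,2])) (Dr [3,1,7,0,2,8,6,9])))))
    (Br 3 5 (Fu 3 (Fu 5 (Br 4 6 (Fu 4 (Dr [0,4,6,3,5,8,7,9])) (Br 4 8 (Fu 4 (Dr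
    [0,4,8,6,3,5,9,7])) (Dr [0,4,7,8,6,3,5,9]))))) (Br 1 2 (Fu 1 (Fu 2 (Br 0 3 (Fu 0 (Fu 3 (Fo 8
    (Fo 9 (Hi 4))))) (Br 0 8 (Fu 0 (Dr [3,1,2,0,7,8,6,9])) (Dr [3,1,2,6,8,7,0,9]))))) (Br 4 5 (Fu
    4 (Fu 5 (Br 0 3 (Fu 0 (Fu 3 (Fo 8 (Fo 9 (Hi 1))))) (Br 0 8 (Fu 0 (Dr [7,0,4,5,3,8,6,9])) (Dr
    [0,4,5,6,7,8,3,9]))))) (Br 0 3 (Fu 0 (Fu 3 (Br 1 6 (Fu 1 (Br 2 8 (Fu 2 (Fo 9 (Fu 4 (Fu 5 (Fu 6
    (Fo 7 (Lo 8))))))) (Dr [6,1,3,0,7,2,9,8]))) (Br 2 6 (Fu 2 (Br 1 8 (Fu 1 (Fo 9 (Fu 4 (Fu 5 (Fu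
    6 (Fo 7 (Lo 8))))))) (Dr [6,2,3,0,7,1,9,8]))) (Br 4 6 (Fu 4 (Br 1 8 (Fu 1 (Fo 9 (Fu 2 (Fu 5
    (Fu 6 (Fo 7 (Lo 8))))))) (Dr [1,3,0,4,5,7,8,9]))) (Br 6 8 (Br 5 6 (Fu 5 (Fu 6 (Fo 9 (Fu 1 (Fu
    2 (Fu 4 (Fo 7 (Lo 8)))))))) (Fo 6 (Br 1 7 (Fu 1 (Br 2 7 (Fu 2 (Fu 7 (Lo 8))) (Dr
    [5,0,7,1,8,2,6,9]))) (Br 2 8 (Fu 2 (Dr [5,0,3,2,1,9,6,7])) (Dr [5,0,7,2,9,1,6,8]))))) (Fo 6
    (Fu 5 (Fo 8 (Fu 1 (Fu 2 (Fu 4 (Fo 7 (Lo 9)))))))))))))) (Br 1 6 (Fu 1 (Br 0 6 (Fu 0 (Fu 6 (Dr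
    [4,0,5,8,2,9,1,6]))) (Br 2 6 (Fu 2 (Fu 6 (Dr [5,0,8,7,6,1,2,9]))) (Br 4 6 (Fu 4 (Fu 6 (Br 0 8
    (Fu 0 (Fo 9 (Fu 2 (Fu 3 (Fu 5 (Fo 7 (Lo 8))))))) (Dr [1,3,6,4,0,9,5,8])))) (Br 5 6 (Fu 5 (Fu 6
    (Br 0 8 (Fu 0 (Fo 9 (Fu 2 (Fu 3 (Fu 4 (Fo 7 (Lo 8))))))) (Dr [1,3,6,5,0,9,4,8])))) (Br 0 8 (Fu
    0 (Br 6 8 (Fu 6 (Dr [3,1,5,9,2,8,0,6])) (Dr [4,0,5,1,6,9,2,8]))) (Fo 0 (Br 6 8 (Fu 6 (Dr
    [4,0,5,1,6,8,2,9])) (Dr [3,1,5,8,2,9,0,6]))))))))) (Br 2 6 (Fu 2 (Br 0 6 (Fu 0 (Fu 6 (Dr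
    [4,0,5,8,1,9,2,6]))) (Br 4 6 (Fu 4 (Fu 6 (Br 0 8 (Fu 0 (Fo 9 (Fu 1 (Fu 3 (Fu 5 (Fo 7 (Lo
    8))))))) (Dr [2,3,6,4,0,9,5,8])))) (Br 5 6 (Fu 5 (Fu 6 (Br 0 8 (Fu 0 (Fo 9 (Fu 1 (Fu 3 (Fu 4
    (Fo 7 (Lo 8))))))) (Dr [2,3,6,5,0,9,4,8])))) (Br 0 8 (Fu 0 (Br 6 8 (Fu 6 (Dr
    [3,1,5,8,0,6,2,9])) (Dr [4,0,5,2,6,9,1,8]))) (Fo 0 (Br 6 8 (Fu 6 (Dr [4,0,5,2,6,8,1,9])) (Dr
    [3,1,5,8,2,6,0,9])))))))) (Br 4 6 (Fu 4 (Br 5 6 (Fu 5 (Fu 6 (Br 0 8 (Fu 0 (Fo 9 (Fu 1 (Fu 2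
    (Fu 3 (Fo 7 (Lo 8))))))) (Dr [7,0,4,6,3,5,9,8])))) (Br 0 6 (Fu 0 (Fu 6 (Br 1 7 (Fu 1 (Fo 8 (Fo
    9 (Hi 2)))) (Dr [7,0,5,1,4,6,3,9])))) (Br 0 8 (Fu 0 (Br 6 8 (Fu 6 (Dr [1,3,2,9,5,0,4,6])) (Dr
    [3,1,5,8,0,2,9,6]))) (Fo 0 (Br 6 8 (Fu 6 (Dr [3,1,5,8,6,2,0,9])) (Dr [1,3,2,8,5,0,4,6])))))))
    (Br 5 6 (Fu 5 (Br 0 6 (Fu 0 (Fu 6 (Br 1 7 (Fu 1 (Fo 8 (Fo 9 (Hi 2)))) (Dr
    [7,0,4,1,5,6,3,9])))) (Br 0 8 (Fu 0 (Br 6 8 (Fu 6 (Dr [1,3,2,9,4,0,5,6])) (Dr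
    [3,1,4,8,0,2,9,6]))) (Fo 0 (Br 6 8 (Fu 6 (Dr [3,1,4,8,6,2,0,9])) (Dr [1,3,2,8,4,0,5,6]))))))
    (Br 0 6 (Fu 0 (Br 6 8 (Fu 6 (Br 1 8 (Fu 1 (Dr [5,0,6,8,1,2,7,9])) (Dr [4,0,5,1,9,2,8,6]))) (Fo
    6 (Br 1 9 (Fu 1 (Dr [5,0,6,9,1,2,7,8])) (Dr [4,0,5,1,8,2,9,6]))))) (Fo 6 (Br 0 8 (Fu 0 (Br 4 9
    (Fu 4 (Br 5 7 (Fu 5 (Dr [2,3,6,8,0,9,4,5])) (Dr [8,0,5,4,2,3,6,7]))) (Dr [9,1,3,6,2,4,0,5])))
    (Fo 0 (Br 4 8 (Fu 4 (Br 5 7 (Fu 5 (Dr [2,3,6,8,4,0,9,5])) (Dr [9,0,5,4,2,3,6,7]))) (Dr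
    [8,1,3,6,2,4,0,5])))))))))))))))), Br 0 1 (Fu 0 (Fu 1 (Br 3 4 (Fu 3 (Fu 4 (Fo 8 (Fo 9 (Hi
    2))))) (Br 3 5 (Fu 3 (Fu 5 (Fo 8 (Fo 9 (Hi 2))))) (Br 4 5 (Fu 4 (Fu 5 (Fo 8 (Fo 9 (Hi 2)))))
    (Br 2 6 (Fu 2 (Br 3 8 (Fu 3 (Fo 9 (Fu 4 (Fu 5 (Fu 6 (Fo 7 (Lo 8))))))) (Dr
    [4,0,1,3,2,9,7,8]))) (Br 5 7 (Fu 5 (Dr [2,3,1,5,8,4,6,9])) (Br 5 8 (Fu 5 (Dr
    [0,1,3,2,5,4,9,6])) (Br 2 7 (Fu 2 (Fo 8 (Fu 3 (Fu 4 (Fu 7 (Lo 9)))))) (Dr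
    [1,0,4,2,5,3,8,7])))))))))) (Br 3 4 (Fu 3 (Fu 4 (Br 0 2 (Fu 0 (Fu 2 (Fo 8 (Fo 9 (Hi 1))))) (Br
    1 2 (Fu 1 (Fu 2 (Fo 8 (Fo 9 (Hi 0))))) (Br 2 6 (Fu 2 (Br 0 8 (Fu 0 (Fo 9 (Fu 1 (Fu 5 (Fu 6 (Fo
    7 (Lo 8))))))) (Dr [7,0,4,2,3,1,8,9]))) (Br 5 6 (Fu 5 (Br 0 8 (Fu 0 (Fo 9 (Fu 1 (Fu 2 (Fu 6
    (Fo 7 (Lo 8))))))) (Dr [1,3,4,0,5,9,7,8]))) (Br 2 8 (Fu 2 (Dr [0,4,2,3,1,5,9,6])) (Dr
    [0,4,2,3,1,5,8,6])))))))) (Br 0 2 (Fu 0 (Fu 2 (Br 1 4 (Fu 1 (Fu 4 (Fo 8 (Fo 9 (Hi 3))))) (Br 1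
    8 (Fu 1 (Dr [4,0,2,6,8,1,7,9])) (Dr [3,1,7,4,0,8,2,9]))))) (Br 3 5 (Fu 3 (Fu 5 (Br 0 8 (Fu 0
    (Dr [6,0,4,9,7,8,3,5])) (Br 4 8 (Fu 4 (Dr [0,4,7,9,6,3,5,8])) (Fo 8 (Fu 1 (Fu 2 (Fo 9 (To (Dr
    [2,3,5,4,7,8,9,6])))))))))) (Br 1 2 (Fu 1 (Fu 2 (Br 0 3 (Fu 0 (Fu 3 (Fo 8 (Fo 9 (Hi 4))))) (Br
    0 8 (Fu 0 (Dr [4,0,6,8,7,1,2,9])) (Dr [3,1,2,4,8,6,0,9]))))) (Br 4 5 (Fu 4 (Fu 5 (Br 1 8 (Fu 1
    (Dr [7,1,3,9,6,8,4,5])) (Br 0 8 (Fu 0 (Dr [7,1,5,0,4,8,3,9])) (Fo 8 (Fu 2 (Fu 3 (Fo 9 (To (Dr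
    [2,3,6,8,7,4,5,9])))))))))) (Br 0 3 (Fu 0 (Fu 3 (Br 1 4 (Fu 1 (Fu 4 (Fo 8 (Fo 9 (Hi 2))))) (Br
    2 6 (Fu 2 (Dr [4,0,3,1,8,7,9,2])) (Br 2 8 (Fu 2 (Dr [4,0,3,1,9,7,8,2])) (Br 1 8 (Fu 1 (Dr
    [6,0,3,1,8,7,2,9])) (Dr [6,0,3,1,9,2,4,8]))))))) (Br 1 4 (Fu 1 (Fu 4 (Br 2 7 (Fu 2 (Dr
    [3,1,4,0,8,6,9,2])) (Br 2 8 (Fu 2 (Dr [3,1,4,0,9,6,8,2])) (Br 0 8 (Fu 0 (Dr
    [6,0,4,1,2,9,7,8])) (Dr [7,0,4,1,3,2,9,8])))))) (Br 2 6 (Fu 2 (Br 4 6 (Fu 4 (Fu 6 (Dr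
    [5,1,8,7,4,2,6,9]))) (Br 5 6 (Fu 5 (Fu 6 (Dr [1,5,2,4,8,7,9,6]))) (Br 1 6 (Fu 1 (Fu 6 (Br 4 8
    (Fu 4 (Fo 9 (Fu 0 (Fu 3 (Fu 5 (Fo 7 (Lo 8))))))) (Dr [5,1,6,2,4,7,8,9])))) (Br 4 8 (Fu 4 (Dr
    [9,0,5,1,3,2,4,6])) (Dr [8,0,5,1,3,2,4,6])))))) (Br 5 6 (Fu 5 (Br 1 6 (Fu 1 (Fu 6 (Dr
    [3,1,5,6,7,4,8,9]))) (Br 4 6 (Fu 4 (Fu 6 (Br 1 8 (Fu 1 (Fo 9 (Fu 0 (Fu 2 (Fu 3 (Fo 7 (Lo
    8))))))) (Dr [3,1,5,6,4,7,8,9])))) (Br 1 8 (Fu 1 (Dr [9,0,4,2,3,1,5,6])) (Dr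
    [8,0,4,2,3,1,5,6]))))) (Br 0 7 (Fu 0 (Br 1 8 (Fu 1 (Dr [3,1,8,2,4,0,6,9])) (Dr
    [6,0,4,2,9,1,3,8]))) (Br 0 8 (Fu 0 (Br 1 8 (Fu 1 (Dr [8,0,4,2,3,9,6,1])) (Dr
    [6,0,4,2,8,3,1,9]))) (Fo 0 (Br 1 8 (Fu 1 (Dr [3,1,8,2,4,0,6,9])) (Dr
    [6,0,4,2,8,3,1,9])))))))))))))), Fu 0 (Fu 1 (Fu 2 (Fu 3 (Fu 4 (Fo 5 (Fo 6 (Fo 7 (Lo 8)))))))),
    Fu 0 (Fu 1 (Fu 2 (Fu 3 (Fu 4 (Fo 6 (Fo 7 (Lo 8))))))), Fu 0 (Fu 1 (Fu 2 (Fu 3 (Fu 4 (Fo 7 (Lo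
    8)))))), Fu 0 (Fu 1 (Fu 2 (Fu 3 (Fu 4 (Fo 7 (Lo 8)))))), Fu 0 (Fu 1 (Fu 2 (Fu 3 (Fu 4 (Fo 7
    (Lo 8))))))]"
  by code_simp

text \<open>In this and the next three certificates the graph without its last vertex is known
  exactly; only the five neighbours of that vertex are open, while two further deletions are allowed
  in all.\<close>

lemma cert_extend_k44e:
  "chk 9 2 20 (\<lambda>i. if i = 8 then 5 else 3) (\<lambda>_. 5) [] (k44e) (k44e @ star 8) (Br 1
    8 (Br 2 8 (Br 3 8 (Br 5 8 (Br 6 8 (Fu 8 (Dr [3,4,0,5,8,6,7])) (Dr [3,4,8,0,5,6,7])) (Dr
    [3,4,8,0,6,5,7])) (Dr [7,0,8,4,1,3,2])) (Dr [7,0,8,1,4,2,3])) (Dr [7,0,8,2,4,1,3]))"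
  by code_simp

lemma cert_extend_p8:
  "chk 9 2 20 (\<lambda>i. if i = 8 then 5 else 3) (\<lambda>_. 5) [] (p8) (p8 @ star 8) (Fu 7 (Dr
    [8,0,5,2,3,7,6]))"
  by code_simp

lemma cert_extend_p9:
  "chk 10 2 20 (\<lambda>i. if i = 9 then 5 else 3) (\<lambda>_. 5) [] (p9) (p9 @ star 9) (Br 2 9
    (Br 5 9 (Br 8 9 (Br 0 9 (Br 1 9 (Fu 9 (Dr [1,3,6,8,5,9,4,7])) (Br 3 9 (Fu 9 (Dr
    [8,5,1,3,9,6,4,7])) (Dr [9,0,4,7,1,3,6,8]))) (Br 4 9 (Br 6 9 (Fu 9 (Dr [6,0,4,7,1,3,8,9])) (Dr
    [9,1,7,4,0,6,8,2])) (Dr [9,1,3,6,0,4,7,8]))) (Dr [9,0,4,7,1,8,6,3])) (Dr [9,1,3,6,8,5,7,4]))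
    (Dr [9,0,4,2,6,8,7,1]))"
  by code_simp

lemma cert_extend_p10:
  "chk 11 2 20 (\<lambda>i. if i = 10 then 5 else 3) (\<lambda>_. 5) [] (p10) (p10 @ star 10) (Br
    0 10 (Br 1 10 (Br 2 10 (Br 3 10 (Br 4 10 (Fu 10 (Dr [2,3,6,9,7,5,8,4,10])) (Br 7 10 (Fu 10 (Dr
    [2,3,6,9,7,5,8,4,10])) (Dr [10,2,3,6,9,7,4,8,5]))) (Br 6 10 (Br 4 10 (Fu 10 (Dr
    [2,3,6,9,7,5,8,4,10])) (Br 7 10 (Fu 10 (Dr [2,3,6,9,7,5,8,4,10])) (Dr [10,2,3,6,9,7,4,8,5])))
    (Dr [10,2,4,7,9,6,3,8,5]))) (Br 3 10 (Br 4 10 (Br 8 10 (Fu 10 (Dr [8,2,4,7,9,6,5,1,10])) (Dr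
    [10,0,5,1,7,9,8,2,6])) (Dr [10,1,5,8,2,4,7,9,6])) (Dr [10,0,5,8,2,3,6,9,7]))) (Br 3 10 (Br 5
    10 (Br 7 10 (Br 2 10 (Fu 10 (Dr [7,1,5,8,9,6,4,2,10])) (Br 4 10 (Fu 10 (Dr
    [7,1,5,8,9,6,4,2,10])) (Dr [10,5,1,7,4,2,8,9,6]))) (Dr [10,0,5,1,7,6,9,8,2])) (Dr
    [10,2,4,7,1,5,8,9,6])) (Dr [10,0,4,7,1,3,6,9,8]))) (Br 4 10 (Br 5 10 (Br 6 10 (Br 1 10 (Br 2
    10 (Fu 10 (Dr [6,0,5,8,9,7,3,2,10])) (Br 3 10 (Fu 10 (Dr [6,0,5,8,9,7,3,2,10])) (Dr
    [10,5,0,6,3,2,8,9,7]))) (Br 3 10 (Br 7 10 (Fu 10 (Dr [5,0,6,9,8,2,1,7,10])) (Dr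
    [10,2,8,5,0,6,1,7,9])) (Dr [10,4,0,6,3,1,7,9,8]))) (Dr [10,1,5,0,6,7,9,8,2])) (Dr
    [10,2,3,6,0,5,8,9,7])) (Dr [10,1,3,6,0,4,7,9,8])))"
  by code_simp

text \<open>Label 9 is the subdividing vertex and 10 the vertex of degree 4. Vertices 2, 5 and 8
  have degree 4 in \<open>p9\<close> already, hence take no further edge, and the edge from 9 to 10
  is forced by minimum degree 3.\<close>

lemma cert_extend_subdivided_p9:
  "list_all2 (\<lambda>(i, j). chk 11 2 20 (\<lambda>i. if i = 10 then 4 else 3) (\<lambda>_. 4)
    [] (subdivide 9 i j p9) (subdivide 9 i j p9 @ star 10)) p9 [Fu 2 (Fu 5 (Fu 8 (Fo 9 (Dr
    [10,3,2,4,9,7,8,5,6])))), Fu 2 (Fu 5 (Fu 8 (Fo 9 (Dr [10,0,4,7,1,8,9,5,3])))), Fu 2 (Fu 5 (Fu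
    8 (Fo 9 (Dr [10,3,2,4,7,8,5,6,9])))), Fu 2 (Fu 5 (Fu 8 (Fo 9 (Dr [10,3,2,4,7,8,5,6,9])))), Fu
    2 (Fu 5 (Fu 8 (Fo 9 (Dr [10,0,4,7,1,8,5,9,3])))), Fu 2 (Fu 5 (Fu 8 (Fo 9 (Dr
    [10,3,2,4,7,8,5,6,9])))), Fu 2 (Fu 5 (Fu 8 (Fo 9 (Dr [10,3,6,8,2,5,7,4,9])))), Fu 2 (Fu 5 (Fu
    8 (Fo 9 (Dr [10,3,2,5,8,6,7,4,9])))), Fu 2 (Fu 5 (Fu 8 (Fo 9 (Dr [10,0,4,7,1,8,6,3,9])))), Fu
    2 (Fu 5 (Fu 8 (Fo 9 (Dr [10,1,3,6,8,5,7,4,9])))), Fu 2 (Fu 5 (Fu 8 (Fo 9 (Dr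
    [10,3,2,4,7,8,5,6,9])))), Fu 2 (Fu 5 (Fu 8 (Fo 9 (Dr [10,3,2,4,9,7,8,5,6])))), Fu 2 (Fu 5 (Fu
    8 (Fo 9 (Dr [10,0,4,2,8,6,9,1,7])))), Fu 2 (Fu 5 (Fu 8 (Fo 9 (Dr [10,3,2,4,7,5,8,9,6])))), Fu
    2 (Fu 5 (Fu 8 (Fo 9 (Dr [10,3,2,4,7,9,8,5,6]))))]"
  by code_simp

text \<open>One subdivided edge suffices because the Petersen graph is edge-transitive.\<close>

lemma cert_extend_subdivided_p10:
  "chk 12 2 20 (\<lambda>i. if i = 11 then 4 else 3) (\<lambda>_. 4) [] (subdivide 10 0 4 p10)
    (subdivide 10 0 4 p10 @ star 11) (Fo 10 (Br 0 11 (Br 1 11 (Br 2 11 (Fu 11 (Dr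
    [2,3,6,9,7,4,10,11,5,8])) (Br 3 11 (Fu 11 (Dr [2,3,6,9,7,5,8,4,10,11])) (Dr
    [11,0,5,8,2,3,9,7,6,10]))) (Br 3 11 (Br 5 11 (Fu 11 (Dr [4,2,8,5,1,11,10,7,9,6])) (Dr
    [11,2,4,10,7,1,5,8,9,6])) (Dr [11,0,6,3,1,9,8,7,4,10]))) (Br 1 11 (Br 2 11 (Br 3 11 (Fu 11 (Dr
    [0,5,8,9,6,3,11,10,4,7])) (Br 6 11 (Fu 11 (Dr [6,0,5,8,9,7,4,10,11,3])) (Dr
    [11,4,7,9,6,0,10,5,3,8]))) (Br 3 11 (Br 8 11 (Fu 11 (Dr [0,5,3,2,6,9,7,4,10,11])) (Dr
    [11,1,5,0,10,6,9,8,2,7])) (Dr [11,5,0,10,6,3,2,8,9,7]))) (Br 3 11 (Br 5 11 (Br 7 11 (Fu 11 (Dr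
    [7,1,0,6,9,8,2,4,10,11])) (Dr [11,2,8,5,0,10,6,1,7,9])) (Dr [11,2,4,10,0,5,1,8,9,6])) (Dr
    [11,4,7,1,3,0,10,6,9,8])))))"
  by code_simp

text \<open>Each list is an automorphism of the Petersen graph, extended by fixing the subdividing
  vertex 10, that carries the edge 04 to the edge in question.\<close>

lemma p10_edge_transitive:
  "list_all2 (\<lambda>(i, j). embeds 11 (subdivide 10 i j p10) 11 (subdivide 10 0 4 p10)) p10
    [[0,1,2,3,4,5,6,7,8,9,10], [0,2,1,3,5,4,6,8,7,9,10], [0,2,9,8,6,4,5,3,7,1,10],
    [1,0,2,4,3,5,7,6,8,9,10], [1,2,0,4,5,3,7,8,6,9,10], [1,2,9,8,7,3,5,4,6,0,10],
    [2,0,1,5,3,4,8,6,7,9,10], [2,1,0,5,4,3,8,7,6,9,10], [2,1,9,7,8,3,4,5,6,0,10],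
    [3,5,9,8,6,1,2,0,7,4,10], [4,5,9,8,7,0,2,1,6,3,10], [5,4,9,7,8,0,1,2,6,3,10],
    [6,4,8,2,9,0,3,7,5,1,10], [7,3,8,2,9,1,4,6,5,0,10], [8,3,7,1,9,2,5,6,4,0,10]]"
  by code_simp

section \<open>Small nonplanar graphs\<close>

text \<open>Certificates list one tree per starting graph in the same order; this extracts the tree
  belonging to a given one.\<close>

lemma list_all2_ex: "list_all2 P xs ys \<Longrightarrow> x \<in> set xs \<Longrightarrow> \<exists>y. P x y"
  by (metis in_set_conv_nth list_all2_conv_all_nth)

lemma bij_betw_snoc:
  assumes "bij_betw g {..<n} W" "b \<notin> W" "V = insert b W" "n' = Suc n"
  shows "bij_betw (g(n := b)) {..<n'} V"
proof -
  have "bij_betw (g(n := b)) {..<n} W" using assms(1) by (rule bij_betw_cong[THEN iffD1, rotated]) simp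
  hence "bij_betw (g(n := b)) ({..<n} \<union> {n}) (W \<union> {(g(n := b)) n})"
    using notIn_Un_bij_betw3[of n "{..<n}" "g(n := b)" W] assms(2) by simp
  moreover have "{..<n} \<union> {n} = {..<n'}" using assms(4) by auto
  ultimately show ?thesis using assms(3) by simp
qed

section \<open>Degree counting\<close>

lemma deg_del:
  assumes "simple_graph V E" "w \<noteq> b"
  shows "deg (del {b} E) w + (if {b, w} \<in> E then 1 else 0) = deg E w"
proof -
  have fin: "finite E" by (rule simple_graph_finite_edges[OF assms(1)])
  have "{e \<in> E. w \<in> e} = {e \<in> del {b} E. w \<in> e} \<union> ({{b, w}} \<inter> E)"
  proof (intro equalityI subsetI)
    fix e assume e: "e \<in> {e \<in> E. w \<in> e}"
    show "e \<in> {e \<in> del {b} E. w \<in> e} \<union> ({{b, w}} \<inter> E)"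
    proof (cases "b \<in> e")
      case True
      have "card e = 2" using e assms(1) by (auto simp: simple_graph_def)
      hence "e = {b, w}" using True e assms(2) by (auto simp: card_2_iff)
      thus ?thesis using e by simp
    qed (use e in \<open>auto simp: del_def\<close>)
  qed (auto simp: del_def)
  moreover have "{e \<in> del {b} E. w \<in> e} \<inter> ({{b, w}} \<inter> E) = {}" by (auto simp: del_def)
  moreover have "card ({{b, w}} \<inter> E) = (if {b, w} \<in> E then 1 else 0)" by auto
  moreover have "finite {e \<in> del {b} E. w \<in> e}" using fin by (simp add: del_def)
  ultimately show ?thesis unfolding deg_def using card_Un_disjoint[of "{e \<in> del {b} E. w \<in> e}" "{{b, w}} \<inter> E"] by simp
qed

text \<open>If all other vertices take at least \<open>c\<close> each, only the rest of the degree
  sum is left for \<open>v\<close>.\<close>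

lemma deg_slack:
  assumes "simple_graph V E" "\<And>v. v \<in> V \<Longrightarrow> c \<le> deg E v" "v \<in> V"
  shows "deg E v + c * (card V - 1) \<le> 2 * card E"
proof -
  have fin: "finite V" using assms(1) by (simp add: simple_graph_def)
  have "c * (card V - 1) = (\<Sum>u\<in>V - {v}. c)" using fin assms(3) by simp
  also have "\<dots> \<le> (\<Sum>u\<in>V - {v}. deg E u)" by (rule sum_mono) (use assms(2) in auto)
  finally show ?thesis using handshake[OF assms(1)] sum.remove[OF fin assms(3), of "deg E"] by simp
qed

lemma deg_sum_ge:
  assumes "simple_graph V E" "\<And>v. v \<in> V \<Longrightarrow> c \<le> deg E v"
  shows "c * card V \<le> 2 * card E"
  using sum_mono[of V "\<lambda>_. c" "deg E"] handshake[OF assms(1)] assms(2) by (simp add: mult.commute)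

lemma deg_sum_le:
  assumes "simple_graph V E" "\<And>v. v \<in> V \<Longrightarrow> deg E v \<le> c"
  shows "2 * card E \<le> c * card V"
  using sum_mono[of V "deg E" "\<lambda>_. c"] handshake[OF assms(1)] assms(2) by (simp add: mult.commute)

lemma deg_less_card:
  assumes "simple_graph V E" "v \<in> V"
  shows "deg E v < card V"
proof -
  have fin: "finite V" using assms(1) by (simp add: simple_graph_def)
  have sub: "(\<lambda>e. e - {v}) ` {e \<in> E. v \<in> e} \<subseteq> (\<lambda>u. {u}) ` (V - {v})"
  proof
    fix e' assume "e' \<in> (\<lambda>e. e - {v}) ` {e \<in> E. v \<in> e}"
    then obtain e where e: "e \<in> E" "v \<in> e" "e' = e - {v}" by blast
    have "card e' = 1" "e' \<subseteq> V - {v}" using e assms(1) by (auto simp: simple_graph_def)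
    thus "e' \<in> (\<lambda>u. {u}) ` (V - {v})" by (auto simp: card_1_singleton_iff)
  qed
  have "inj_on (\<lambda>e. e - {v}) {e \<in> E. v \<in> e}"
    by (rule inj_onI) (metis (mono_tags, lifting) insert_Diff mem_Collect_eq)
  hence "deg E v = card ((\<lambda>e. e - {v}) ` {e \<in> E. v \<in> e})" unfolding deg_def by (rule card_image[symmetric])
  also have "\<dots> \<le> card ((\<lambda>u. {u}) ` (V - {v}))" by (rule card_mono[OF _ sub]) (use fin in simp)
  also have "\<dots> \<le> card (V - {v})" by (rule card_image_le) (use fin in simp)
  also have "\<dots> < card V" using fin assms(2) by (metis card_Diff1_less)
  finally show ?thesis .
qed

lemma regular_if_tight:
  assumes "simple_graph V E" "\<And>v. v \<in> V \<Longrightarrow> deg E v \<le> c" "c * card V = 2 * card E" "v \<in> V"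
  shows "deg E v = c"
proof (rule ccontr)
  assume "deg E v \<noteq> c"
  hence "deg E v < c" using assms(2,4) by (simp add: le_neq_implies_less)
  moreover have "finite V" using assms(1) by (simp add: simple_graph_def)
  ultimately have "(\<Sum>u\<in>V. deg E u) < (\<Sum>u\<in>V. c)" using assms(2,4) by (intro sum_strict_mono_ex1) auto
  thus False using handshake[OF assms(1)] assms(3) by (simp add: mult.commute)
qed

lemma seeds_ordered: "(r, es) \<in> set seeds \<Longrightarrow> ordered_pairs r es"
  using ordered_seeds by (auto simp: list_all_iff)

lemma seeds_bounds: "list_all (\<lambda>(r, es). r \<le> 9 \<and> 9 \<le> length es) seeds"
  by code_simp

lemma ordered_pairsD: "ordered_pairs n es \<Longrightarrow> (i, j) \<in> set es \<Longrightarrow> i < j \<and> j < n"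
  by (auto simp: ordered_pairs_def list_all_iff)

lemma ordered_subdivide:
  "ordered_pairs n es \<Longrightarrow> (i, j) \<in> set es \<Longrightarrow> ordered_pairs (Suc n) (subdivide n i j es)"
  by (fastforce simp: ordered_pairs_def list_all_iff subdivide_def distinct_removeAll)

lemma length_subdivide:
  "ordered_pairs n es \<Longrightarrow> (i, j) \<in> set es \<Longrightarrow> length (subdivide n i j es) = Suc (length es)"
  by (simp add: subdivide_def ordered_pairs_def distinct_remove1_removeAll[symmetric] length_remove1)
     (metis Suc_pred length_pos_if_in_set)

text \<open>A copy found after smoothing either avoids the artificial edge \<open>xy\<close>, and is
  then a copy in the original graph, or uses it, and then the detour through \<open>v\<close> gives
  a copy with that edge subdivided.\<close>

lemma copy_smooth:
  assumes f: "inj_on f {..<r}" "f ` {..<r} \<subseteq> V - {v}"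
    and es: "\<And>i j. (i, j) \<in> set es \<Longrightarrow> {f i, f j} \<in> insert {x, y} (del {v} E)"
    and G: "v \<in> V" "{v, x} \<in> E" "{v, y} \<in> E" "ordered_pairs r es"
  shows "(\<forall>i j. (i, j) \<in> set es \<longrightarrow> {f i, f j} \<in> E) \<or>
    (\<exists>i j. (i, j) \<in> set es \<and> copy (Suc r) (subdivide r i j es) V E)"
proof (cases "\<exists>i j. (i, j) \<in> set es \<and> {f i, f j} = {x, y}")
  case False
  thus ?thesis using es by (auto simp: del_def)
next
  case True
  then obtain i j where ij: "(i, j) \<in> set es" "{f i, f j} = {x, y}" by blast
  have o: "a < b" "b < r" "a < r" if "(a, b) \<in> set es" for a b using ordered_pairsD[OF G(4) that] by linarith+
  have ff: "a = b" if "a < r" "b < r" "f a = f b" for a b using f(1) that by (auto dest: inj_onD)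
  define g where "g = f(r := v)"
  have g: "g a = f a" if "a < r" for a using that by (simp add: g_def)
  have gr: "g r = v" by (simp add: g_def)
  have "bij_betw g {..<Suc r} (insert v (f ` {..<r}))"
    unfolding g_def by (rule bij_betw_snoc[OF _ _ refl refl]) (use f in \<open>auto simp: bij_betw_def\<close>)
  hence "inj_on g {..<Suc r}" "g ` {..<Suc r} \<subseteq> V" using f(2) G(1) by (auto simp: bij_betw_def)
  moreover have "{g a, g b} \<in> E" if "(a, b) \<in> set (subdivide r i j es)" for a b
  proof -
    have "(a, b) = (i, r) \<or> (a, b) = (j, r) \<or> (a, b) \<in> set es \<and> (a, b) \<noteq> (i, j)"
      using that by (auto simp: subdivide_def)
    then consider "a = i" "b = r" | "a = j" "b = r" | "(a, b) \<in> set es" "(a, b) \<noteq> (i, j)" by blast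
    thus ?thesis
    proof cases
      case 1
      have "f i \<in> {x, y}" using ij(2) by blast
      thus ?thesis using 1 g[OF o(3)[OF ij(1)]] gr G(2,3) by (auto simp: insert_commute)
    next
      case 2
      have "f j \<in> {x, y}" using ij(2) by blast
      thus ?thesis using 2 g[OF o(2)[OF ij(1)]] gr G(2,3) by (auto simp: insert_commute)
    next
      case 3
      have "{f a, f b} \<noteq> {f i, f j}"
      proof
        assume "{f a, f b} = {f i, f j}"
        hence "f a = f i \<and> f b = f j \<or> f a = f j \<and> f b = f i" by (simp only: doubleton_eq_iff)
        thus False
          using ff[of a i] ff[of b j] ff[of a j] ff[of b i] o[OF 3(1)] o[OF ij(1)] 3(2) by auto
      qed
      hence "{f a, f b} \<in> del {v} E" using es[OF 3(1)] ij(2) by simp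
      thus ?thesis using g o[OF 3(1)] by (simp add: del_def)
    qed
  qed
  ultimately have "copy (Suc r) (subdivide r i j es) V E" unfolding copy_def by (intro exI[of _ g]) simp
  thus ?thesis using ij(1) by blast
qed

text \<open>This supplies the choice of labels with which the searches for seeds begin: a vertex of
  known degree followed by all its neighbours.\<close>

lemma label_star:
  assumes "simple_graph V E" "v \<in> V" "deg E v = d" "card V = n"
  obtains f where "bij_betw f {..<n} V" "f 0 = v" "\<And>i. 0 < i \<Longrightarrow> i \<le> d \<Longrightarrow> {f 0, f i} \<in> E"
proof -
  have fin: "finite V" using assms(1) by (simp add: simple_graph_def)
  define N where "N = {u. {v, u} \<in> E}"
  have vN: "v \<notin> N" "N \<subseteq> V" using assms(1) by (auto simp: N_def simple_graph_def)
  have "(\<lambda>u. {v, u}) ` N = {e \<in> E. v \<in> e}"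
  proof (intro equalityI subsetI)
    fix e assume e: "e \<in> {e \<in> E. v \<in> e}"
    hence "card e = 2" using assms(1) by (auto simp: simple_graph_def)
    then obtain u where "e = {v, u}" using e by (auto simp: card_2_iff insert_commute)
    thus "e \<in> (\<lambda>u. {v, u}) ` N" using e by (auto simp: N_def)
  qed (auto simp: N_def)
  moreover have "inj_on (\<lambda>u. {v, u}) N" by (auto simp: inj_on_def doubleton_eq_iff)
  ultimately have "card N = d" using assms(3) unfolding deg_def by (metis card_image)
  moreover have "finite N" using vN(2) fin finite_subset by blast
  ultimately obtain h where h: "bij_betw h {..<d} N" using finite_same_card_bij[of "{..<d}" N] by auto
  define g where "g i = (if i = 0 then v else h (i - 1))" for i
  have hN: "h i \<in> N" if "i < d" for i using h that by (auto simp: bij_betw_def)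
  have inj: "inj_on g {..<Suc d}"
  proof (rule inj_onI)
    fix i j assume H: "i \<in> {..<Suc d}" "j \<in> {..<Suc d}" "g i = g j"
    show "i = j"
    proof (cases "i = 0"; cases "j = 0")
      assume "i \<noteq> 0" "j \<noteq> 0"
      hence "h (i - 1) = h (j - 1)" "i - 1 \<in> {..<d}" "j - 1 \<in> {..<d}" using H by (auto simp: g_def)
      hence "i - 1 = j - 1" using h by (auto simp: bij_betw_def dest: inj_onD)
      thus ?thesis using \<open>i \<noteq> 0\<close> \<open>j \<noteq> 0\<close> by simp
    next
      assume "i = 0" "j \<noteq> 0"
      hence "v = h (j - 1)" "j - 1 < d" using H by (auto simp: g_def)
      thus ?thesis using hN vN(1) by metis
    next
      assume "i \<noteq> 0" "j = 0"
      hence "v = h (i - 1)" "i - 1 < d" using H by (auto simp: g_def)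
      thus ?thesis using hN vN(1) by metis
    qed simp
  qed
  have "g i \<in> V" if "i < Suc d" for i
    using that hN[of "i - 1"] vN(2) assms(2) by (auto simp: g_def)
  hence sub: "g ` {..<Suc d} \<subseteq> V" by auto
  obtain f where f: "bij_betw f {..<n} V" "\<And>i. i < Suc d \<Longrightarrow> f i = g i"
    using extend_injection[OF inj sub fin assms(4)] by metis
  show thesis
  proof (rule that[OF f(1)])
    show "f 0 = v" using f(2)[of 0] by (simp add: g_def)
    show "{f 0, f i} \<in> E" if "0 < i" "i \<le> d" for i
      using f(2)[of 0] f(2)[of i] hN[of "i - 1"] that by (simp add: g_def N_def)
  qed
qed

lemma seeds_mem_lt: "(s, es) \<in> set seeds \<Longrightarrow> (i, j) \<in> set es \<Longrightarrow> i < s \<and> j < s"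
  using ordered_pairsD[OF seeds_ordered] by fastforce

lemma kuratowski_small:
  assumes "simple_graph V E" "\<not> thick V E"
    and "card E \<le> 11 \<or> card E \<le> 12 \<and> 8 \<le> card V \<and> (\<forall>v\<in>V. deg E v \<noteq> 0)"
  shows "\<exists>(r, es)\<in>set seeds. copy r es V E"
  using assms
proof (induction "card V" arbitrary: V E rule: less_induct)
  case less
  have fin: "finite V" "finite E" using less.prems(1) simple_graph_finite_edges by (auto simp: simple_graph_def)
  have na: "\<not> kapex 0 V E" using less.prems(2) kapex_0[OF fin(1)] by simp
  show ?case
  proof (cases "\<exists>v\<in>V. deg E v \<le> 2")
    case True
    then obtain v where v: "v \<in> V" "deg E v \<le> 2" by blast
    have smaller: "card (V - {v}) < card V" using fin(1) v(1) by (metis card_Diff1_less)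
    have cd: "card (del {v} E) + deg E v = card E" by (rule card_del[OF fin(2)])
    show ?thesis
      using less.prems(1) v na
    proof (cases rule: not_kapex_reduceE)
      case delete
      have "\<not> thick (V - {v}) (del {v} E)" using delete kapex_0 fin(1) by blast
      \<comment> \<open>In the 12-edge case \<open>v\<close> is not isolated and takes at least one
        edge with it.\<close>
      moreover have "card (del {v} E) \<le> 11" using cd less.prems(3) v(1) by (cases "deg E v = 0") auto
      ultimately obtain r es where se: "(r, es) \<in> set seeds" "copy r es (V - {v}) (del {v} E)"
        using less.hyps[OF smaller simple_graph_del[OF less.prems(1)]] by blast
      have "copy r es V E" by (rule copy_mono[OF se(2)]) (auto simp: del_def)
      thus ?thesis using se(1) by blast
    next
      case (smooth x y)
      let ?E = "insert {x, y} (del {v} E)"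
      have sg: "simple_graph (V - {v}) ?E" using simple_graph_del[OF less.prems(1), of "{v}"] smooth by (auto simp: simple_graph_def)
      have c11: "card ?E \<le> 11" using card_insert_le_m1[of 11 "del {v} E" "{x, y}"] cd smooth(9) less.prems(3) by linarith
      have "\<not> thick (V - {v}) ?E" using smooth(11) kapex_0 fin(1) by blast
      then obtain r es where se: "(r, es) \<in> set seeds" "copy r es (V - {v}) ?E"
        using less.hyps[OF smaller sg] c11 by blast
      have o: "ordered_pairs r es" by (rule seeds_ordered[OF se(1)])
      \<comment> \<open>A seed that has to be subdivided thus has at most 11 edges and falls under
        the closure certificate.\<close>
      have l: "length es \<le> 11" using copy_card_le[OF se(2) o simple_graph_finite_edges[OF sg]] c11 by simp
      obtain f where f: "inj_on f {..<r}" "f ` {..<r} \<subseteq> V - {v}" "\<And>i j. (i, j) \<in> set es \<Longrightarrow> {f i, f j} \<in> ?E"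
        using se(2) by (auto simp: copy_def)
      from copy_smooth[OF f v(1) smooth(6,7) o] show ?thesis
      proof
        assume "\<forall>i j. (i, j) \<in> set es \<longrightarrow> {f i, f j} \<in> E"
        hence "copy r es V E" using f unfolding copy_def by (intro exI[of _ f]) auto
        thus ?thesis using se(1) by blast
      next
        assume "\<exists>i j. (i, j) \<in> set es \<and> copy (Suc r) (subdivide r i j es) V E"
        then obtain i j where ij: "(i, j) \<in> set es" "copy (Suc r) (subdivide r i j es) V E" by blast
        have "(r, es) \<in> set (small_seeds 9 11)"
          using se(1) l seeds_bounds by (auto simp: small_seeds_def list_all_iff)
        from list_all2_ex[OF seeds_subdivide this] obtain cs where
          cs: "list_all2 (\<lambda>(i, j) (c, p). c < length seeds \<and>
            embeds (Suc r) (subdivide r i j es) (fst (seeds ! c)) (snd (seeds ! c)) p) es cs" by auto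
        obtain c p where cp: "c < length seeds"
          "embeds (Suc r) (subdivide r i j es) (fst (seeds ! c)) (snd (seeds ! c)) p"
          using list_all2_ex[OF cs ij(1)] by auto
        obtain g where g: "inj_on g {..<Suc r}" "g ` {..<Suc r} \<subseteq> V"
          "\<And>a b. (a, b) \<in> set (subdivide r i j es) \<Longrightarrow> {g a, g b} \<in> E"
          using ij(2) unfolding copy_def by blast
        have mem: "seeds ! c \<in> set seeds" using cp(1) by simp
        have "copy (fst (seeds ! c)) (snd (seeds ! c)) V E"
          by (rule embeds_copy[OF cp(2) g]) (use seeds_mem_lt[of "fst (seeds ! c)" "snd (seeds ! c)"] mem in auto)
        thus ?thesis using mem by (intro bexI[of _ "seeds ! c"]) (simp_all add: case_prod_beta)
      qed
    qed
  next
    case False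
    hence d3: "3 \<le> deg E v" if "v \<in> V" for v using that by fastforce
    have "3 * card V \<le> 2 * card E" by (rule deg_sum_ge[OF less.prems(1) d3])
    moreover have "card E \<le> 12" using less.prems(3) by auto
    moreover have "\<not> card V \<le> 4" using thick_card_le_4[OF less.prems(1)] less.prems(2) by blast
    ultimately consider "card V = 5" | "card V = 6" | "card V = 7" | "card V = 8" by linarith
    thus ?thesis
    proof cases
      case 1
      hence c: "card E \<le> 11" using less.prems(3) by auto
      obtain f where f: "bij_betw f {..<5::nat} V" using finite_same_card_bij[of "{..<5::nat}" V] fin(1) 1 by auto
      have hi: "deg E (f i) \<le> 4" if "i < 5" for i
        using deg_less_card[OF less.prems(1), of "f i"] f that 1 by (auto simp: bij_betw_def)
      show ?thesis
        by (rule chk_sound[OF cert_kuratowski_5 less.prems(1) f na c _ hi seeds_mem_lt]) (auto simp: set_pairs)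
    next
      case 2
      hence c: "card E \<le> 11" using less.prems(3) by auto
      have "\<exists>v\<in>V. deg E v \<le> 3"
      proof (rule ccontr)
        assume "\<not> ?thesis"
        hence "4 * card V \<le> 2 * card E" by (intro deg_sum_ge[OF less.prems(1)]) force
        thus False using 2 c by simp
      qed
      then obtain v where v: "v \<in> V" "deg E v = 3" using d3 by (meson le_antisym)
      obtain f where f: "bij_betw f {..<6::nat} V" "f 0 = v" "\<And>i. 0 < i \<Longrightarrow> i \<le> 3 \<Longrightarrow> {f 0, f i} \<in> E"
        using label_star[OF less.prems(1) v 2] by metis
      have fV: "f i \<in> V" if "i < 6" for i using f(1) that by (auto simp: bij_betw_def)
      have hi: "deg E (f i) \<le> (if i = 0 then 3 else 5)" if "i < 6" for i
      proof (cases "i = 0")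
        case False
        thus ?thesis using deg_less_card[OF less.prems(1) fV[OF that]] 2 by simp
      qed (use f v in simp)
      show ?thesis
        by (rule chk_sound[OF cert_kuratowski_6 less.prems(1) f(1) na c d3[OF fV] hi seeds_mem_lt])
           (use f(3) in \<open>auto simp: set_pairs\<close>)
    next
      case 3
      hence c: "card E \<le> 11" using less.prems(3) by auto
      \<comment> \<open>Otherwise the degree sum would be 21, which is odd.\<close>
      have "\<exists>v\<in>V. 4 \<le> deg E v"
      proof (rule ccontr)
        assume "\<not> ?thesis"
        hence "2 * card E \<le> 3 * card V" by (intro deg_sum_le[OF less.prems(1)]) force
        moreover have "3 * card V \<le> 2 * card E" by (rule deg_sum_ge[OF less.prems(1) d3])
        ultimately show False using 3 by presburger
      qed
      then obtain v where v: "v \<in> V" "4 \<le> deg E v" by blast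
      have sum: "deg E v + (\<Sum>u\<in>V - {v}. deg E u) \<le> 22"
        using handshake[OF less.prems(1)] sum.remove[OF fin(1) v(1), of "deg E"] c by simp
      \<comment> \<open>The sum is at most 22 and the other six vertices take at least 18 of it. The
        same count then gives degree 3 for each of them.\<close>
      have v4: "deg E v = 4"
        using deg_slack[OF less.prems(1) d3 v(1)] v(2) 3 c by simp
      have u3: "deg E u = 3" if u: "u \<in> V" "u \<noteq> v" for u
      proof (rule antisym)
        have "(\<Sum>w\<in>V - {v} - {u}. 3) \<le> (\<Sum>w\<in>V - {v} - {u}. deg E w)" by (rule sum_mono) (use d3 in auto)
        moreover have "card (V - {v} - {u}) = 5" using u v(1) fin 3 by simp
        moreover have "(\<Sum>w\<in>V - {v}. deg E w) = deg E u + (\<Sum>w\<in>V - {v} - {u}. deg E w)"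
          by (rule sum.remove) (use u fin in auto)
        ultimately show "deg E u \<le> 3" using sum v4 by simp
      qed (rule d3[OF u(1)])
      obtain f where f: "bij_betw f {..<7::nat} V" "f 0 = v" "\<And>i. 0 < i \<Longrightarrow> i \<le> 4 \<Longrightarrow> {f 0, f i} \<in> E"
        using label_star[OF less.prems(1) v(1) v4 3] by metis
      have fV: "f i \<in> V" if "i < 7" for i using f(1) that by (auto simp: bij_betw_def)
      have d: "deg E (f i) = (if i = 0 then 4 else 3)" if "i < 7" for i
      proof (cases "i = 0")
        case False
        hence "f i \<noteq> v" using f(1,2) that by (auto simp: bij_betw_def dest: inj_onD)
        thus ?thesis using u3[OF fV[OF that]] False by simp
      qed (use f v4 in simp)
      show ?thesis
        by (rule chk_sound[OF cert_kuratowski_7 less.prems(1) f(1) na c eq_refl[OF d[symmetric]] eq_refl[OF d] seeds_mem_lt])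
           (use f(3) in \<open>auto simp: set_pairs\<close>)
    next
      case 4
      have c: "card E \<le> 12" using less.prems(3) by auto
      have d: "deg E v = 3" if "v \<in> V" for v
        using deg_slack[OF less.prems(1) d3 that] d3[OF that] 4 c by simp
      have "V \<noteq> {}" using 4 by auto
      then obtain v where v: "v \<in> V" by blast
      obtain f where f: "bij_betw f {..<8::nat} V" "\<And>i. 0 < i \<Longrightarrow> i \<le> 3 \<Longrightarrow> {f 0, f i} \<in> E"
        using label_star[OF less.prems(1) v d[OF v] 4] by metis
      have fV: "f i \<in> V" if "i < 8" for i using f(1) that by (auto simp: bij_betw_def)
      show ?thesis
        by (rule chk_sound[OF cert_kuratowski_8 less.prems(1) f(1) na c d3[OF fV] eq_refl[OF d[OF fV]] seeds_mem_lt])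
           (use f(2) in \<open>auto simp: set_pairs\<close>)
    qed
  qed
qed

section \<open>Graphs that are not apex\<close>

lemma not_kapex_del:
  assumes "finite V" "\<not> kapex (Suc k) V E" "a \<in> V"
  shows "\<not> kapex k (V - {a}) (del {a} E)"
  using kapex_Suc[OF assms(1,3)] assms(2) by blast

text \<open>A vertex \<open>v\<close> of maximum degree is removed. The rest is nonplanar and
  contains a seed, whose labelling is extended to all of \<open>V\<close> with \<open>v\<close> as
  last label \<open>b\<close>. The condition on \<open>l\<close> is the one under which seeds are
  available; isolated vertices cannot arise, since each degree drops by at most 1.\<close>

lemma apex_step:
  assumes cert: "list_all2 (\<lambda>(r, es). chk n 1 m (\<lambda>i. if i = b then d else 3) (\<lambda>_. d) T es (pairs n)) (small_seeds b l) ts"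
    and n: "n = Suc b" "card V = n" "card E \<le> l + d" "l \<le> 11 \<or> l \<le> 12 \<and> 8 \<le> b"
    and G: "simple_graph V E" "\<not> kapex 1 V E" "card E \<le> m" "v \<in> V" "deg E v = d"
      "\<And>u. u \<in> V \<Longrightarrow> 3 \<le> deg E u" "\<And>u. u \<in> V \<Longrightarrow> deg E u \<le> d"
    and T: "\<And>s es i j. (s, es) \<in> set T \<Longrightarrow> (i, j) \<in> set es \<Longrightarrow> i < s \<and> j < s"
  shows "\<exists>(s, es)\<in>set T. copy s es V E"
proof -
  have fin: "finite V" "finite E" using G(1) simple_graph_finite_edges by (auto simp: simple_graph_def)
  let ?V = "V - {v}" and ?E = "del {v} E"
  have sg: "simple_graph ?V ?E" by (rule simple_graph_del[OF G(1)])
  have cV: "card ?V = b" using n fin G(4) by simp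
  have cE: "card ?E \<le> l" using card_del[OF fin(2), of v] G(5) n(3) by simp
  have "\<not> thick ?V ?E" using not_kapex_del[of V 0 E v] G fin kapex_0[of ?V ?E] by simp
  moreover have "deg ?E u \<noteq> 0" if "u \<in> ?V" for u
    using deg_del[OF G(1), of u v] G(6)[of u] that by (auto split: if_splits)
  ultimately obtain r es where se: "(r, es) \<in> set seeds" "copy r es ?V ?E"
    using kuratowski_small[OF sg] cE cV n(4) by fastforce
  have o: "ordered_pairs r es" by (rule seeds_ordered[OF se(1)])
  have "length es \<le> l" using copy_card_le[OF se(2) o simple_graph_finite_edges[OF sg]] cE by simp
  moreover obtain f where f: "bij_betw f {..<b} ?V" "\<And>i j. (i, j) \<in> set es \<Longrightarrow> {f i, f j} \<in> ?E" "r \<le> b"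
    using copy_extend[OF se(2) o _ cV] fin(1) by blast
  ultimately have "(r, es) \<in> set (small_seeds b l)" using se(1) by (simp add: small_seeds_def)
  from list_all2_ex[OF cert this] obtain t where
    t: "chk n 1 m (\<lambda>i. if i = b then d else 3) (\<lambda>_. d) T es (pairs n) t" by auto
  let ?g = "f(b := v)"
  have g: "bij_betw ?g {..<n} V" by (rule bij_betw_snoc[OF f(1) _ _ n(1)]) (use G(4) in auto)
  have gV: "?g i \<in> V" if "i < n" for i using g that by (auto simp: bij_betw_def)
  show ?thesis
  proof (rule chk_sound[OF t G(1) g G(2,3) _ _ T])
    show "(if i = b then d else 3) \<le> deg E (?g i)" if "i < n" for i using G(5) G(6)[OF gV[OF that]] by auto
    show "deg E (?g i) \<le> d" if "i < n" for i by (rule G(7)[OF gV[OF that]])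
    show "i < j \<and> j < n \<and> {?g i, ?g j} \<in> E" if "(i, j) \<in> set es" for i j
      using ordered_pairsD[OF o that] f(2)[OF that] f(3) n(1) by (auto simp: del_def)
  qed (simp_all add: set_pairs)
qed

lemma regular_step:
  assumes cert: "list_all2 (\<lambda>(r, es). chk n 2 20 (\<lambda>_. d) (\<lambda>_. d) [] es (removeAll (c, c') (pairs n))) (small_seeds c l) ts"
    and n: "n = Suc c'" "c' = Suc c" "card V = n" "3 \<le> d" "d < c'" "card E \<le> l + 2 * d" "l \<le> 11 \<or> l \<le> 12 \<and> 8 \<le> c"
    and G: "simple_graph V E" "card E \<le> 20" "\<And>u. u \<in> V \<Longrightarrow> deg E u = d"
  shows "kapex 2 V E"
proof (rule ccontr)
  assume na: "\<not> kapex 2 V E"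
  have fin: "finite V" "finite E" using G(1) simple_graph_finite_edges by (auto simp: simple_graph_def)
  have "V \<noteq> {}" using n by auto
  then obtain a where a: "a \<in> V" by blast
  \<comment> \<open>A vertex adjacent to all others would have degree \<open>n - 1\<close>, which
    exceeds \<open>d\<close>.\<close>
  have "\<exists>b\<in>V - {a}. {a, b} \<notin> E"
  proof (rule ccontr)
    assume "\<not> ?thesis"
    hence "(\<lambda>b. {a, b}) ` (V - {a}) \<subseteq> {e \<in> E. a \<in> e}" by auto
    moreover have "inj_on (\<lambda>b. {a, b}) (V - {a})" by (auto simp: inj_on_def doubleton_eq_iff)
    ultimately have "card (V - {a}) \<le> deg E a" unfolding deg_def using fin(2) by (intro card_inj_on_le) auto
    thus False using G(3)[OF a] fin(1) a n by simp
  qed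
  then obtain b where b: "b \<in> V" "b \<noteq> a" "{a, b} \<notin> E" by blast
  let ?V1 = "V - {a}" and ?E1 = "del {a} E"
  let ?V = "?V1 - {b}" and ?E = "del {b} ?E1"
  have sg1: "simple_graph ?V1 ?E1" by (rule simple_graph_del[OF G(1)])
  have sg: "simple_graph ?V ?E" by (rule simple_graph_del[OF sg1])
  have cV: "card ?V = c" using n fin a b by simp
  \<comment> \<open>Nonadjacency matters here: \<open>b\<close> keeps its full degree after the
    deletion of \<open>a\<close>, so exactly \<open>2 * d\<close> edges disappear.\<close>
  have d1: "deg ?E1 b = d" using deg_del[OF G(1) b(2)] b G(3) by simp
  have fin1: "finite ?E1" using fin by (simp add: del_def)
  have cE: "card ?E \<le> l" using card_del[OF fin(2), of a] card_del[OF fin1, of b] G(3)[OF a] d1 n(6) by simp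
  have "\<not> kapex 1 ?V1 ?E1" using not_kapex_del[of V 1 E a] na a fin(1) by (simp add: numeral_2_eq_2)
  hence "\<not> thick ?V ?E" using not_kapex_del[of ?V1 0 ?E1 b] b fin(1) kapex_0[of ?V ?E] by simp
  moreover have "deg ?E u \<noteq> 0" if "u \<in> ?V" for u
    using deg_del[OF G(1), of u a] deg_del[OF sg1, of u b] G(3)[of u] that n(4) by (auto split: if_splits)
  ultimately obtain r es where se: "(r, es) \<in> set seeds" "copy r es ?V ?E"
    using kuratowski_small[OF sg] cE cV n(7) by fastforce
  have o: "ordered_pairs r es" by (rule seeds_ordered[OF se(1)])
  have "length es \<le> l" using copy_card_le[OF se(2) o simple_graph_finite_edges[OF sg]] cE by simp
  moreover obtain f where f: "bij_betw f {..<c} ?V" "\<And>i j. (i, j) \<in> set es \<Longrightarrow> {f i, f j} \<in> ?E" "r \<le> c"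
    using copy_extend[OF se(2) o _ cV] fin(1) by blast
  ultimately have "(r, es) \<in> set (small_seeds c l)" using se(1) by (simp add: small_seeds_def)
  from list_all2_ex[OF cert this] obtain t where
    t: "chk n 2 20 (\<lambda>_. d) (\<lambda>_. d) [] es (removeAll (c, c') (pairs n)) t" by auto
  define g where "g = (f(c := a))(c' := b)"
  have g1: "bij_betw (f(c := a)) {..<c'} (insert a ?V)" by (rule bij_betw_snoc[OF f(1) _ refl n(2)]) simp
  have g: "bij_betw g {..<n} V" unfolding g_def
    by (rule bij_betw_snoc[OF g1 _ _ n(1)]) (use a b in auto)
  have gV: "g i \<in> V" if "i < n" for i using g that by (auto simp: bij_betw_def)
  have "\<exists>(s, es)\<in>set []. copy s es V E"
  proof (rule chk_sound[OF t G(1) g na G(2)])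
    show "d \<le> deg E (g i)" "deg E (g i) \<le> d" if "i < n" for i using G(3)[OF gV[OF that]] by simp_all
    show "i < j \<and> j < n \<and> {g i, g j} \<in> E" if "(i, j) \<in> set es" for i j
      using ordered_pairsD[OF o that] f(2)[OF that] f(3) n(1,2) by (auto simp: del_def g_def)
    show "(i, j) \<in> set (removeAll (c, c') (pairs n))" if "i < j" "j < n" "{g i, g j} \<in> E" for i j
    proof -
      have "g c = a" "g c' = b" using n(2) by (simp_all add: g_def)
      hence "(i, j) \<noteq> (c, c')" using that(3) b(3) by auto
      thus ?thesis using that by (simp add: set_pairs)
    qed
  qed simp_all
  thus False by simp
qed

text \<open>Since \<open>V - {a}\<close> carries exactly the known graph, its edges are both certain
  and the only possible ones; the search runs over the edges at \<open>a\<close>.\<close>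

lemma extend_step:
  assumes cert: "chk n 2 20 (\<lambda>i. if i = r then d else 3) (\<lambda>_. d) [] es (es @ star r) t"
    and n: "n = Suc r" "ordered_pairs r es" "card (V - {a}) = r" "card (del {a} E) = length es" "copy r es (V - {a}) (del {a} E)"
    and G: "simple_graph V E" "card E \<le> 20" "a \<in> V" "deg E a = d"
      "\<And>u. u \<in> V \<Longrightarrow> 3 \<le> deg E u" "\<And>u. u \<in> V \<Longrightarrow> deg E u \<le> d"
  shows "kapex 2 V E"
proof (rule ccontr)
  assume na: "\<not> kapex 2 V E"
  obtain f where f: "bij_betw f {..<r} (V - {a})" "del {a} E = (\<lambda>(i, j). {f i, f j}) ` set es"
    "\<And>i j. i < j \<Longrightarrow> j < r \<Longrightarrow> {f i, f j} \<in> del {a} E \<Longrightarrow> (i, j) \<in> set es"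
    using copy_exact[OF n(5,2) simple_graph_del[OF G(1)] n(3,4)] by metis
  let ?g = "f(r := a)"
  have g: "bij_betw ?g {..<n} V" by (rule bij_betw_snoc[OF f(1) _ _ n(1)]) (use G(3) in auto)
  have gV: "?g i \<in> V" if "i < n" for i using g that by (auto simp: bij_betw_def)
  have fa: "f i \<noteq> a" if "i < r" for i using f(1) that by (auto simp: bij_betw_def)
  have "\<exists>(s, es)\<in>set []. copy s es V E"
  proof (rule chk_sound[OF cert G(1) g na G(2)])
    show "(if i = r then d else 3) \<le> deg E (?g i)" if "i < n" for i using G(4) G(5)[OF gV[OF that]] by auto
    show "deg E (?g i) \<le> d" if "i < n" for i by (rule G(6)[OF gV[OF that]])
    show "i < j \<and> j < n \<and> {?g i, ?g j} \<in> E" if "(i, j) \<in> set es" for i j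
    proof -
      have "{f i, f j} \<in> del {a} E" unfolding f(2) using that by (intro image_eqI[of _ _ "(i, j)"]) auto
      thus ?thesis using ordered_pairsD[OF n(2) that] n(1) by (auto simp: del_def)
    qed
    show "(i, j) \<in> set (es @ star r)" if H: "i < j" "j < n" "{?g i, ?g j} \<in> E" for i j
    proof (cases "j = r")
      case True thus ?thesis using H by (auto simp: star_def)
    next
      case False
      hence "j < r" "i < r" using H n(1) by simp_all
      hence "{f i, f j} \<in> del {a} E" using H fa[of i] fa[of j] by (auto simp: del_def)
      thus ?thesis using f(3)[OF H(1) \<open>j < r\<close>] by simp
    qed
  qed simp_all
  thus False by simp
qed

lemma max_degree_vertex:
  assumes "finite V" "V \<noteq> {}"
  obtains v where "v \<in> V" "\<And>u. u \<in> V \<Longrightarrow> deg E u \<le> deg E v"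
proof -
  have "Max (deg E ` V) \<in> deg E ` V" using assms by simp
  then obtain v where v: "v \<in> V" "deg E v = Max (deg E ` V)" by auto
  thus thesis using that[OF v(1)] assms by simp
qed

text \<open>By minimality all degrees are at least 3. Then the number of vertices is between 6 and 9
  and the maximum degree between 3 and 5, which is the range of the twelve certificates.\<close>

lemma apex_if_card_le_14:
  "simple_graph V E \<Longrightarrow> card E \<le> 14 \<Longrightarrow> kapex 1 V E"
proof (induction "card V" arbitrary: V E rule: less_induct)
  case less
  have fin: "finite V" "finite E" using less.prems(1) simple_graph_finite_edges by (auto simp: simple_graph_def)
  show ?case
  proof (rule ccontr)
    assume na: "\<not> kapex 1 V E"
    \<comment> \<open>On five vertices, deleting one leaves four, and these can always be
      drawn.\<close>
    have n6: "6 \<le> card V" using kapex_card_le[OF less.prems(1), of 1] na by linarith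
    have d3: "3 \<le> deg E v" if v: "v \<in> V" for v
    proof (rule ccontr)
      assume "\<not> 3 \<le> deg E v"
      hence "deg E v \<le> 2" by simp
      then obtain E' where "simple_graph (V - {v}) E'" "\<not> kapex 1 (V - {v}) E'" "card E' \<le> card E"
        using not_kapex_reduce[OF less.prems(1) v _ na] by blast
      moreover have "card (V - {v}) < card V" using fin(1) v by (metis card_Diff1_less)
      ultimately show False using less by force
    qed
    have n9: "card V \<le> 9" using deg_sum_ge[OF less.prems(1) d3] less.prems(2) by simp
    have "V \<noteq> {}" using n6 by auto
    then obtain v where v: "v \<in> V" "\<And>u. u \<in> V \<Longrightarrow> deg E u \<le> deg E v"
      using max_degree_vertex[OF fin(1)] by blast
    \<comment> \<open>Otherwise at most 8 edges remain without \<open>v\<close>, and every seed has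
      at least 9.\<close>
    have "deg E v \<le> 5"
    proof (rule ccontr)
      assume "\<not> deg E v \<le> 5"
      hence c8: "card (del {v} E) \<le> 8" using card_del[OF fin(2), of v] less.prems(2) by linarith
      have "\<not> thick (V - {v}) (del {v} E)"
        using not_kapex_del[of V 0 E v] na v(1) fin kapex_0[of "V - {v}" "del {v} E"] by simp
      then obtain r es where se: "(r, es) \<in> set seeds" "copy r es (V - {v}) (del {v} E)"
        using kuratowski_small[OF simple_graph_del[OF less.prems(1)]] c8 by fastforce
      have "length es \<le> 8"
        using copy_card_le[OF se(2) seeds_ordered[OF se(1)] simple_graph_finite_edges[OF simple_graph_del[OF less.prems(1)]]] c8 by simp
      thus False using se(1) seeds_bounds by (auto simp: list_all_iff)
    qed
    hence d: "deg E v = 3 \<or> deg E v = 4 \<or> deg E v = 5" using d3[OF v(1)] by linarith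
    have step: False if c: "list_all2 (\<lambda>(r, es). chk n 1 14 (\<lambda>i. if i = b then d else 3) (\<lambda>_. d) [] es (pairs n)) (small_seeds b l) ts"
      "n = Suc b" "card V = n" "14 \<le> l + d" "l \<le> 11" "deg E v = d" for n b l d ts
      using apex_step[OF c(1-3) _ _ less.prems(1) na less.prems(2) v(1) c(6) d3] c(4-6) v(2) less.prems(2) by simp
    have "card V = 6 \<or> card V = 7 \<or> card V = 8 \<or> card V = 9" using n6 n9 by linarith
    thus False using d
      using step[OF cert_apex14_6_3] step[OF cert_apex14_6_4] step[OF cert_apex14_6_5]
        step[OF cert_apex14_7_3] step[OF cert_apex14_7_4] step[OF cert_apex14_7_5]
        step[OF cert_apex14_8_3] step[OF cert_apex14_8_4] step[OF cert_apex14_8_5]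
        step[OF cert_apex14_9_3] step[OF cert_apex14_9_4] step[OF cert_apex14_9_5]
      by (elim disjE) simp_all
  qed
qed

text \<open>Removing or smoothing a vertex of degree 1 or 2 loses an edge and would give a
  counterexample to the bound 14.\<close>

lemma not_apex_15_min_degree:
  assumes "simple_graph V E" "card E = 15" "\<not> kapex 1 V E" "\<And>v. v \<in> V \<Longrightarrow> deg E v \<noteq> 0" "v \<in> V"
  shows "3 \<le> deg E v"
proof (rule ccontr)
  assume "\<not> 3 \<le> deg E v"
  hence "deg E v \<le> 2" by simp
  then obtain E' where "simple_graph (V - {v}) E'" "\<not> kapex 1 (V - {v}) E'" "card E' < card E"
    using not_kapex_reduce[OF assms(1,5) _ assms(3)] assms(4)[OF assms(5)] by blast
  thus False using apex_if_card_le_14[of "V - {v}" E'] assms(2) by simp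
qed

lemma not_apex_15:
  assumes G: "simple_graph V E" "card E = 15" "\<not> kapex 1 V E"
    and d3: "\<And>v. v \<in> V \<Longrightarrow> 3 \<le> deg E v" and d5: "\<And>v. v \<in> V \<Longrightarrow> deg E v \<le> 5" and n8: "8 \<le> card V"
  shows "card V = 8 \<and> (copy 8 k44e V E \<or> copy 8 p8 V E) \<or> card V = 9 \<and> copy 9 p9 V E \<or> card V = 10 \<and> copy 10 p10 V E"
proof -
  have fin: "finite V" using G(1) by (simp add: simple_graph_def)
  have n10: "card V \<le> 10" using deg_sum_ge[OF G(1) d3] G(2) by simp
  have "V \<noteq> {}" using n8 by auto
  then obtain v where v: "v \<in> V" "\<And>u. u \<in> V \<Longrightarrow> deg E u \<le> deg E v"
    using max_degree_vertex[OF fin] by blast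
  \<comment> \<open>The two estimates delimit the maximum degree: the average forces at least 4 on 8
    or 9 vertices, and the slack forces 3 on 10 vertices.\<close>
  have avg: "30 \<le> deg E v * card V" using deg_sum_le[OF G(1) v(2)] G(2) by simp
  have slack: "deg E v + 3 * (card V - 1) \<le> 30" using deg_slack[OF G(1) d3 v(1)] G(2) by simp
  have step: "\<exists>(s, es)\<in>set T. copy s es V E"
    if c: "list_all2 (\<lambda>(r, es). chk n 1 15 (\<lambda>i. if i = b then d else 3) (\<lambda>_. d) T es (pairs n)) (small_seeds b l) ts"
      "n = Suc b" "card V = n" "15 \<le> l + d" "l \<le> 11 \<or> l \<le> 12 \<and> 8 \<le> b" "deg E v = d"
      "\<And>s es. (s, es) \<in> set T \<Longrightarrow> ordered_pairs s es" for n b l d ts T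
  proof (rule apex_step[OF c(1-3) _ c(5) G(1,3) _ v(1) c(6) d3])
    show "i < s \<and> j < s" if "(s, es) \<in> set T" "(i, j) \<in> set es" for s es i j
      using ordered_pairsD[OF c(7)[OF that(1)] that(2)] by simp
  qed (use c(4,6) v(2) G(2) in auto)
  have d: "deg E v = 3 \<or> deg E v = 4 \<or> deg E v = 5" using d3[OF v(1)] d5[OF v(1)] by linarith
  consider "card V = 8" | "card V = 9" | "card V = 10" using n8 n10 by linarith
  thus ?thesis
  proof cases
    case 1
    hence "deg E v = 4 \<or> deg E v = 5" using d avg by auto
    thus ?thesis using step[OF cert_apex15_8_4] step[OF cert_apex15_8_5] 1 ordered_named by auto
  next
    case 2
    hence "deg E v = 4 \<or> deg E v = 5" using d avg by auto
    thus ?thesis using step[OF cert_apex15_9_4] step[OF cert_apex15_9_5] 2 ordered_named by auto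
  next
    case 3
    hence "deg E v = 3" using d slack by auto
    thus ?thesis using step[OF cert_apex15_10_3] 3 ordered_named by auto
  qed
qed

text \<open>The ends \<open>x\<close> and \<open>y\<close> exchange their neighbour \<open>v\<close>
  for each other; all other vertices keep their edges.\<close>

lemma deg_smooth:
  assumes "simple_graph V E" "w \<noteq> v" "x \<noteq> y" "{x, y} \<notin> E"
    "E = insert {v, x} (insert {v, y} (del {v} E))" "v \<noteq> x" "v \<noteq> y"
  shows "deg (insert {x, y} (del {v} E)) w = deg E w"
proof -
  have fin: "finite (del {v} E)" using simple_graph_finite_edges[OF assms(1)] by (simp add: del_def)
  let ?F = "insert {v, x} (insert {v, y} (del {v} E))"
  have F1: "z \<in> ?F" if "z \<in> E" for z by (rule subst[where P = "\<lambda>F. z \<in> F", OF assms(5) that])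
  have F2: "z \<in> E" if "z \<in> ?F" for z by (rule subst[where P = "\<lambda>F. z \<in> F", OF assms(5)[symmetric] that])
  have "{v, w} \<in> E \<longleftrightarrow> w = x \<or> w = y"
  proof
    assume "{v, w} \<in> E"
    from F1[OF this] show "w = x \<or> w = y" using assms(2) by (auto simp: del_def doubleton_eq_iff)
  next
    assume "w = x \<or> w = y"
    thus "{v, w} \<in> E" by (intro F2) auto
  qed
  moreover have "{e \<in> insert {x, y} (del {v} E). w \<in> e} =
      (if w = x \<or> w = y then insert {x, y} {e \<in> del {v} E. w \<in> e} else {e \<in> del {v} E. w \<in> e})" by auto
  moreover have "{x, y} \<notin> del {v} E" using assms(4) by (auto simp: del_def)
  ultimately have "deg (insert {x, y} (del {v} E)) w = deg (del {v} E) w + (if {v, w} \<in> E then 1 else 0)"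
    unfolding deg_def using fin by simp
  thus ?thesis using deg_del[OF assms(1,2)] by simp
qed

text \<open>Adding edges can only make it harder to be 2-apex, so a counterexample may be filled up
  to exactly 20 edges.\<close>

lemma edges_extend:
  assumes "simple_graph V E" "card E \<le> m" "m \<le> card V choose 2"
  obtains E' where "simple_graph V E'" "E \<subseteq> E'" "card E' = m"
proof -
  let ?K = "{e. e \<subseteq> V \<and> card e = 2}"
  have fin: "finite V" using assms(1) by (simp add: simple_graph_def)
  have finK: "finite ?K" using fin by simp
  have "E \<subseteq> ?K" using assms(1) by (auto simp: simple_graph_def)
  moreover have "card ?K = card V choose 2" by (rule n_subsets[OF fin])
  ultimately have "m - card E \<le> card (?K - E)" using assms(3) finK
    by (simp add: card_Diff_subset finite_subset)
  then obtain D where D: "D \<subseteq> ?K - E" "card D = m - card E" "finite D" by (rule obtain_subset_with_card_n)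
  have "card (E \<union> D) = m"
    using D assms(2) simple_graph_finite_edges[OF assms(1)] by (subst card_Un_disjoint) auto
  moreover have "simple_graph V (E \<union> D)" using D(1) assms(1) by (auto simp: simple_graph_def)
  ultimately show thesis using that by blast
qed

section \<open>Graphs with at most 20 edges\<close>

text \<open>Removing one vertex turns the component \<open>K\<^sub>4\<close> into a triangle, which is irrelevant for planarity.\<close>

lemma kapex_K4_component:
  assumes G: "simple_graph V E" "card E \<le> 20" and R: "R \<subseteq> V" "card R = 4"
    and complete: "\<And>u w. u \<in> R \<Longrightarrow> w \<in> R \<Longrightarrow> u \<noteq> w \<Longrightarrow> {u, w} \<in> E"
    and closed: "\<And>u w. u \<in> R \<Longrightarrow> {u, w} \<in> E \<Longrightarrow> w \<in> R"
    and d3: "\<And>u. u \<in> R \<Longrightarrow> deg E u = 3"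
  shows "kapex 2 V E"
proof (rule ccontr)
  assume na: "\<not> kapex 2 V E"
  have fin: "finite V" "finite E" using G(1) simple_graph_finite_edges by (auto simp: simple_graph_def)
  have finR: "finite R" using R fin finite_subset by blast
  have "R \<noteq> {}" using R by auto
  then obtain r where r: "r \<in> R" by blast
  \<comment> \<open>The vertex \<open>r\<close> uses up one deletion. Then the remaining vertices of
    \<open>R\<close> are removed one at a time; each has degree at most 2 by then, so this preserves
    not being 1-apex.\<close>
  have "U \<subseteq> R - {r} \<longrightarrow> \<not> kapex 1 (V - insert r U) (del (insert r U) E)" if "finite U" for U
    using that
  proof (induction U)
    case empty
    show ?case using not_kapex_del[of V 1 E r] na r R(1) fin by (auto simp: numeral_2_eq_2)
  next
    case (insert u U)
    show ?case
    proof
      assume sub: "insert u U \<subseteq> R - {r}"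
      let ?S = "insert r U"
      let ?V = "V - ?S" and ?E = "del ?S E"
      have na: "\<not> kapex 1 ?V ?E" using insert.IH sub by simp
      have sg: "simple_graph ?V ?E" by (rule simple_graph_del[OF G(1)])
      have u: "u \<in> ?V" "u \<in> R" "u \<noteq> r" using sub insert.hyps R(1) by auto
      have "{e \<in> ?E. u \<in> e} \<subseteq> {e \<in> del {r} E. u \<in> e}" by (auto simp: del_def)
      hence "deg ?E u \<le> deg (del {r} E) u" unfolding deg_def
        by (rule card_mono[rotated]) (use fin(2) in \<open>simp add: del_def\<close>)
      hence d2: "deg ?E u \<le> 2" using deg_del[OF G(1) u(3)] d3[OF u(2)] complete[OF r u(2)] u(3) by simp
      have "\<not> kapex 1 (?V - {u}) (del {u} ?E)"
        using sg u(1) d2 na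
      proof (cases rule: not_kapex_reduceE)
        \<comment> \<open>Neighbours of \<open>u\<close> lie in \<open>R\<close> and are adjacent
          there, so smoothing cannot occur.\<close>
        case (smooth x y)
        have xy: "x \<in> R" "y \<in> R" using closed[OF u(2)] smooth(6,7) by (auto simp: del_def)
        have "{x, y} \<in> E" by (rule complete[OF xy smooth(5)])
        hence "{x, y} \<in> ?E" using smooth(1,2) by (auto simp: del_def)
        thus ?thesis using smooth(8) by simp
      qed
      moreover have "?V - {u} = V - insert r (insert u U)" "del {u} ?E = del (insert r (insert u U)) E"
        by (auto simp: del_def)
      ultimately show "\<not> kapex 1 (V - insert r (insert u U)) (del (insert r (insert u U)) E)" by simp
    qed
  qed
  from this[of "R - {r}"] have na1: "\<not> kapex 1 (V - R) (del R E)" using finR r by (simp add: insert_absorb)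
  let ?K = "{e. e \<subseteq> R \<and> card e = 2}"
  have "?K \<subseteq> E"
  proof
    fix e assume e: "e \<in> ?K"
    then obtain u w where "e = {u, w}" "u \<noteq> w" by (auto simp: card_2_iff)
    thus "e \<in> E" using complete e by auto
  qed
  moreover have "card ?K = 6" using n_subsets[OF finR, of 2] R(2) by (simp add: choose_two)
  moreover have "?K \<inter> del R E = {}" by (auto simp: del_def Int_absorb2)
  moreover have "del R E \<subseteq> E" by (auto simp: del_def)
  moreover have "finite ?K" using finR by simp
  \<comment> \<open>The six edges of the component are gone, which leaves at most 14, the range of
    the bound for one deletion.\<close>
  ultimately have "6 + card (del R E) \<le> card E"
    using card_mono[OF fin(2), of "?K \<union> del R E"] card_Un_disjoint[of ?K "del R E"] fin(2) finite_subset[of "del R E" E] by simp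
  hence "card (del R E) \<le> 14" using G(2) by simp
  thus False using apex_if_card_le_14[OF simple_graph_del[OF G(1)]] na1 by blast
qed

lemma kapex_if_card_20_max_degree_5:
  assumes G: "simple_graph V E" "card E = 20" and d3: "\<And>v. v \<in> V \<Longrightarrow> 3 \<le> deg E v"
    and d5: "\<And>v. v \<in> V \<Longrightarrow> deg E v \<le> 5" and a: "a \<in> V" "deg E a = 5"
  shows "kapex 2 V E"
proof (rule ccontr)
  assume na: "\<not> kapex 2 V E"
  have fin: "finite V" "finite E" using G(1) simple_graph_finite_edges by (auto simp: simple_graph_def)
  \<comment> \<open>Degrees at most 5 with sum 40. Equality forces 5-regularity; otherwise removing
    \<open>a\<close> still leaves the 8 vertices that the classification for 15 edges asks
    for.\<close>
  have "8 \<le> card V" using deg_sum_le[OF G(1) d5] G(2) by simp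
  have n9: "9 \<le> card V"
  proof (rule ccontr)
    assume "\<not> ?thesis"
    hence n8: "card V = 8" using \<open>8 \<le> card V\<close> by simp
    have "deg E u = 5" if "u \<in> V" for u by (rule regular_if_tight[OF G(1) d5 _ that]) (use n8 G(2) in simp_all)
    hence "kapex 2 V E" by (intro regular_step[OF cert_regular_8 _ _ n8 _ _ _ _ G(1)]) (use G(2) in simp_all)
    thus False using na by simp
  qed
  let ?V = "V - {a}" and ?E = "del {a} E"
  have sg: "simple_graph ?V ?E" by (rule simple_graph_del[OF G(1)])
  have cV: "card ?V = card V - 1" using fin a by simp
  have c8: "8 \<le> card ?V" using cV n9 by linarith
  have c15: "card ?E = 15" using card_del[OF fin(2), of a] a G(2) by simp
  have na1: "\<not> kapex 1 ?V ?E" using not_kapex_del[of V 1 E a] na a(1) fin(1) by (simp add: numeral_2_eq_2)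
  have dd: "deg E u \<le> deg ?E u + 1" "deg ?E u \<le> deg E u" if "u \<in> ?V" for u
    using deg_del[OF G(1), of u a] that by (auto split: if_splits)
  \<comment> \<open>Degrees dropped by at most 1 from at least 3, so no vertex is isolated; not
    being 1-apex with 15 edges then raises the lower bound back to 3.\<close>
  have "deg ?E u \<noteq> 0" if "u \<in> ?V" for u using dd(1)[OF that] d3[of u] that by force
  hence d3': "3 \<le> deg ?E u" if "u \<in> ?V" for u by (rule not_apex_15_min_degree[OF sg c15 na1 _ that])
  have d5': "deg ?E u \<le> 5" if "u \<in> ?V" for u using dd(2)[OF that] d5[of u] that by force
  have "card ?V = 8 \<and> (copy 8 k44e ?V ?E \<or> copy 8 p8 ?V ?E) \<or> card ?V = 9 \<and> copy 9 p9 ?V ?E \<or> card ?V = 10 \<and> copy 10 p10 ?V ?E"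
    by (rule not_apex_15[OF sg c15 na1 d3' d5' c8])
  moreover have len: "length k44e = 15" "length p8 = 15" "length p9 = 15" "length p10 = 15"
    by (simp_all add: k44e_def p8_def p9_def p10_def)
  moreover have step: False
    if "chk n 2 20 (\<lambda>i. if i = r then 5 else 3) (\<lambda>_. 5) [] es (es @ star r) t" "n = Suc r" "ordered_pairs r es"
      "card ?V = r" "length es = 15" "copy r es ?V ?E" for n r es t
    using extend_step[OF that(1-4) _ that(6) G(1) _ a d3 d5] that(5) c15 G(2) na by simp
  ultimately show False
    using step[OF cert_extend_k44e] step[OF cert_extend_p8] step[OF cert_extend_p9] step[OF cert_extend_p10] ordered_named
    by (elim disjE conjE) simp_all
qed

text \<open>The neighbour \<open>r\<close> of degree 3 is the point of the choice: it has degree 2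
  in the graph without \<open>a\<close>. Smoothing it turns 16 edges into 15, to which the
  classification applies.\<close>

lemma kapex_if_edge_4_3:
  assumes G: "simple_graph V E" "card E = 20" and d3: "\<And>v. v \<in> V \<Longrightarrow> 3 \<le> deg E v"
    and d4: "\<And>v. v \<in> V \<Longrightarrow> deg E v \<le> 4" and n: "11 \<le> card V"
    and a: "a \<in> V" "deg E a = 4" and r: "r \<in> V" "deg E r = 3" "{a, r} \<in> E"
  shows "kapex 2 V E"
proof (rule ccontr)
  assume na: "\<not> kapex 2 V E"
  have fin: "finite V" "finite E" using G(1) simple_graph_finite_edges by (auto simp: simple_graph_def)
  let ?V = "V - {a}" and ?E = "del {a} E"
  have sg: "simple_graph ?V ?E" by (rule simple_graph_del[OF G(1)])
  have cV: "card ?V = card V - 1" using fin a by simp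
  have c16: "card ?E = 16" using card_del[OF fin(2), of a] a G(2) by simp
  have fin1: "finite ?E" using fin(2) by (simp add: del_def)
  have na1: "\<not> kapex 1 ?V ?E" using not_kapex_del[of V 1 E a] na a(1) fin(1) by (simp add: numeral_2_eq_2)
  have ra: "r \<noteq> a" using a r by auto
  have r2: "deg ?E r = 2" using deg_del[OF G(1) ra] r by simp
  have dd: "2 \<le> deg ?E u" "deg ?E u \<le> 4" if "u \<in> ?V" for u
    using deg_del[OF G(1), of u a] that d3[of u] d4[of u] by (auto split: if_splits)
  have rV: "r \<in> ?V" using r(1) ra by simp
  show False
    using sg rV eq_refl[OF r2] na1
  proof (cases rule: not_kapex_reduceE)
    case delete
    have "card (del {r} ?E) \<le> 14" using card_del[OF fin1, of r] r2 c16 by simp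
    thus False using apex_if_card_le_14[OF simple_graph_del[OF sg]] delete by blast
  next
    case (smooth x y)
    let ?W = "?V - {r}" and ?F = "insert {x, y} (del {r} ?E)"
    have sg2: "simple_graph ?W ?F" using simple_graph_del[OF sg, of "{r}"] smooth(1-5) by (auto simp: simple_graph_def)
    have "{x, y} \<notin> del {r} ?E" using smooth(8) by (auto simp: del_def)
    moreover have "finite (del {r} ?E)" by (rule simple_graph_finite_edges[OF simple_graph_del[OF sg]])
    ultimately have c15: "card ?F = 15" using card_del[OF fin1, of r] r2 c16 by simp
    have ds: "deg ?F u = deg ?E u" if "u \<in> ?W" for u
      by (rule deg_smooth[OF sg _ smooth(5,8,10)]) (use that smooth(3,4) in auto)
    have d0: "deg ?F u \<noteq> 0" if "u \<in> ?W" for u using ds[OF that] dd(1)[of u] that by force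
    have d3': "3 \<le> deg ?F u" if "u \<in> ?W" for u by (rule not_apex_15_min_degree[OF sg2 c15 smooth(11) d0 that])
    have d5': "deg ?F u \<le> 5" if "u \<in> ?W" for u using ds[OF that] dd(2)[of u] that by force
    have cW: "card ?W = card V - 2" using cV rV fin(1) by simp
    have c8: "8 \<le> card ?W" using cW n by linarith
    have "card ?W = 8 \<and> (copy 8 k44e ?W ?F \<or> copy 8 p8 ?W ?F) \<or> card ?W = 9 \<and> copy 9 p9 ?W ?F \<or> card ?W = 10 \<and> copy 10 p10 ?W ?F"
      by (rule not_apex_15[OF sg2 c15 smooth(11) d3' d5' c8])
    \<comment> \<open>With at least 11 vertices to begin with, at least 9 remain, so the members on
      8 vertices drop out.\<close>
    hence cases: "card ?W = 9 \<and> copy 9 p9 ?W ?F \<or> card ?W = 10 \<and> copy 10 p10 ?W ?F" using cW n by auto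
    have len: "length p9 = 15" "length p10 = 15" by (simp_all add: p9_def p10_def)
    have sub: "\<exists>i j. (i, j) \<in> set es \<and> copy (Suc s) (subdivide s i j es) ?V ?E"
      if es: "card ?W = s" "copy s es ?W ?F" "ordered_pairs s es" "length es = 15" for s es
    proof -
      obtain f where f: "bij_betw f {..<s} ?W" "?F = (\<lambda>(i, j). {f i, f j}) ` set es"
        using copy_exact[OF es(2,3) sg2 es(1)] c15 es(4) by metis
      have fe: "{f i, f j} \<in> ?F" if "(i, j) \<in> set es" for i j
        unfolding f(2) using that by (intro image_eqI[of _ _ "(i, j)"]) auto
      have "{x, y} \<in> (\<lambda>(i, j). {f i, f j}) ` set es" unfolding f(2)[symmetric] by simp
      then obtain i j where ij: "(i, j) \<in> set es" "{x, y} = {f i, f j}" by auto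
      have "inj_on f {..<s}" "f ` {..<s} \<subseteq> ?V - {r}" using f(1) by (auto simp: bij_betw_def)
      \<comment> \<open>The first alternative would make \<open>xy\<close> an edge before smoothing,
        because the isomorphism onto the smoothed graph covers \<open>xy\<close>. Hence the copy is
        subdivided at some edge.\<close>
      from copy_smooth[OF this fe rV smooth(6,7) es(3)] show ?thesis
        using ij smooth(8) by metis
    qed
    have cV1: "card ?V = Suc (card ?W)" using cW cV n by simp
    have step: False
      if "chk n 2 20 (\<lambda>i. if i = s then 4 else 3) (\<lambda>_. 4) [] es (es @ star s) t" "n = Suc s" "ordered_pairs s es"
        "card ?V = s" "length es = 16" "copy s es ?V ?E" for n s es t
      using extend_step[OF that(1-4) _ that(6) G(1) _ a d3 d4] that(5) c16 G(2) na by simp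
    from cases show False
    proof
      assume H: "card ?W = 9 \<and> copy 9 p9 ?W ?F"
      then obtain i j where ij: "(i, j) \<in> set p9" "copy (Suc 9) (subdivide 9 i j p9) ?V ?E"
        using sub[of 9 p9] ordered_named len by blast
      obtain t where t: "chk 11 2 20 (\<lambda>i. if i = 10 then 4 else 3) (\<lambda>_. 4) [] (subdivide 9 i j p9) (subdivide 9 i j p9 @ star 10) t"
        using list_all2_ex[OF cert_extend_subdivided_p9 ij(1)] by auto
      have o: "ordered_pairs 9 p9" using ordered_named by simp
      show False
        by (rule step[OF t]) (use ordered_subdivide[OF o ij(1)] length_subdivide[OF o ij(1)] ij(2) len H cV1 in simp_all)
    next
      assume H: "card ?W = 10 \<and> copy 10 p10 ?W ?F"
      then obtain i j where ij: "(i, j) \<in> set p10" "copy (Suc 10) (subdivide 10 i j p10) ?V ?E"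
        using sub[of 10 p10] ordered_named len by blast
      obtain p where p: "embeds 11 (subdivide 10 i j p10) 11 (subdivide 10 0 4 p10) p"
        using list_all2_ex[OF p10_edge_transitive ij(1)] by auto
      have o: "ordered_pairs 10 p10" using ordered_named by simp
      have m: "(0, 4) \<in> set p10" by (simp add: p10_def)
      obtain g where g: "inj_on g {..<11}" "g ` {..<11} \<subseteq> ?V" "\<And>a b. (a, b) \<in> set (subdivide 10 i j p10) \<Longrightarrow> {g a, g b} \<in> ?E"
        using ij(2) unfolding copy_def by auto
      \<comment> \<open>Edge-transitivity moves the subdivided edge to 04, the only position that
        was searched.\<close>
      have "copy 11 (subdivide 10 0 4 p10) ?V ?E"
        by (rule embeds_copy[OF p g]) (use ordered_pairsD[OF ordered_subdivide[OF o m]] in force)+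
      thus False
        by (intro step[OF cert_extend_subdivided_p10])
           (use ordered_subdivide[OF o m] length_subdivide[OF o m] len H cV1 in simp_all)
    qed
  qed
qed

lemma kapex_if_card_20_max_degree_4:
  assumes G: "simple_graph V E" "card E = 20" and d3: "\<And>v. v \<in> V \<Longrightarrow> 3 \<le> deg E v"
    and d4: "\<And>v. v \<in> V \<Longrightarrow> deg E v \<le> 4"
  shows "kapex 2 V E"
proof (cases "card V = 10")
  case True
  have "deg E u = 4" if "u \<in> V" for u by (rule regular_if_tight[OF G(1) d4 _ that]) (use True G(2) in simp_all)
  thus ?thesis by (intro regular_step[OF cert_regular_10 _ _ True _ _ _ _ G(1)]) (use G(2) in simp_all)
next
  case False
  have fin: "finite V" "finite E" using G(1) simple_graph_finite_edges by (auto simp: simple_graph_def)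
  have "10 \<le> card V" using deg_sum_le[OF G(1) d4] G(2) by simp
  hence n: "11 \<le> card V" using False by simp
  have d34: "deg E v = 3 \<or> deg E v = 4" if "v \<in> V" for v using d3[OF that] d4[OF that] by linarith
  show ?thesis
  proof (cases "\<exists>a\<in>V. \<exists>r\<in>V. deg E a = 4 \<and> deg E r = 3 \<and> {a, r} \<in> E")
    case True
    thus ?thesis using kapex_if_edge_4_3[OF G d3 d4 n] by blast
  next
    case noedge: False
    define Q where "Q = {v \<in> V. deg E v = 4}"
    define R where "R = {v \<in> V. deg E v = 3}"
    have QR: "V = Q \<union> R" "Q \<inter> R = {}" using d34 by (auto simp: Q_def R_def)
    have finQR: "finite Q" "finite R" using fin by (auto simp: Q_def R_def)
    have "(\<Sum>v\<in>V. deg E v) = (\<Sum>v\<in>Q. deg E v) + (\<Sum>v\<in>R. deg E v)"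
      unfolding QR(1) by (rule sum.union_disjoint[OF finQR QR(2)])
    also have "\<dots> = 4 * card Q + 3 * card R" by (simp add: Q_def R_def)
    finally have s: "4 * card Q + 3 * card R = 40" using handshake[OF G(1)] G(2) by simp
    have cQR: "card V = card Q + card R" using QR finQR card_Un_disjoint by metis
    have closedQ: "w \<in> Q" if "u \<in> Q" "{u, w} \<in> E" for u w
    proof -
      have "u \<in> V" "w \<in> V" using G(1) that(2) by (auto simp: simple_graph_def)
      thus ?thesis using noedge d34[of w] that by (auto simp: Q_def)
    qed
    have closedR: "w \<in> R" if "u \<in> R" "{u, w} \<in> E" for u w
    proof -
      have "u \<in> V" "w \<in> V" using G(1) that(2) by (auto simp: simple_graph_def)
      thus ?thesis using noedge d34[of w] that by (auto simp: R_def insert_commute)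
    qed
    have nbrs: "deg E u \<le> card (X - {u})" "card (X - {u}) \<le> deg E u \<Longrightarrow> w \<in> X \<Longrightarrow> w \<noteq> u \<Longrightarrow> {u, w} \<in> E"
      if X: "finite X" "u \<in> X" "\<And>w. {u, w} \<in> E \<Longrightarrow> w \<in> X" for u w X
    proof -
      have fX: "finite ((\<lambda>w. {u, w}) ` (X - {u}))" using X(1) by simp
      have sub: "{e \<in> E. u \<in> e} \<subseteq> (\<lambda>w. {u, w}) ` (X - {u})"
      proof
        fix e assume e: "e \<in> {e \<in> E. u \<in> e}"
        hence "card e = 2" using G(1) by (auto simp: simple_graph_def)
        then obtain w where "e = {u, w}" "w \<noteq> u" using e by (auto simp: card_2_iff insert_commute)
        thus "e \<in> (\<lambda>w. {u, w}) ` (X - {u})" using X(3) e by auto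
      qed
      have ci: "card ((\<lambda>w. {u, w}) ` (X - {u})) = card (X - {u})"
        by (rule card_image) (auto simp: inj_on_def doubleton_eq_iff)
      show "deg E u \<le> card (X - {u})" unfolding deg_def ci[symmetric] by (rule card_mono[OF fX sub])
      assume "card (X - {u}) \<le> deg E u" "w \<in> X" "w \<noteq> u"
      hence "{e \<in> E. u \<in> e} = (\<lambda>w. {u, w}) ` (X - {u})"
        using card_seteq[OF fX sub] ci unfolding deg_def by simp
      thus "{u, w} \<in> E" using \<open>w \<in> X\<close> \<open>w \<noteq> u\<close> by blast
    qed
    \<comment> \<open>A cubic graph would need a degree sum of 40 divisible by 3.\<close>
    have "Q \<noteq> {}"
    proof
      assume "Q = {}"
      hence "3 * card R = 40" using s by simp
      thus False by presburger
    qed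
    then obtain q where q: "q \<in> Q" by blast
    have "4 \<le> card (Q - {q})" using nbrs(1)[OF finQR(1) q closedQ[OF q]] q by (simp add: Q_def)
    hence "5 \<le> card Q" using q finQR by simp
    \<comment> \<open>The degree sum gives 3 |V| + |Q| = 40. With |Q| at least 5 and |V| at least 11
      this leaves |V| = 11, |Q| = 7 and |R| = 4; the four vertices of \<open>R\<close>, of degree 3
      and joined only to each other, form a complete component.\<close>
    hence "card V \<le> 11" using s cQR by linarith
    hence R4: "card R = 4" using s cQR n by linarith
    have complete: "{u, w} \<in> E" if "u \<in> R" "w \<in> R" "u \<noteq> w" for u w
      by (rule nbrs(2)[OF finQR(2) that(1) closedR[OF that(1)] _ that(2)]) (use that R4 finQR in \<open>auto simp: R_def\<close>)
    show ?thesis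
    proof (rule kapex_K4_component[OF G(1) _ _ R4 complete closedR])
      show "card E \<le> 20" "R \<subseteq> V" using G(2) by (auto simp: R_def)
      show "deg E u = 3" if "u \<in> R" for u using that by (simp add: R_def)
    qed
  qed
qed

text \<open>The induction runs over the number of vertices only, since the edge set is first
  enlarged to exactly 20 edges; reductions never exceed that number.\<close>

lemma kapex_if_card_le_20:
  "simple_graph V E \<Longrightarrow> card E \<le> 20 \<Longrightarrow> kapex 2 V E"
proof (induction "card V" arbitrary: V E rule: less_induct)
  case less
  show ?case
  proof (rule ccontr)
    assume na0: "\<not> kapex 2 V E"
    have fin: "finite V" using less.prems(1) by (simp add: simple_graph_def)
    have n7: "7 \<le> card V" using kapex_card_le[OF less.prems(1), of 2] na0 by linarith
    \<comment> \<open>Seven vertices offer 21 pairs, so there is room for 20 edges.\<close>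
    have "42 \<le> card V * (card V - 1)" using mult_le_mono[OF n7, of 6 "card V - 1"] n7 by simp
    hence "20 \<le> card V choose 2" by (simp add: choose_two)
    then obtain F where F: "simple_graph V F" "E \<subseteq> F" "card F = 20" using edges_extend[OF less.prems] by blast
    have na: "\<not> kapex 2 V F" using na0 kapex_mono F(2) by blast
    have finF: "finite F" by (rule simple_graph_finite_edges[OF F(1)])
    have d3: "3 \<le> deg F v" if v: "v \<in> V" for v
    proof (rule ccontr)
      assume "\<not> 3 \<le> deg F v"
      hence "deg F v \<le> 2" by simp
      then obtain E' where "simple_graph (V - {v}) E'" "\<not> kapex 2 (V - {v}) E'" "card E' \<le> card F"
        using not_kapex_reduce[OF F(1) v _ na] by blast
      moreover have "card (V - {v}) < card V" using fin v by (metis card_Diff1_less)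
      ultimately show False using less.hyps[of "V - {v}" E'] F(3) by simp
    qed
    \<comment> \<open>A vertex of degree at least 6 leaves at most 14 edges, and then one further
      deletion suffices.\<close>
    have d5: "deg F v \<le> 5" if v: "v \<in> V" for v
    proof (rule ccontr)
      assume "\<not> deg F v \<le> 5"
      hence "card (del {v} F) \<le> 14" using card_del[OF finF, of v] F(3) by linarith
      hence "kapex 1 (V - {v}) (del {v} F)" by (rule apex_if_card_le_14[OF simple_graph_del[OF F(1)]])
      thus False using kapex_Suc[OF fin v, of 1 F] na by (simp add: numeral_2_eq_2)
    qed
    show False
    proof (cases "\<exists>a\<in>V. deg F a = 5")
      case True
      thus False using kapex_if_card_20_max_degree_5[OF F(1,3) d3 d5] na by blast
    next
      case False
      hence "deg F v \<le> 4" if "v \<in> V" for v using d5[OF that] that by fastforce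
      thus False using kapex_if_card_20_max_degree_4[OF F(1,3) d3] na by blast
    qed
  qed
qed

theorem theorem1p2:
  fixes V :: "'a set" and E :: "'a set set"
  assumes "simple_graph V E" and "card E \<le> 20"
  shows "two_apex V E"
proof -
  obtain S where S: "S \<subseteq> V" "card S \<le> 2" "thick (V - S) (del S E)"
    using kapex_if_card_le_20[OF assms] by (auto simp: kapex_def)
  have "finite S" using S(1) assms(1) finite_subset by (auto simp: simple_graph_def)
  thus ?thesis using S thick_imp_planar[OF S(3)] unfolding two_apex_def del_def by blast
qed

end
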